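(* Let $(k_1,\alpha_1),\dots,(k_n,\alpha_n)$ be an admissible sequence. Then the random vector $(\widehat{\mathcal{V}}_{k_1}^{(\alpha_1)},\dots,\widehat{\mathcal{V}}_{k_n}^{(\alpha_n)})$ has the asymptotic covariance matrix $$\Sigma=\begin{cases}A^{<1}_0 & \text{if }\lim_{t\to\infty}t\delta_t^d=0,\\[2pt] \sum_{m=0}^{2k_n}A^{<1}_m\,c^{m/2} & \text{if }\lim_{t\to\infty}t\delta_t^d=c\in(0,1],\\[2pt] \sum_{m=0}^{k_n}A^{>1}_m\,c^{-m} & \text{if }\lim_{t\to\infty}t\delta_t^d=c\in[1,\infty),\\[2pt] A^{>1}_0 & \text{if }\lim_{t\to\infty}t\delta_t^d=\infty,\end{cases}$$ that is, in each of these cases $\lim_{t\to\infty}\mathrm{Cov}(\widehat{\mathcal{V}}_{k_l}^{(\alpha_l)},\widehat{\mathcal{V}}_{k_j}^{(\alpha_j)})=\Sigma_{lj}$ for all $l,j\in\{1,\dots,n\}$.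
   Context: Fix $d\ge 1$ and a compact convex set $W\subset\mathbb{R}^d$ of volume $1$. For $t>0$ let $\eta_t$ be a Poisson point process on $W$ with constant intensity $t$ (intensity measure $t\,dx$ on $W$), and let $\delta_t>0$ be real numbers with $\delta_t\to0$ as $t\to\infty$. Let $B^d$ be the unit ball of $\mathbb{R}^d$ centered at the origin. For $s>0$ and points $x_0,\dots,x_k\in\mathbb{R}^d$, $\Delta_s[x_0,\dots,x_k]$ denotes the $k$-dimensional volume of the convex hull of $x_0,\dots,x_k$ if $\|x_i-x_j\|\le s$ for all $i,j$, and $0$ otherwise. The power $\Delta_s[x_0,\dots,x_k]^\alpha$ is understood as the $\alpha$-th power of this volume times the indicator that all pairwise distances are at most $s$ (so it is $0$ if some pairwise distance exceeds $s$, also for $\alpha\le 0$; for $\alpha=0$ it is this indicator). For $k>d$ only $\alpha=0$ is used, and $\Delta_s[x_0,\dots,x_k]^0$ is the indicator that all pairwise distances are at most $s$. For $k=0$, $\Delta_s[x_0]=1$. The volume-power functional of the Vietoris-Rips complex is $$\mathcal{V}_k^{(\alpha)}=\frac1{(k+1)!}\sum_{(x_0,\dots,x_k)\in\eta_{t,\neq}^{k+1}}\Delta_{\delta_t}[x_0,\dots,x_k]^\alpha,$$ where $\eta_{t,\neq}^{k+1}$ is the set of $(k+1)$-tuples of distinct points of $\eta_t$. A sequence $(k_1,\alpha_1),\dots,(k_n,\alpha_n)$ (with $k_i$ integers, $\alpha_i$ real) is admissible if (i) $0\le k_1\le\dots\le k_n$; (ii) the pairs $(k_i,\alpha_i)$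 are distinct; (iii) $\alpha_i=0$ for $k_i>d$; (iv) $\min\{\alpha_i,\alpha_j,\alpha_i+\alpha_j\}>-d$ for all $i,j\in\{1,\dots,n\}$. Normalization: $\widehat{\mathcal{V}}_{k_i}^{(\alpha_i)}=\mathcal{V}_{k_i}^{(\alpha_i)}/Q_i$ with $$Q_i=t^{1/2}\,\delta_t^{\alpha_ik_i}\max_{1\le m\le k_i+1}(t\delta_t^d)^{k_i-\frac{m-1}2}.$$ For integers $p\le q$, $1\le m\le p+1$ and reals $\alpha,\beta$, $$\mu_{p,q:m}^{(\alpha,\beta)}=\int_{(B^d)^{p+q+1-m}}\Delta_1[0,\{x_l\}_{l=1}^{p}]^{\alpha}\,\Delta_1[0,\{x_l\}_{l=p-m+2}^{p+q-m+1}]^{\beta}\,dx_1\cdots dx_{p+q-m+1},$$ where $\{x_l\}_{l=a}^{b}$ stands for the points $x_a,\dots,x_b$ (no points if $b<a$; an integral over no variables equals the integrand), and $\mu_{q,p:m}^{(\beta,\alpha)}=\mu_{p,q:m}^{(\alpha,\beta)}$. The $n\times n$ matrices are: for $m=0,\dots,2k_n$, $$(A^{<1}_m)_{lj}=\mu_{k_l,k_j:\frac{k_l+k_j-m+2}2}^{(\alpha_l,\alpha_j)}\;\frac{\mathbf{1}\big(m-|k_l-k_j|\in\{0,2,4,\dots,2\min(k_l,k_j)\}\big)}{\big(\frac{k_l+k_j-m+2}2\big)!\,\big(\frac{m-k_l+k_j}2\big)!\,\big(\frac{m+k_l-k_j}2\big)!},$$ and for $m=0,\dots,k_n$, $$(A^{>1}_m)_{lj}=\mu_{k_l,k_j:m+1}^{(\alpha_l,\alpha_j)}\;\frac{\mathbf{1}(m\le\min(k_l,k_j))}{(m+1)!\,(k_l-m)!\,(k_j-m)!},$$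 where an entry is $0$ whenever its indicator vanishes.
   Formalization: The formal theorem also assumes that each μ_{k_i,k_i:k_i+1}^{(α_i,α_i)} is finite (finite variance); admissibility does not give this when k_i≥2 and α_i<0, e.g. d=k=2, α=-3/4, where the variance is infinite and the claim fails as tδ_t^d→∞. *)

theory Defs
  imports "HOL-Probability.Probability"
begin

text \<open>
  The point process is realised as a random finite set of points, which loses nothing as long as the
  intensity measure is finite and has no atoms (then the process is almost surely simple).
  The Poisson law is written out because the library's \<open>poisson_pmf\<close> is only specified for
  positive rates, whereas sets of intensity \<open>0\<close> occur here.
\<close>

definition poisson_process :: "'w measure \<Rightarrow> 'a measure \<Rightarrow> ('w \<Rightarrow> 'a set) \<Rightarrow> bool" where
  "poisson_process M \<mu> \<eta> \<longleftrightarrow>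
     prob_space M \<and>
     (\<forall>\<omega>\<in>space M. finite (\<eta> \<omega>) \<and> \<eta> \<omega> \<subseteq> space \<mu>) \<and>
     (\<forall>B\<in>sets \<mu>. (\<lambda>\<omega>. card (\<eta> \<omega> \<inter> B)) \<in> M \<rightarrow>\<^sub>M count_space UNIV) \<and>
     (\<forall>B\<in>sets \<mu>. \<forall>n. measure M {\<omega>\<in>space M. card (\<eta> \<omega> \<inter> B) = n} =
        measure \<mu> B ^ n / fact n * exp (- measure \<mu> B)) \<and>
     (\<forall>r (B :: nat \<Rightarrow> 'a set). B ` {..<r} \<subseteq> sets \<mu> \<and> disjoint_family_on B {..<r} \<longrightarrow>
        prob_space.indep_vars M (\<lambda>_. count_space UNIV) (\<lambda>i \<omega>. card (\<eta> \<omega> \<inter> B i)) {..<r})"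

definition intensity :: "'a::euclidean_space set \<Rightarrow> real \<Rightarrow> 'a measure" where
  "intensity W t = scale_measure (ennreal t) (restrict_space lborel W)"

definition covariance :: "'w measure \<Rightarrow> ('w \<Rightarrow> real) \<Rightarrow> ('w \<Rightarrow> real) \<Rightarrow> real" where
  "covariance M X Y =
     (\<integral>\<omega>. (X \<omega> - (\<integral>\<omega>'. X \<omega>' \<partial>M)) * (Y \<omega> - (\<integral>\<omega>'. Y \<omega>' \<partial>M)) \<partial>M)"

text \<open>
  The integrability clause says that the covariances exist, so that the limit is not
  about the default value \<open>0\<close> of the Bochner integral.
\<close>

definition asymptotic_covariance ::
  "nat \<Rightarrow> (real \<Rightarrow> 'w measure) \<Rightarrow> (real \<Rightarrow> nat \<Rightarrow> 'w \<Rightarrow> real) \<Rightarrow> (nat \<Rightarrow> nat \<Rightarrow> real) \<Rightarrow> bool" where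
  "asymptotic_covariance n M X \<Sigma> \<longleftrightarrow>
     (\<forall>l\<in>{1..n}. \<forall>j\<in>{1..n}.
        (\<forall>\<^sub>F t in at_top. integrable (M t) (X t l) \<and> integrable (M t) (X t j) \<and>
           integrable (M t) (\<lambda>\<omega>. X t l \<omega> * X t j \<omega>)) \<and>
        ((\<lambda>t. covariance (M t) (X t l) (X t j)) \<longlongrightarrow> \<Sigma> l j) at_top)"

text \<open>
  Lebesgue measure of the affine subspace \<open>p + span B\<close>, for an orthonormal set \<open>B\<close>; the definition is
  that of \<open>lborel\<close> with \<open>Basis\<close> replaced by \<open>B\<close>. The \<open>k\<close>-dimensional volume of a
  set contained in a \<open>k\<close>-dimensional affine subspace is its Lebesgue measure there, which does
  not depend on the chosen \<open>p\<close>, \<open>B\<close>.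
\<close>

definition flat_lborel :: "'a::euclidean_space \<Rightarrow> 'a set \<Rightarrow> 'a measure" where
  "flat_lborel p B = distr (\<Pi>\<^sub>M b\<in>B. lborel) borel (\<lambda>f. p + (\<Sum>b\<in>B. f b *\<^sub>R b))"

definition orthonormal :: "'a::euclidean_space set \<Rightarrow> bool" where
  "orthonormal B \<longleftrightarrow> pairwise orthogonal B \<and> (\<forall>b\<in>B. norm b = 1)"

definition kvol :: "nat \<Rightarrow> 'a::euclidean_space set \<Rightarrow> real" where
  "kvol k S = (SOME v. \<exists>p B. orthonormal B \<and> card B = k \<and> S \<subseteq> (+) p ` span B \<and>
     v = measure (flat_lborel p B) S)"

text \<open>
  \<open>Delta_pow s \<alpha> [x\<^sub>0, \<dots>, x\<^sub>k]\<close> is the power \<open>\<Delta>\<^sub>s[x\<^sub>0, \<dots>, x\<^sub>k]\<^sup>\<alpha>\<close>. The case \<open>\<alpha> = 0\<close> is separate since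
  \<open>0 powr 0 = 0\<close>; it also covers \<open>k > d\<close>, where \<open>kvol\<close> is unspecified. For negative \<open>\<alpha>\<close>, degenerate
  simplices contribute \<open>0 powr \<alpha> = 0\<close>; they form a null set.
\<close>

definition Delta_pow :: "real \<Rightarrow> real \<Rightarrow> 'a::euclidean_space list \<Rightarrow> real" where
  "Delta_pow s \<alpha> xs =
     (if \<forall>x\<in>set xs. \<forall>y\<in>set xs. norm (x - y) \<le> s
      then (if \<alpha> = 0 then 1 else kvol (length xs - 1) (convex hull (set xs)) powr \<alpha>)
      else 0)"

definition vol_power :: "real \<Rightarrow> nat \<Rightarrow> real \<Rightarrow> 'a::euclidean_space set \<Rightarrow> real" where
  "vol_power s k \<alpha> X =
     (\<Sum>xs | length xs = k + 1 \<and> distinct xs \<and> set xs \<subseteq> X. Delta_pow s \<alpha> xs) / fact (k + 1)"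

definition normalizer :: "nat \<Rightarrow> real \<Rightarrow> nat \<Rightarrow> real \<Rightarrow> real \<Rightarrow> real" where
  "normalizer d t k \<alpha> s = sqrt t * s powr (\<alpha> * real k) *
     Max ((\<lambda>m. (t * s ^ d) powr (real k - (real m - 1) / 2)) ` {1..k + 1})"

definition vol_power_hat :: "real \<Rightarrow> real \<Rightarrow> nat \<Rightarrow> real \<Rightarrow> 'a::euclidean_space set \<Rightarrow> real" where
  "vol_power_hat t s k \<alpha> X = vol_power s k \<alpha> X / normalizer DIM('a) t k \<alpha> s"

definition admissible :: "nat \<Rightarrow> nat \<Rightarrow> (nat \<Rightarrow> nat) \<Rightarrow> (nat \<Rightarrow> real) \<Rightarrow> bool" where
  "admissible d n k \<alpha> \<longleftrightarrow>
     (\<forall>i\<in>{1..n}. \<forall>j\<in>{1..n}. i \<le> j \<longrightarrow> k i \<le> k j) \<and>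
     inj_on (\<lambda>i. (k i, \<alpha> i)) {1..n} \<and>
     (\<forall>i\<in>{1..n}. k i > d \<longrightarrow> \<alpha> i = 0) \<and>
     (\<forall>i\<in>{1..n}. \<forall>j\<in>{1..n}. Min {\<alpha> i, \<alpha> j, \<alpha> i + \<alpha> j} > - real d)"

text \<open>
  For \<open>p \<le> q\<close> and \<open>1 \<le> m \<le> p + 1\<close> no subtraction below is truncated. The \<open>m - 1\<close> variables with
  indices \<open>p - m + 2, \<dots>, p\<close> occur in both factors.
\<close>

definition mu_domain :: "nat \<Rightarrow> nat \<Rightarrow> nat \<Rightarrow> (nat \<Rightarrow> 'a::euclidean_space) set" where
  "mu_domain p q m = (\<Pi>\<^sub>E i\<in>{1..p + q + 1 - m}. cball 0 1)"

definition mu_integrand ::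
  "nat \<Rightarrow> nat \<Rightarrow> nat \<Rightarrow> real \<Rightarrow> real \<Rightarrow> (nat \<Rightarrow> 'a::euclidean_space) \<Rightarrow> real" where
  "mu_integrand p q m \<alpha> \<beta> x =
     Delta_pow 1 \<alpha> (0 # map x [1..<p + 1]) *
     Delta_pow 1 \<beta> (0 # map x [p + 2 - m..<p + q + 2 - m])"

definition mu_integral ::
  "'a::euclidean_space itself \<Rightarrow> nat \<Rightarrow> nat \<Rightarrow> nat \<Rightarrow> real \<Rightarrow> real \<Rightarrow> real" where
  "mu_integral _ p q m \<alpha> \<beta> =
     (LINT x:(mu_domain p q m :: (nat \<Rightarrow> 'a) set)|(\<Pi>\<^sub>M i\<in>{1..p + q + 1 - m}. lborel).
        mu_integrand p q m \<alpha> \<beta> x)"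

text \<open>
  Absolute convergence of the integral does not follow from admissibility: the \<open>k\<close>-dimensional volume
  raised to the power \<open>2 * \<alpha>\<close> is integrable iff \<open>2 * \<alpha> > k - 1 - d\<close> (for \<open>1 \<le> k \<le> d\<close>), which is stronger
  than \<open>2 * \<alpha> > - d\<close> when \<open>k \<ge> 2\<close>. Without it the corresponding functional has infinite variance.
\<close>

definition mu_converges ::
  "'a::euclidean_space itself \<Rightarrow> nat \<Rightarrow> nat \<Rightarrow> nat \<Rightarrow> real \<Rightarrow> real \<Rightarrow> bool" where
  "mu_converges _ p q m \<alpha> \<beta> \<longleftrightarrow>
     set_integrable (\<Pi>\<^sub>M i\<in>{1..p + q + 1 - m}. lborel)
       (mu_domain p q m :: (nat \<Rightarrow> 'a) set) (mu_integrand p q m \<alpha> \<beta>)"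

definition mu ::
  "'a::euclidean_space itself \<Rightarrow> nat \<Rightarrow> nat \<Rightarrow> nat \<Rightarrow> real \<Rightarrow> real \<Rightarrow> real" where
  "mu T p q m \<alpha> \<beta> = (if p \<le> q then mu_integral T p q m \<alpha> \<beta> else mu_integral T q p m \<beta> \<alpha>)"

text \<open>
  When the condition on \<open>m\<close> holds, \<open>m \<le> k l + k j\<close>, the three numerators are even and natural
  subtraction is exact.
\<close>

definition A_lt ::
  "'a::euclidean_space itself \<Rightarrow> (nat \<Rightarrow> nat) \<Rightarrow> (nat \<Rightarrow> real) \<Rightarrow> nat \<Rightarrow> nat \<Rightarrow> nat \<Rightarrow> real" where
  "A_lt T k \<alpha> m l j =
     (if int m - \<bar>int (k l) - int (k j)\<bar> \<in> (\<lambda>i. 2 * int i) ` {0..min (k l) (k j)}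
      then mu T (k l) (k j) ((k l + k j + 2 - m) div 2) (\<alpha> l) (\<alpha> j) /
        (fact ((k l + k j + 2 - m) div 2) * fact ((m + k j - k l) div 2) *
         fact ((m + k l - k j) div 2))
      else 0)"

definition A_gt ::
  "'a::euclidean_space itself \<Rightarrow> (nat \<Rightarrow> nat) \<Rightarrow> (nat \<Rightarrow> real) \<Rightarrow> nat \<Rightarrow> nat \<Rightarrow> nat \<Rightarrow> real" where
  "A_gt T k \<alpha> m l j =
     (if m \<le> min (k l) (k j)
      then mu T (k l) (k j) (m + 1) (\<alpha> l) (\<alpha> j) /
        (fact (m + 1) * fact (k l - m) * fact (k j - m))
      else 0)"

end

theory Submission
  imports Defs
begin

text \<open>
  The covariance of two of the functionals is computed exactly, and its limit is then read off term by term.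

  Write the product of the functionals for \<open>(p, \<alpha>)\<close> and \<open>(q, \<beta>)\<close> as a sum over pairs of a set of \<open>p + 1\<close>
  points and a set of \<open>q + 1\<close> points of the process, and sort the pairs by the number \<open>m\<close> of common points
  (\<open>subset_sum_mult\<close>). The expectation of the sum over the pairs with \<open>m\<close> common points is, by the multivariate
  Mecke formula \<open>mecke\<close>, a multiple of \<open>t ^ r\<close> times an integral over \<open>W ^ r\<close>, where \<open>r = p + q + 2 - m\<close> is the number of
  distinct points of such a pair. For \<open>m = 0\<close> this integral is a product, and the term is exactly the product of the
  two expectations. So the covariance is the sum over \<open>m \<ge> 1\<close> (\<open>vol_power_moments\<close>).

  For \<open>m \<ge> 1\<close> all points of a pair lie close to one common point \<open>x\<^sub>0\<close>. The substitution
  \<open>x\<^sub>i = x\<^sub>0 + \<delta> y\<^sub>i\<close> and the homogeneity of the volume take out all powers of \<open>\<delta>\<close>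
  (\<open>nn_integral_overlap_tuple\<close>). In the integral that is left, \<open>\<delta>\<close> occurs only in the condition that the points
  \<open>x\<^sub>0 + \<delta> y\<^sub>i\<close> lie in \<open>W\<close>. This condition is fulfilled in the limit for every interior point
  \<open>x\<^sub>0\<close>; the boundary of a convex set is a null set and \<open>W\<close> has volume 1, so dominated convergence gives the
  limit \<open>\<mu>\<close> (\<open>window_integral_tendsto\<close>). The dominating function is integrable because a product is at most the
  sum of the squares, and the squares are integrable by assumption (\<open>mu_converges_cross\<close>).

  With \<open>u = t \<delta> ^ d\<close>, the powers of \<open>t\<close> and \<open>\<delta>\<close> divided by the two normalizations amount to
  \<open>u powr (p + q + 1 - m)\<close> divided by the two maxima of powers of \<open>u\<close>; call this the growth ratio. For \<open>u \<le> 1\<close> it is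
  \<open>u powr ((p + q + 2 - 2 m) / 2)\<close>, for \<open>u \<ge> 1\<close> it is \<open>u powr (1 - m)\<close>. Its limits in the four regimes are the
  coefficients in the four formulas.

  This rests on two facts. The \<open>k\<close>-dimensional volume, which is defined by an arbitrary choice of an orthonormal system,
  is a measurable and homogeneous function of the vertices, by the explicit formula \<open>kvol_simplex\<close>. And the counts of
  points in disjoint sets, which are independent Poisson variables, determine the expected number of tuples of distinct
  points in every measurable set of tuples, since boxes with disjoint sides generate these sets (\<open>mecke_set\<close>).
\<close>

section \<open>Products of Lebesgue measure\<close>

interpretation lborel_product: product_sigma_finite "\<lambda>_::'i. lborel :: 'a::euclidean_space measure"
  by standard

text \<open>
  Each coordinate may be translated by a different vector. With \<open>s = 1\<close> this is translation invariance; with the same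
  vector in all coordinates it is the substitution that rescales a cluster of points around its base point.
\<close>

lemma nn_integral_PiM_lborel_affine:
  fixes a :: "'i \<Rightarrow> 'a::euclidean_space"
  assumes I: "finite I" and s: "s > 0"
    and f [measurable]: "f \<in> borel_measurable (\<Pi>\<^sub>M i\<in>I. (lborel::'a measure))"
  shows "(\<integral>\<^sup>+x. f x \<partial>(\<Pi>\<^sub>M i\<in>I. lborel)) =
     ennreal (s ^ (DIM('a) * card I)) *
     (\<integral>\<^sup>+x. f (\<lambda>i\<in>I. a i + s *\<^sub>R x i) \<partial>(\<Pi>\<^sub>M i\<in>I. (lborel::'a measure)))"
proof -
  let ?P = "\<Pi>\<^sub>M i\<in>I. (lborel::'a measure)"
  let ?T = "\<lambda>x. \<lambda>i\<in>I. a i + s *\<^sub>R x i"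
  have T [measurable]: "?T \<in> ?P \<rightarrow>\<^sub>M ?P"
    by measurable
  have "scale_measure (ennreal (s ^ (DIM('a) * card I))) (distr ?P ?P ?T) = ?P"
  proof (rule lborel_product.PiM_eqI[OF I])
    fix A assume A: "\<And>i. i \<in> I \<Longrightarrow> A i \<in> sets (lborel :: 'a measure)"
    have scaled: "emeasure lborel (A i) =
        ennreal (s ^ DIM('a)) * emeasure lborel ((\<lambda>x. a i + s *\<^sub>R x) -` A i)" if "i \<in> I" for i
    proof -
      have "emeasure lborel (A i) =
          emeasure (density (distr lborel borel (\<lambda>x. a i + s *\<^sub>R x)) (\<lambda>_. \<bar>s\<bar>^DIM('a))) (A i)"
        using lborel_affine[of s "a i"] s by simp
      also have "\<dots> = ennreal (s ^ DIM('a)) * emeasure lborel ((\<lambda>x. a i + s *\<^sub>R x) -` A i)"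
        using A[OF that] s by (subst emeasure_density_const) (auto simp: emeasure_distr ennreal_power)
      finally show ?thesis .
    qed
    have pre: "?T -` Pi\<^sub>E I A \<inter> space ?P = (\<Pi>\<^sub>E i\<in>I. (\<lambda>x. a i + s *\<^sub>R x) -` A i)"
      by (auto simp: space_PiM PiE_def Pi_def extensional_def)
    have A_vim: "(\<lambda>x. a i + s *\<^sub>R x) -` A i \<in> sets lborel" if "i \<in> I" for i
    proof -
      have "(\<lambda>x. a i + s *\<^sub>R x) -` A i \<inter> space borel \<in> sets borel"
        using A[OF that] by (intro measurable_sets[where A=borel]) auto
      then show ?thesis by simp
    qed
    have "emeasure (distr ?P ?P ?T) (Pi\<^sub>E I A) = emeasure ?P (\<Pi>\<^sub>E i\<in>I. (\<lambda>x. a i + s *\<^sub>R x) -` A i)"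
      using A I by (subst emeasure_distr) (auto simp: pre intro!: sets_PiM_I_finite)
    also have "\<dots> = (\<Prod>i\<in>I. emeasure lborel ((\<lambda>x. a i + s *\<^sub>R x) -` A i))"
      using A_vim I by (intro lborel_product.emeasure_PiM) auto
    finally show "emeasure (scale_measure (ennreal (s ^ (DIM('a) * card I))) (distr ?P ?P ?T)) (Pi\<^sub>E I A) =
        (\<Prod>i\<in>I. emeasure lborel (A i))"
      using s by (simp add: scaled prod.distrib power_mult ennreal_power)
  qed simp
  then have "(\<integral>\<^sup>+x. f x \<partial>?P) =
      (\<integral>\<^sup>+x. f x \<partial>scale_measure (ennreal (s ^ (DIM('a) * card I))) (distr ?P ?P ?T))"
    by simp
  also have "\<dots> = ennreal (s ^ (DIM('a) * card I)) * (\<integral>\<^sup>+x. f (?T x) \<partial>?P)"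
    by (simp add: nn_integral_scale_measure nn_integral_distr)
  finally show ?thesis .
qed

lemma nn_integral_PiM_lborel_reindex:
  fixes f :: "('i \<Rightarrow> 'a::euclidean_space) \<Rightarrow> ennreal"
  assumes J: "finite J" and \<sigma>: "bij_betw \<sigma> I J"
    and f [measurable]: "f \<in> borel_measurable (\<Pi>\<^sub>M i\<in>I. lborel)"
  shows "(\<integral>\<^sup>+x. f x \<partial>(\<Pi>\<^sub>M i\<in>I. lborel)) = (\<integral>\<^sup>+x. f (\<lambda>i\<in>I. x (\<sigma> i)) \<partial>(\<Pi>\<^sub>M j\<in>J. lborel))"
proof -
  let ?P = "\<lambda>K. \<Pi>\<^sub>M i\<in>K. (lborel::'a measure)"
  let ?T = "\<lambda>x. \<lambda>i\<in>I. x (\<sigma> i)"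
  have I: "finite I" using \<sigma> J by (simp add: bij_betw_finite)
  have \<sigma>_in: "\<sigma> i \<in> J" if "i \<in> I" for i using \<sigma> that by (auto simp: bij_betw_def)
  have T [measurable]: "?T \<in> ?P J \<rightarrow>\<^sub>M ?P I"
    by (intro measurable_restrict measurable_component_singleton \<sigma>_in)
  have "distr (?P J) (?P I) ?T = ?P I"
  proof (rule lborel_product.PiM_eqI[OF I])
    fix A assume A: "\<And>i. i \<in> I \<Longrightarrow> A i \<in> sets (lborel :: 'a measure)"
    define \<tau> where "\<tau> = inv_into I \<sigma>"
    have \<tau>: "\<tau> j \<in> I" "\<sigma> (\<tau> j) = j" if "j \<in> J" for j
      using \<sigma> that by (auto simp: \<tau>_def bij_betw_def inv_into_into f_inv_into_f)
    have \<tau>\<sigma>: "\<tau> (\<sigma> i) = i" if "i \<in> I" for i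
      using \<sigma> that by (simp add: \<tau>_def bij_betw_def)
    have pre: "?T -` Pi\<^sub>E I A \<inter> space (?P J) = (\<Pi>\<^sub>E j\<in>J. A (\<tau> j))"
    proof (intro set_eqI iffI)
      fix x assume "x \<in> ?T -` Pi\<^sub>E I A \<inter> space (?P J)"
      then have ext: "x \<in> extensional J" and "\<forall>i\<in>I. x (\<sigma> i) \<in> A i"
        by (auto simp: space_PiM PiE_iff)
      then have "x j \<in> A (\<tau> j)" if "j \<in> J" for j
        using \<tau>[OF that] by (auto dest!: bspec[of _ _ "\<tau> j"])
      then show "x \<in> (\<Pi>\<^sub>E j\<in>J. A (\<tau> j))"
        using ext by (auto simp: PiE_iff)
    next
      fix x assume x: "x \<in> (\<Pi>\<^sub>E j\<in>J. A (\<tau> j))"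
      have "x (\<sigma> i) \<in> A i" if "i \<in> I" for i
        using x \<sigma>_in[OF that] \<tau>\<sigma>[OF that] by (auto simp: PiE_iff dest!: bspec)
      then show "x \<in> ?T -` Pi\<^sub>E I A \<inter> space (?P J)"
        using x by (auto simp: space_PiM PiE_iff)
    qed
    have "emeasure (distr (?P J) (?P I) ?T) (Pi\<^sub>E I A) = emeasure (?P J) (\<Pi>\<^sub>E j\<in>J. A (\<tau> j))"
      using A I by (subst emeasure_distr) (auto simp: pre intro!: sets_PiM_I_finite)
    also have "\<dots> = (\<Prod>j\<in>J. emeasure lborel (A (\<tau> j)))"
      using A \<tau> J by (intro lborel_product.emeasure_PiM) auto
    also have "\<dots> = (\<Prod>i\<in>I. emeasure lborel (A i))"
      using prod.reindex_bij_betw[OF \<sigma>, of "\<lambda>j. emeasure lborel (A (\<tau> j))"] \<tau>\<sigma> by simp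
    finally show "emeasure (distr (?P J) (?P I) ?T) (Pi\<^sub>E I A) = (\<Prod>i\<in>I. emeasure lborel (A i))" .
  qed simp
  then have "(\<integral>\<^sup>+x. f x \<partial>?P I) = (\<integral>\<^sup>+x. f x \<partial>distr (?P J) (?P I) ?T)" by simp
  also have "\<dots> = (\<integral>\<^sup>+x. f (?T x) \<partial>?P J)" by (simp add: nn_integral_distr)
  finally show ?thesis .
qed

section \<open>Translation-invariant measures on a subspace\<close>

text \<open>
  The combinations of the vectors \<open>v i\<close> with Lebesgue-distributed coefficients. For an orthonormal family this is
  Lebesgue measure on the span. For an independent family it is a multiple of that measure; the factor, the
  inverse square root of a Gram determinant, is determined below by comparing balls.
\<close>

definition lin_image :: "'i set \<Rightarrow> ('i \<Rightarrow> 'a::euclidean_space) \<Rightarrow> 'a measure" where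
  "lin_image I v = distr (\<Pi>\<^sub>M i\<in>I. lborel) borel (\<lambda>f. \<Sum>i\<in>I. f i *\<^sub>R v i)"

lemma sets_lin_image [simp, measurable_cong]: "sets (lin_image I v) = sets borel"
  and space_lin_image [simp]: "space (lin_image I v) = UNIV"
  by (auto simp: lin_image_def)

lemma combo_measurable [measurable]:
  "(\<lambda>f. \<Sum>i\<in>I. f i *\<^sub>R (v i :: 'a::euclidean_space)) \<in> borel_measurable (\<Pi>\<^sub>M i\<in>I. lborel)"
  by measurable

lemma nn_integral_lin_image:
  "h \<in> borel_measurable borel \<Longrightarrow>
    (\<integral>\<^sup>+y. h y \<partial>lin_image I v) = (\<integral>\<^sup>+f. h (\<Sum>i\<in>I. f i *\<^sub>R v i) \<partial>(\<Pi>\<^sub>M i\<in>I. lborel))"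
  unfolding lin_image_def by (subst nn_integral_distr) auto

lemma emeasure_lin_image:
  "A \<in> sets borel \<Longrightarrow> emeasure (lin_image I v) A =
    (\<integral>\<^sup>+f. indicator A (\<Sum>i\<in>I. f i *\<^sub>R v i) \<partial>(\<Pi>\<^sub>M i\<in>I. lborel))"
  by (subst nn_integral_lin_image[symmetric]) auto

lemma span_image_combo:
  assumes "finite I" "w \<in> span (v ` I)"
  obtains a where "w = (\<Sum>i\<in>I. a i *\<^sub>R (v i :: 'a::real_vector))"
proof -
  have "\<exists>a. w = (\<Sum>i\<in>I. a i *\<^sub>R v i)"
    using assms(2)
  proof (induction rule: span_induct_alt)
    case base
    then show ?case by (intro exI[of _ "\<lambda>_. 0"]) simp
  next
    case (step c x y)
    then obtain i a where i: "i \<in> I" "x = v i" and a: "y = (\<Sum>i\<in>I. a i *\<^sub>R v i)" by blast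
    have "c *\<^sub>R x = (\<Sum>j\<in>I. (if j = i then c else 0) *\<^sub>R v j)"
      using i assms(1) by (simp add: if_distrib[of "\<lambda>r. r *\<^sub>R _"] cong: if_cong)
    then show ?case
      using a by (intro exI[of _ "\<lambda>j. (if j = i then c else 0) + a j"])
        (simp add: scaleR_add_left sum.distrib)
  qed
  then show thesis using that by blast
qed

text \<open>
  A translation by a vector of the span is a translation of the coefficients.
\<close>

lemma nn_integral_lin_image_shift:
  assumes I: "finite I" and w: "w \<in> span (v ` I)" and h [measurable]: "h \<in> borel_measurable borel"
  shows "(\<integral>\<^sup>+y. h (y + w) \<partial>lin_image I v) = (\<integral>\<^sup>+y. h y \<partial>lin_image I v)"
proof -
  obtain a where a: "w = (\<Sum>i\<in>I. a i *\<^sub>R v i)" using span_image_combo[OF I w] .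
  have "(\<integral>\<^sup>+y. h y \<partial>lin_image I v) = (\<integral>\<^sup>+f. h (\<Sum>i\<in>I. f i *\<^sub>R v i) \<partial>(\<Pi>\<^sub>M i\<in>I. lborel))"
    by (rule nn_integral_lin_image) simp
  also have "\<dots> = (\<integral>\<^sup>+f. h (\<Sum>i\<in>I. (\<lambda>i\<in>I. a i + 1 *\<^sub>R f i) i *\<^sub>R v i) \<partial>(\<Pi>\<^sub>M i\<in>I. lborel))"
    by (subst nn_integral_PiM_lborel_affine[OF I zero_less_one, of _ a]) simp_all
  also have "\<dots> = (\<integral>\<^sup>+f. h ((\<Sum>i\<in>I. f i *\<^sub>R v i) + w) \<partial>(\<Pi>\<^sub>M i\<in>I. lborel))"
    by (intro nn_integral_cong arg_cong[of _ _ h])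
      (simp add: a scaleR_add_left sum.distrib add.commute cong: sum.cong)
  also have "\<dots> = (\<integral>\<^sup>+y. h (y + w) \<partial>lin_image I v)"
    by (subst nn_integral_lin_image) simp_all
  finally show ?thesis by simp
qed

text \<open>
  Both measures are invariant under translations by the common span, so they are proportional; the identity states this
  without a division. It is the classical Fubini argument: in the product of the two measures, the set
  \<open>y \<in> D, x \<in> A\<close> has the same mass as \<open>y \<in> D, x + y \<in> A\<close>, hence as \<open>y - x \<in> D, y \<in> A\<close>. The integrals are taken
  over the coefficient spaces, which are \<open>\<sigma>\<close>-finite also for a dependent family.
\<close>

lemma lin_image_swap:
  fixes v :: "'i \<Rightarrow> 'a::euclidean_space" and w :: "'j \<Rightarrow> 'a"
  assumes I: "finite I" and J: "finite J" and sp: "span (v ` I) = span (w ` J)"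
    and A [measurable]: "A \<in> sets borel" and D [measurable]: "D \<in> sets borel"
    and sym: "\<And>y. - y \<in> D \<longleftrightarrow> y \<in> D"
  shows "emeasure (lin_image I v) A * emeasure (lin_image J w) D =
         emeasure (lin_image J w) A * emeasure (lin_image I v) D"
proof -
  let ?PI = "\<Pi>\<^sub>M i\<in>I. (lborel::real measure)" and ?PJ = "\<Pi>\<^sub>M j\<in>J. (lborel::real measure)"
  let ?\<mu> = "lin_image I v" and ?\<nu> = "lin_image J w"
  let ?S = "\<lambda>f. \<Sum>i\<in>I. f i *\<^sub>R v i" and ?T = "\<lambda>g. \<Sum>j\<in>J. g j *\<^sub>R w j"
  interpret PI: sigma_finite_measure ?PI using I by (rule lborel_product.sigma_finite)
  interpret PJ: sigma_finite_measure ?PJ using J by (rule lborel_product.sigma_finite)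
  interpret pair_sigma_finite ?PI ?PJ ..
  have S_span: "?S f \<in> span (v ` I)" for f by (intro span_sum span_scale span_base) auto
  have T_span: "?T g \<in> span (w ` J)" for g by (intro span_sum span_scale span_base) auto
  have "emeasure ?\<mu> A * emeasure ?\<nu> D = (\<integral>\<^sup>+g. indicator D (?T g) * emeasure ?\<mu> A \<partial>?PJ)"
    by (subst nn_integral_multc) (simp_all add: emeasure_lin_image[of D] mult.commute)
  also have "\<dots> = (\<integral>\<^sup>+g. (\<integral>\<^sup>+f. indicator D (?T g) * indicator A (?S f + ?T g) \<partial>?PI) \<partial>?PJ)"
  proof (rule nn_integral_cong)
    fix g
    have "emeasure ?\<mu> A = (\<integral>\<^sup>+y. indicator A y \<partial>?\<mu>)" by simp
    also have "\<dots> = (\<integral>\<^sup>+y. indicator A (y + ?T g) \<partial>?\<mu>)"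
      using T_span[of g] sp by (intro nn_integral_lin_image_shift[OF I, symmetric]) auto
    also have "\<dots> = (\<integral>\<^sup>+f. indicator A (?S f + ?T g) \<partial>?PI)"
      by (subst nn_integral_lin_image) auto
    finally show "indicator D (?T g) * emeasure ?\<mu> A =
        (\<integral>\<^sup>+f. indicator D (?T g) * indicator A (?S f + ?T g) \<partial>?PI)"
      by (simp add: nn_integral_cmult)
  qed
  also have "\<dots> = (\<integral>\<^sup>+f. (\<integral>\<^sup>+g. indicator D (?T g) * indicator A (?S f + ?T g) \<partial>?PJ) \<partial>?PI)"
    by (rule Fubini') measurable
  also have "\<dots> = (\<integral>\<^sup>+f. (\<integral>\<^sup>+g. indicator D (?T g - ?S f) * indicator A (?T g) \<partial>?PJ) \<partial>?PI)"
  proof (rule nn_integral_cong)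
    fix f
    have "(\<integral>\<^sup>+g. indicator D (?T g) * indicator A (?S f + ?T g) \<partial>?PJ) =
        (\<integral>\<^sup>+y. indicator D (y + ?S f - ?S f) * indicator A (y + ?S f) \<partial>?\<nu>)"
      by (subst nn_integral_lin_image) (auto simp: add.commute)
    also have "\<dots> = (\<integral>\<^sup>+y. indicator D (y - ?S f) * indicator A y \<partial>?\<nu>)"
      using S_span[of f] sp by (intro nn_integral_lin_image_shift[OF J]) auto
    finally show "(\<integral>\<^sup>+g. indicator D (?T g) * indicator A (?S f + ?T g) \<partial>?PJ) =
        (\<integral>\<^sup>+g. indicator D (?T g - ?S f) * indicator A (?T g) \<partial>?PJ)"
      by (simp add: nn_integral_lin_image)
  qed
  also have "\<dots> = (\<integral>\<^sup>+g. (\<integral>\<^sup>+f. indicator D (?T g - ?S f) * indicator A (?T g) \<partial>?PI) \<partial>?PJ)"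
    by (rule Fubini'[symmetric]) measurable
  also have "\<dots> = (\<integral>\<^sup>+g. indicator A (?T g) * emeasure ?\<mu> D \<partial>?PJ)"
  proof (rule nn_integral_cong)
    fix g
    have "(\<integral>\<^sup>+f. indicator D (?T g - ?S f) * indicator A (?T g) \<partial>?PI) =
        (\<integral>\<^sup>+f. indicator D (?S f + (- ?T g)) \<partial>?PI) * indicator A (?T g)"
      using sym[of "?T g - ?S _"] by (subst nn_integral_multc[symmetric])
        (auto intro!: nn_integral_cong simp: indicator_def)
    also have "(\<integral>\<^sup>+f. indicator D (?S f + (- ?T g)) \<partial>?PI) = (\<integral>\<^sup>+y. indicator D (y + (- ?T g)) \<partial>?\<mu>)"
      by (subst nn_integral_lin_image) auto
    also have "\<dots> = (\<integral>\<^sup>+y. indicator D y \<partial>?\<mu>)"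
      using T_span[of g] sp by (intro nn_integral_lin_image_shift[OF I]) (auto intro: span_neg)
    finally show "(\<integral>\<^sup>+f. indicator D (?T g - ?S f) * indicator A (?T g) \<partial>?PI) =
        indicator A (?T g) * emeasure ?\<mu> D"
      by (simp add: mult.commute)
  qed
  also have "\<dots> = emeasure ?\<nu> A * emeasure ?\<mu> D"
    by (subst nn_integral_multc) (simp_all add: emeasure_lin_image[of A J])
  finally show ?thesis .
qed

section \<open>The volume of a simplex\<close>

text \<open>
  Independence of an indexed family; unlike independence of the set \<open>v ` I\<close> it excludes repetitions.
\<close>

definition lin_indep :: "'i set \<Rightarrow> ('i \<Rightarrow> 'a::real_vector) \<Rightarrow> bool" where
  "lin_indep I v \<longleftrightarrow> (\<forall>a. (\<Sum>i\<in>I. a i *\<^sub>R v i) = 0 \<longrightarrow> (\<forall>i\<in>I. a i = 0))"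

lemma lin_indep_imp:
  assumes I: "finite I" and v: "lin_indep I v"
  shows "inj_on v I" "independent (v ` I)"
proof -
  show inj: "inj_on v I"
  proof (rule inj_onI, rule ccontr)
    fix i j assume ij: "i \<in> I" "j \<in> I" "v i = v j" "i \<noteq> j"
    have "(\<Sum>l\<in>I. ((if l = i then 1 else 0) - (if l = j then 1 else 0)) *\<^sub>R v l) = v i - v j"
      using I ij by (simp add: scaleR_diff_left sum_subtractf if_distrib[of "\<lambda>r. r *\<^sub>R _"] cong: if_cong)
    then have "(if i = i then 1 else 0) - (if i = j then 1 else 0) = (0::real)"
      using v ij by (auto simp: lin_indep_def dest!: spec[of _ "\<lambda>l. (if l = i then 1 else 0) - (if l = j then 1 else 0)"])
    with ij show False by simp
  qed
  show "independent (v ` I)"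
    using v I inj by (intro independent_if_scalars_zero)
      (auto simp: lin_indep_def sum.reindex dest!: spec[of _ "\<lambda>i. _ (v i)"])
qed

text \<open>
  The coefficient is a linear functional of the combination, and linear functionals are bounded.
\<close>

lemma lin_indep_coordinate_bound:
  fixes v :: "'i \<Rightarrow> 'a::euclidean_space"
  assumes I: "finite I" and v: "lin_indep I v" and i: "i \<in> I"
  shows "\<exists>K>0. \<forall>f. \<bar>f i\<bar> \<le> K * norm (\<Sum>i\<in>I. f i *\<^sub>R v i)"
proof -
  note inj = lin_indep_imp(1)[OF I v]
  \<comment> \<open>The coordinate functional of \<open>v i\<close>, extended to the whole space.\<close>
  obtain g :: "'a \<Rightarrow> real" where g: "linear g" "\<forall>x\<in>v ` I. g x = (if x = v i then 1 else 0)"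
    using linear_independent_extend[OF lin_indep_imp(2)[OF I v], of "\<lambda>x. if x = v i then 1 else (0::real)"] by blast
  obtain K where K: "K > 0" "\<forall>x. norm (g x) \<le> K * norm x"
    using linear_bounded_pos[OF g(1)] by blast
  have "g (\<Sum>j\<in>I. f j *\<^sub>R v j) = f i" for f
  proof -
    have "g (\<Sum>j\<in>I. f j *\<^sub>R v j) = (\<Sum>j\<in>I. f j * g (v j))"
      using g(1) by (simp add: linear_sum linear_cmul)
    also have "\<dots> = (\<Sum>j\<in>I. if j = i then f j else 0)"
      using g(2) inj i by (intro sum.cong) (auto dest: inj_onD)
    finally show ?thesis using I i by simp
  qed
  then show ?thesis using K by (metis real_norm_def)
qed

lemma borel_ball [measurable, simp]: "ball (x :: 'a::euclidean_space) r \<in> sets borel"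
  by (rule borel_open) simp

lemma indicator_ball_measurable [measurable, simp]:
  "(indicator (ball (x :: 'a::euclidean_space) r) :: 'a \<Rightarrow> ennreal) \<in> borel_measurable borel"
  by (rule borel_measurable_indicator) simp

lemma lin_image_ball_pos:
  fixes v :: "'i \<Rightarrow> 'a::euclidean_space"
  assumes I: "finite I"
  shows "emeasure (lin_image I v) (ball 0 1) > 0"
proof -
  \<comment> \<open>Coefficients below \<open>\<epsilon>\<close> keep the combination in the unit ball.\<close>
  define \<epsilon> where "\<epsilon> = 1 / (1 + (\<Sum>i\<in>I. norm (v i)))"
  have \<epsilon>: "\<epsilon> > 0" by (auto simp: \<epsilon>_def intro!: divide_pos_pos add_pos_nonneg sum_nonneg)
  have "0 < (\<Prod>i\<in>I. ennreal (2 * \<epsilon>))"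
    using \<epsilon> by (simp add: prod_constant ennreal_power)
  also have "\<dots> = emeasure (\<Pi>\<^sub>M i\<in>I. lborel) (\<Pi>\<^sub>E i\<in>I. {- \<epsilon><..<\<epsilon>})"
    using \<epsilon> I by (subst lborel_product.emeasure_PiM) auto
  also have "\<dots> = (\<integral>\<^sup>+f. indicator (\<Pi>\<^sub>E i\<in>I. {- \<epsilon><..<\<epsilon>}) f \<partial>(\<Pi>\<^sub>M i\<in>I. lborel))"
    using I by (intro nn_integral_indicator[symmetric] sets_PiM_I_finite) auto
  also have "\<dots> \<le> (\<integral>\<^sup>+f. indicator (ball 0 1) (\<Sum>i\<in>I. f i *\<^sub>R v i) \<partial>(\<Pi>\<^sub>M i\<in>I. lborel))"
  proof (rule nn_integral_mono)
    fix f
    have "norm (\<Sum>i\<in>I. f i *\<^sub>R v i) < 1" if "\<forall>i\<in>I. \<bar>f i\<bar> < \<epsilon>"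
    proof -
      have "norm (\<Sum>i\<in>I. f i *\<^sub>R v i) \<le> (\<Sum>i\<in>I. \<epsilon> * norm (v i))"
        using that by (intro sum_norm_le) (auto intro!: mult_right_mono simp: less_imp_le)
      also have "\<dots> = \<epsilon> * (\<Sum>i\<in>I. norm (v i))" by (simp add: sum_distrib_left)
      also have "\<dots> < \<epsilon> * (1 + (\<Sum>i\<in>I. norm (v i)))" using \<epsilon> by simp
      also have "\<dots> = 1" using \<epsilon> by (simp add: \<epsilon>_def)
      finally show ?thesis .
    qed
    then show "indicator (\<Pi>\<^sub>E i\<in>I. {- \<epsilon><..<\<epsilon>}) f \<le>
        (indicator (ball 0 1) (\<Sum>i\<in>I. f i *\<^sub>R v i) :: ennreal)"
      by (auto simp: indicator_def PiE_iff abs_less_iff minus_less_iff)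
  qed
  also have "\<dots> = emeasure (lin_image I v) (ball 0 1)" by (simp add: emeasure_lin_image)
  finally show ?thesis .
qed

lemma lin_image_ball_finite:
  fixes v :: "'i \<Rightarrow> 'a::euclidean_space"
  assumes I: "finite I" and v: "lin_indep I v"
  shows "emeasure (lin_image I v) (ball 0 1) < \<infinity>"
proof -
  obtain K where K: "\<And>i. i \<in> I \<Longrightarrow> K i > 0" "\<And>i f. i \<in> I \<Longrightarrow> \<bar>f i\<bar> \<le> K i * norm (\<Sum>i\<in>I. f i *\<^sub>R v i)"
    using lin_indep_coordinate_bound[OF I v] by metis
  have "emeasure (lin_image I v) (ball 0 1) =
      (\<integral>\<^sup>+f. indicator (ball 0 1) (\<Sum>i\<in>I. f i *\<^sub>R v i) \<partial>(\<Pi>\<^sub>M i\<in>I. lborel))"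
    by (simp add: emeasure_lin_image)
  also have "\<dots> \<le> (\<integral>\<^sup>+f. indicator (\<Pi>\<^sub>E i\<in>I. {- K i..K i}) f \<partial>(\<Pi>\<^sub>M i\<in>I. lborel))"
  proof (rule nn_integral_mono)
    fix f assume "f \<in> space (\<Pi>\<^sub>M i\<in>I. (lborel::real measure))"
    then have ext: "f \<in> extensional I" by (simp add: space_PiM PiE_def)
    have "\<bar>f i\<bar> \<le> K i" if "norm (\<Sum>i\<in>I. f i *\<^sub>R v i) < 1" "i \<in> I" for i
    proof -
      have "\<bar>f i\<bar> \<le> K i * norm (\<Sum>i\<in>I. f i *\<^sub>R v i)" using K that by blast
      also have "\<dots> \<le> K i * 1" using K(1)[of i] that by (intro mult_left_mono) auto
      finally show ?thesis by simp
    qed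
    then show "(indicator (ball 0 1) (\<Sum>i\<in>I. f i *\<^sub>R v i) :: ennreal) \<le> indicator (\<Pi>\<^sub>E i\<in>I. {- K i..K i}) f"
      using ext by (auto simp: indicator_def PiE_iff abs_le_iff minus_le_iff)
  qed
  also have "\<dots> = emeasure (\<Pi>\<^sub>M i\<in>I. lborel) (\<Pi>\<^sub>E i\<in>I. {- K i..K i})"
    using I by (intro nn_integral_indicator sets_PiM_I_finite) auto
  also have "\<dots> = (\<Prod>i\<in>I. ennreal (2 * K i))"
    using I K(1) by (subst lborel_product.emeasure_PiM) (auto intro!: prod.cong simp: less_imp_le)
  also have "\<dots> = ennreal (\<Prod>i\<in>I. 2 * K i)"
    using K(1) by (intro prod_ennreal) (auto simp: less_imp_le)
  also have "\<dots> < \<infinity>" by simp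
  finally show ?thesis .
qed

text \<open>
  A redundant vector can be given an arbitrary coefficient: for every fixed value of it, the others range over a
  translate of the set for the remaining family, which has positive measure.
\<close>

lemma lin_image_ball_infinite:
  fixes v :: "'i \<Rightarrow> 'a::euclidean_space"
  assumes I: "finite I" "i \<notin> I" and dep: "v i \<in> span (v ` I)"
  shows "emeasure (lin_image (insert i I) v) (ball 0 1) = \<infinity>"
proof -
  have "emeasure (lin_image (insert i I) v) (ball 0 1) =
      (\<integral>\<^sup>+f. indicator (ball 0 1) (\<Sum>j\<in>insert i I. f j *\<^sub>R v j) \<partial>(\<Pi>\<^sub>M j\<in>insert i I. lborel))"
    by (rule emeasure_lin_image) simp
  also have "\<dots> = (\<integral>\<^sup>+y. (\<integral>\<^sup>+f. indicator (ball 0 1) (\<Sum>j\<in>insert i I. (f(i := y)) j *\<^sub>R v j) \<partial>(\<Pi>\<^sub>M j\<in>I. lborel)) \<partial>lborel)"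
    by (rule lborel_product.product_nn_integral_insert_rev[OF I])
      (rule measurable_compose[OF combo_measurable], simp)
  also have "\<dots> = (\<integral>\<^sup>+(y::real). emeasure (lin_image I v) (ball 0 1) \<partial>lborel)"
  proof (rule nn_integral_cong)
    fix y :: real
    have "(\<integral>\<^sup>+f. indicator (ball 0 1) (\<Sum>j\<in>insert i I. (f(i := y)) j *\<^sub>R v j) \<partial>(\<Pi>\<^sub>M j\<in>I. lborel)) =
        (\<integral>\<^sup>+f. indicator (ball 0 1) ((\<Sum>j\<in>I. f j *\<^sub>R v j) + y *\<^sub>R v i) \<partial>(\<Pi>\<^sub>M j\<in>I. lborel))"
      using I by (intro nn_integral_cong arg_cong[where f="indicator _"])
        (auto simp: add.commute intro!: sum.cong)
    also have "\<dots> = (\<integral>\<^sup>+x. indicator (ball 0 1) (x + y *\<^sub>R v i) \<partial>lin_image I v)"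
      by (subst nn_integral_lin_image) auto
    also have "\<dots> = (\<integral>\<^sup>+x. indicator (ball 0 1) x \<partial>lin_image I v)"
      using dep by (intro nn_integral_lin_image_shift I span_scale) auto
    finally show "(\<integral>\<^sup>+f. indicator (ball 0 1) (\<Sum>j\<in>insert i I. (f(i := y)) j *\<^sub>R v j) \<partial>(\<Pi>\<^sub>M j\<in>I. lborel)) =
        emeasure (lin_image I v) (ball 0 1)" by simp
  qed
  also have "\<dots> = \<infinity>"
    using lin_image_ball_pos[OF I(1), of v] by (simp add: ennreal_mult_top)
  finally show ?thesis .
qed

text \<open>
  Some basis vector \<open>b\<close> is not orthogonal to \<open>u\<close>, so the other coefficients determine the one of \<open>b\<close>.
\<close>

lemma lin_image_hyperplane_null:
  fixes B :: "'a::euclidean_space set"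
  assumes B: "finite B" and u: "u \<in> span B" "u \<noteq> 0"
  shows "emeasure (lin_image B (\<lambda>b. b)) {y. u \<bullet> y = 0} = 0"
proof -
  have "\<exists>b\<in>B. u \<bullet> b \<noteq> 0"
  proof (rule ccontr)
    assume "\<not> (\<exists>b\<in>B. u \<bullet> b \<noteq> 0)"
    then have "\<And>b. b \<in> B \<Longrightarrow> orthogonal u b" by (auto simp: orthogonal_def)
    then have "orthogonal u u" using u(1) by (rule orthogonal_to_span[rotated])
    then show False using u(2) by (simp add: orthogonal_def)
  qed
  then obtain b where b: "b \<in> B" "u \<bullet> b \<noteq> 0" by blast
  define C where "C = B - {b}"
  have C: "finite C" "b \<notin> C" "B = insert b C" using B b by (auto simp: C_def)
  have [measurable]: "{y. u \<bullet> y = 0} \<in> sets borel" by (simp add: closed_hyperplane borel_closed)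
  have "emeasure (lin_image B (\<lambda>b. b)) {y. u \<bullet> y = 0} =
      (\<integral>\<^sup>+f. indicator {y. u \<bullet> y = 0} (\<Sum>b\<in>insert b C. f b *\<^sub>R b) \<partial>(\<Pi>\<^sub>M j\<in>insert b C. lborel))"
    unfolding C(3) by (rule emeasure_lin_image) simp
  also have "\<dots> = (\<integral>\<^sup>+f. (\<integral>\<^sup>+y. indicator {y. u \<bullet> y = 0} (\<Sum>j\<in>insert b C. (f(b := y)) j *\<^sub>R j) \<partial>lborel) \<partial>(\<Pi>\<^sub>M j\<in>C. lborel))"
    by (rule lborel_product.product_nn_integral_insert[OF C(1,2)]) measurable
  also have "\<dots> = (\<integral>\<^sup>+f. (0::ennreal) \<partial>(\<Pi>\<^sub>M j\<in>C. (lborel::real measure)))"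
  proof (rule nn_integral_cong)
    fix f :: "'a \<Rightarrow> real"
    define r where "r = - (u \<bullet> (\<Sum>j\<in>C. f j *\<^sub>R j)) / (u \<bullet> b)"
    have upd: "(\<Sum>j\<in>insert b C. (f(b := y)) j *\<^sub>R j) = y *\<^sub>R b + (\<Sum>j\<in>C. f j *\<^sub>R j)" for y
      using C by (subst sum.insert) (auto intro!: sum.cong)
    have "(\<integral>\<^sup>+y. indicator {y. u \<bullet> y = 0} (\<Sum>j\<in>insert b C. (f(b := y)) j *\<^sub>R j) \<partial>lborel) =
        (\<integral>\<^sup>+y. (indicator {r} y :: ennreal) \<partial>lborel)"
      unfolding upd using b
      by (intro nn_integral_cong) (auto simp: indicator_def r_def inner_add_right field_simps)
    also have "\<dots> = 0" by simp
    finally show "(\<integral>\<^sup>+y. indicator {y. u \<bullet> y = 0} (\<Sum>j\<in>insert b C. (f(b := y)) j *\<^sub>R j) \<partial>lborel) = (0::ennreal)" .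
  qed
  finally show ?thesis by simp
qed

definition corner_simplex_vol :: "nat \<Rightarrow> ennreal" where
  "corner_simplex_vol k = (\<integral>\<^sup>+f. indicator {f. (\<forall>i<k. 0 \<le> f i) \<and> (\<Sum>i<k. f i) \<le> 1} f \<partial>(\<Pi>\<^sub>M i\<in>{..<k}. (lborel::real measure)))"

definition euclid_ball_vol :: "nat \<Rightarrow> ennreal" where
  "euclid_ball_vol k = (\<integral>\<^sup>+f. indicator {f. (\<Sum>i<k. (f i)\<^sup>2) < 1} f \<partial>(\<Pi>\<^sub>M i\<in>{..<k}. (lborel::real measure)))"

lemma orthonormal_imp:
  assumes "orthonormal (B :: 'a::euclidean_space set)"
  shows "independent B" "finite B"
proof -
  show "independent B"
    using assms by (intro pairwise_orthogonal_independent) (auto simp: orthonormal_def)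
  then show "finite B" by (rule finiteI_independent)
qed

lemma lin_image_orthonormal_ball:
  fixes B :: "'a::euclidean_space set"
  assumes B: "orthonormal B" and k: "card B = k"
  shows "emeasure (lin_image B (\<lambda>b. b)) (ball 0 1) = euclid_ball_vol k"
proof -
  note fB = orthonormal_imp(2)[OF B]
  obtain \<sigma> where \<sigma>: "bij_betw \<sigma> {..<k} B"
    using ex_bij_betw_nat_finite[OF fB] k by (auto simp: atLeast0LessThan)
  have "euclid_ball_vol k = (\<integral>\<^sup>+f. indicator {f. (\<Sum>i<k. (f i)\<^sup>2) < 1} (\<lambda>i\<in>{..<k}. f (\<sigma> i)) \<partial>(\<Pi>\<^sub>M i\<in>B. (lborel::real measure)))"
    unfolding euclid_ball_vol_def by (rule nn_integral_PiM_lborel_reindex[OF fB \<sigma>]) measurable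
  also have "\<dots> = (\<integral>\<^sup>+f. indicator (ball 0 1) (\<Sum>b\<in>B. f b *\<^sub>R b) \<partial>(\<Pi>\<^sub>M i\<in>B. lborel))"
  proof (rule nn_integral_cong)
    fix f :: "'a \<Rightarrow> real"
    have "(norm (\<Sum>b\<in>B. f b *\<^sub>R b))\<^sup>2 = (\<Sum>b\<in>B. (norm (f b *\<^sub>R b))\<^sup>2)"
      using B fB by (intro norm_sum_Pythagorean)
        (auto simp: orthonormal_def pairwise_def orthogonal_def)
    also have "\<dots> = (\<Sum>b\<in>B. (f b)\<^sup>2)"
      using B by (intro sum.cong) (auto simp: orthonormal_def)
    also have "\<dots> = (\<Sum>i<k. (f (\<sigma> i))\<^sup>2)"
      by (rule sum.reindex_bij_betw[OF \<sigma>, symmetric])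
    finally have "(\<Sum>i<k. (f (\<sigma> i))\<^sup>2) < 1 \<longleftrightarrow> norm (\<Sum>b\<in>B. f b *\<^sub>R b) < 1"
      using abs_square_less_1[of "norm (\<Sum>b\<in>B. f b *\<^sub>R b)"] by simp
    then show "indicator {f. (\<Sum>i<k. (f i)\<^sup>2) < 1} (\<lambda>i\<in>{..<k}. f (\<sigma> i)) =
        (indicator (ball 0 1) (\<Sum>b\<in>B. f b *\<^sub>R b) :: ennreal)"
      by (simp add: indicator_def)
  qed
  also have "\<dots> = emeasure (lin_image B (\<lambda>b. b)) (ball 0 1)" by (simp add: emeasure_lin_image)
  finally show ?thesis by simp
qed

lemma convex_hull_insert_0_image:
  fixes v :: "'i \<Rightarrow> 'a::real_vector"
  assumes I: "finite I"
  shows "convex hull (insert 0 (v ` I)) =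
    {\<Sum>i\<in>I. u i *\<^sub>R v i | u. (\<forall>i\<in>I. 0 \<le> u i) \<and> (\<Sum>i\<in>I. u i) \<le> 1}" (is "_ = ?T")
proof (intro antisym hull_minimal)
  show "insert 0 (v ` I) \<subseteq> ?T"
  proof
    fix x assume "x \<in> insert 0 (v ` I)"
    then consider "x = 0" | i where "i \<in> I" "x = v i" by blast
    then show "x \<in> ?T"
    proof cases
      case 1
      then show ?thesis by (auto intro!: exI[of _ "\<lambda>_. 0"])
    next
      case 2
      then show ?thesis using I
        by (auto intro!: exI[of _ "\<lambda>j. if j = i then 1 else 0"]
            simp: if_distrib[of "\<lambda>r. r *\<^sub>R _"] cong: if_cong)
    qed
  qed
  show "convex ?T"
  proof (rule convexI)
    fix x y and a b :: real assume "x \<in> ?T" "y \<in> ?T" and ab: "0 \<le> a" "0 \<le> b" "a + b = 1"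
    then obtain p q where p: "x = (\<Sum>i\<in>I. p i *\<^sub>R v i)" "\<forall>i\<in>I. 0 \<le> p i" "(\<Sum>i\<in>I. p i) \<le> 1"
      and q: "y = (\<Sum>i\<in>I. q i *\<^sub>R v i)" "\<forall>i\<in>I. 0 \<le> q i" "(\<Sum>i\<in>I. q i) \<le> 1" by blast
    have "a * (\<Sum>i\<in>I. p i) + b * (\<Sum>i\<in>I. q i) \<le> a * 1 + b * 1"
      using ab p q by (intro add_mono mult_left_mono) auto
    then show "a *\<^sub>R x + b *\<^sub>R y \<in> ?T"
      using ab p q
      by (auto intro!: exI[of _ "\<lambda>i. a * p i + b * q i"]
          simp: scaleR_add_left scaleR_sum_right sum.distrib sum_distrib_left)
  qed
  show "?T \<subseteq> convex hull (insert 0 (v ` I))"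
  proof clarify
    fix u assume u: "\<forall>i\<in>I. 0 \<le> u i" "(\<Sum>i\<in>I. u i) \<le> (1::real)"
    \<comment> \<open>The missing weight goes to the vertex \<open>0\<close>, here with the index \<open>None\<close>.\<close>
    have "(\<Sum>i\<in>I. u i *\<^sub>R v i) = (\<Sum>i\<in>insert None (Some ` I).
        (case i of None \<Rightarrow> 1 - (\<Sum>i\<in>I. u i) | Some i \<Rightarrow> u i) *\<^sub>R (case i of None \<Rightarrow> 0 | Some i \<Rightarrow> v i))"
      using I by (subst sum.insert) (auto simp: sum.reindex)
    also have "\<dots> \<in> convex hull (insert 0 (v ` I))"
      using I u by (intro convex_sum)
        (auto simp: sum.reindex sum.insert split: option.split intro: hull_inc)
    finally show "(\<Sum>i\<in>I. u i *\<^sub>R v i) \<in> convex hull (insert 0 (v ` I))" .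
  qed
qed

text \<open>
  An independent family maps the corner simplex of the coefficient space one-to-one onto this simplex, so the measure
  does not depend on the family.
\<close>

lemma lin_image_simplex:
  fixes v :: "nat \<Rightarrow> 'a::euclidean_space"
  assumes v: "lin_indep {..<k} v"
  shows "emeasure (lin_image {..<k} v) (convex hull (insert 0 (v ` {..<k}))) = corner_simplex_vol k"
proof -
  have "convex hull (insert 0 (v ` {..<k})) \<in> sets borel"
    by (intro borel_compact finite_imp_compact_convex_hull) simp
  then have "emeasure (lin_image {..<k} v) (convex hull (insert 0 (v ` {..<k}))) =
      (\<integral>\<^sup>+f. indicator (convex hull (insert 0 (v ` {..<k}))) (\<Sum>i<k. f i *\<^sub>R v i) \<partial>(\<Pi>\<^sub>M i\<in>{..<k}. lborel))"
    by (rule emeasure_lin_image)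
  also have "\<dots> = corner_simplex_vol k"
    unfolding corner_simplex_vol_def
  proof (rule nn_integral_cong)
    fix f :: "nat \<Rightarrow> real"
    have "u i = f i" if "(\<Sum>i<k. f i *\<^sub>R v i) = (\<Sum>i<k. u i *\<^sub>R v i)" "i < k" for u i
    proof -
      have "(\<Sum>i<k. (u i - f i) *\<^sub>R v i) = 0"
        using that by (simp add: scaleR_diff_left sum_subtractf)
      then have "\<forall>i\<in>{..<k}. u i - f i = 0"
        using v unfolding lin_indep_def by (elim allE[of _ "\<lambda>i. u i - f i"]) auto
      then show ?thesis using that by auto
    qed
    note unique = this
    have "(\<Sum>i<k. f i *\<^sub>R v i) \<in> convex hull (insert 0 (v ` {..<k})) \<longleftrightarrow>
        (\<forall>i<k. 0 \<le> f i) \<and> (\<Sum>i<k. f i) \<le> 1" (is "?L \<longleftrightarrow> ?R")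
    proof
      assume ?L
      then obtain u where u: "(\<Sum>i<k. f i *\<^sub>R v i) = (\<Sum>i<k. u i *\<^sub>R v i)"
          "\<forall>i<k. 0 \<le> u i" "(\<Sum>i<k. u i) \<le> 1"
        unfolding convex_hull_insert_0_image[OF finite_lessThan] by auto
      with unique[OF u(1)] show ?R by auto
    next
      assume ?R
      then show ?L unfolding convex_hull_insert_0_image[OF finite_lessThan] by auto
    qed
    then show "indicator (convex hull (insert 0 (v ` {..<k}))) (\<Sum>i<k. f i *\<^sub>R v i) =
        (indicator {f. (\<forall>i<k. 0 \<le> f i) \<and> (\<Sum>i<k. f i) \<le> 1} f :: ennreal)"
      by (simp add: indicator_def)
  qed
  finally show ?thesis .
qed

text \<open>
  The volume of an ellipsoid in the coefficient space. It is inversely proportional to the volume of the parallelotope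
  spanned by the vectors, and it is infinite if they are dependent.
\<close>

definition coeff_ball_vol :: "nat \<Rightarrow> (nat \<Rightarrow> 'a::euclidean_space) \<Rightarrow> ennreal" where
  "coeff_ball_vol k v = emeasure (lin_image {..<k} v) (ball 0 1)"

text \<open>
  In the independent case, compare the two measures on the simplex and on the unit ball: the simplex has a universal
  value for the second one, the ball for the first one. In the dependent case the simplex lies in a hyperplane of the span
  of \<open>B\<close>, and the right-hand side is a quotient by \<open>\<infinity>\<close>, hence also \<open>0\<close>.
\<close>

lemma lin_image_orthonormal_simplex:
  fixes v :: "nat \<Rightarrow> 'a::euclidean_space"
  assumes B: "orthonormal B" "card B = k" and v: "v ` {..<k} \<subseteq> span B"
  shows "emeasure (lin_image B (\<lambda>b. b)) (convex hull (insert 0 (v ` {..<k}))) =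
    corner_simplex_vol k * euclid_ball_vol k / coeff_ball_vol k v"
proof (cases "lin_indep {..<k} v")
  case True
  note indep = lin_indep_imp[OF finite_lessThan True]
  let ?A = "convex hull (insert 0 (v ` {..<k}))"
  have A: "?A \<in> sets borel"
    by (intro borel_compact finite_imp_compact_convex_hull) simp
  have "dim (span B) \<le> dim (span (v ` {..<k}))"
    using indep B orthonormal_imp[OF B(1)]
    by (simp add: dim_eq_card_independent card_image)
  then have "span (v ` {..<k}) = span B"
    using v by (intro subspace_dim_equal) (auto intro: span_minimal[THEN subsetD])
  then have "emeasure (lin_image B (\<lambda>b. b)) ?A * emeasure (lin_image {..<k} v) (ball 0 1) =
      emeasure (lin_image {..<k} v) ?A * emeasure (lin_image B (\<lambda>b. b)) (ball 0 1)"
    using orthonormal_imp[OF B(1)] A by (intro lin_image_swap) auto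
  then have "emeasure (lin_image B (\<lambda>b. b)) ?A * coeff_ball_vol k v = corner_simplex_vol k * euclid_ball_vol k"
    by (simp add: coeff_ball_vol_def lin_image_simplex[OF True] lin_image_orthonormal_ball[OF B])
  moreover have "coeff_ball_vol k v \<noteq> 0" "coeff_ball_vol k v \<noteq> \<infinity>"
    using lin_image_ball_pos[of "{..<k}" v] lin_image_ball_finite[OF _ True] by (auto simp: coeff_ball_vol_def)
  ultimately show ?thesis
    by (metis mult_divide_eq_ennreal infinity_ennreal_def)
next
  case False
  then obtain a i where a: "(\<Sum>i<k. a i *\<^sub>R v i) = 0" and i: "i < k" "a i \<noteq> 0"
    by (auto simp: lin_indep_def)
  define I where "I = {..<k} - {i}"
  have I: "{..<k} = insert i I" "finite I" "i \<notin> I" using i by (auto simp: I_def)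
  have "a i *\<^sub>R v i = - (\<Sum>j\<in>I. a j *\<^sub>R v j)"
    using a I by (simp add: eq_neg_iff_add_eq_0)
  then have "v i = (- 1 / a i) *\<^sub>R (\<Sum>j\<in>I. a j *\<^sub>R v j)"
    using i by (metis (no_types, lifting) divide_minus_left minus_divide_left inverse_eq_divide
        scaleR_minus_left scaleR_minus_right scaleR_left_imp_eq scaleR_scaleR scaleR_one nonzero_divide_eq_eq mult.commute)
  then have dep: "v i \<in> span (v ` I)"
    by (auto intro!: span_neg span_scale span_sum intro: span_base)
  have "coeff_ball_vol k v = \<infinity>"
    unfolding coeff_ball_vol_def I(1) using I(2,3) dep by (rule lin_image_ball_infinite)
  moreover have "emeasure (lin_image B (\<lambda>b. b)) (convex hull (insert 0 (v ` {..<k}))) = 0"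
  proof -
    have sp: "span (v ` {..<k}) = span (v ` I)"
      unfolding I(1) image_insert using dep by (rule span_redundant)
    have "dim (v ` I) \<le> card (v ` I)" using I by (intro dim_le_card') auto
    also have "\<dots> \<le> card I" using I by (intro card_image_le)
    also have "\<dots> < k" using i by (simp add: I_def)
    also have "k = dim B" using B orthonormal_imp[OF B(1)] by (simp add: dim_eq_card_independent)
    finally have "dim (v ` I) < dim B" .
    moreover have "span (v ` I) \<subseteq> span B"
      using v sp by (metis span_minimal subspace_span)
    ultimately have "span (v ` I) \<subset> span B"
      by (auto simp: psubset_eq dest!: span_eq_dim)
    then obtain u where u: "u \<noteq> 0" "u \<in> span B" "\<And>y. y \<in> span (v ` I) \<Longrightarrow> orthogonal u y"
      using orthogonal_to_subspace_exists_gen by blast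
    have "convex hull (insert 0 (v ` {..<k})) \<subseteq> span (v ` {..<k})"
      by (intro hull_minimal) (auto intro: span_base span_zero subspace_imp_convex)
    also have "\<dots> \<subseteq> {y. u \<bullet> y = 0}" using u(3) sp by (auto simp: orthogonal_def)
    finally have "emeasure (lin_image B (\<lambda>b. b)) (convex hull (insert 0 (v ` {..<k}))) \<le>
        emeasure (lin_image B (\<lambda>b. b)) {y. u \<bullet> y = 0}"
      by (intro emeasure_mono) (auto simp: closed_hyperplane borel_closed)
    then show ?thesis
      using lin_image_hyperplane_null[OF orthonormal_imp(2)[OF B(1)] u(2,1)] by simp
  qed
  ultimately show ?thesis by simp
qed

text \<open>
  Provides the witness for the choice in the definition of \<open>kvol\<close>, also for degenerate simplices.
\<close>

lemma orthonormal_superspace: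
  fixes V :: "'a::euclidean_space set"
  assumes dim: "dim V \<le> k" "k \<le> DIM('a)"
  obtains B where "orthonormal B" "card B = k" "V \<subseteq> span B"
proof -
  obtain C where C: "C \<subseteq> span V" "pairwise orthogonal C" "\<And>x. x \<in> C \<Longrightarrow> norm x = 1"
      "independent C" "card C = dim (span V)" "span C = span V"
    using orthonormal_basis_subspace[OF subspace_span] by metis
  define U where "U = {y \<in> UNIV. \<forall>x\<in>span V. orthogonal x y}"
  have "subspace U"
    unfolding U_def by (rule subspaceI) (auto simp: orthogonal_clauses)
  then obtain D where D: "D \<subseteq> U" "pairwise orthogonal D" "\<And>x. x \<in> D \<Longrightarrow> norm x = 1"
      "independent D" "card D = dim U"
    by (rule orthonormal_basis_subspace) blast
  have "dim U + dim (span V) = DIM('a)"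
    using dim_subspace_orthogonal_to_vectors[of "span V" UNIV] by (simp add: U_def)
  then have "k - card C \<le> card D" using dim C D by simp
  then obtain E where E: "E \<subseteq> D" "card E = k - card C" by (meson obtain_subset_with_card_n)
  have fin: "finite C" "finite E"
    using C(4) D(4) E by (auto intro: finiteI_independent finite_subset)
  have orth: "orthogonal x y" if "x \<in> C" "y \<in> E" for x y
    using that C(1) subsetD[OF D(1) subsetD[OF E(1)]] by (auto simp: U_def)
  then have disj: "C \<inter> E = {}"
    using C(3) by (fastforce simp: orthogonal_def)
  show thesis
  proof (rule that[of "C \<union> E"])
    show "orthonormal (C \<union> E)"
      using C D E orth by (auto simp: orthonormal_def pairwise_def subset_iff)
        (metis orthogonal_commute)
    show "card (C \<union> E) = k"
      using fin disj E C dim by (simp add: card_Un_disjoint)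
    show "V \<subseteq> span (C \<union> E)"
      using C(6) by (metis Un_upper1 order_trans span_mono span_superset)
  qed
qed

lemma nth_minus_image:
  fixes xs :: "'a::euclidean_space list"
  assumes "length xs = Suc k"
  shows "insert 0 ((\<lambda>i. xs ! Suc i - xs ! 0) ` {..<k}) = (\<lambda>x. x - xs ! 0) ` set xs"
proof -
  obtain y ys where "xs = y # ys" "length ys = k" using assms by (cases xs) auto
  moreover from this have "set ys = (\<lambda>i. ys ! i) ` {..<k}" by (auto simp: set_conv_nth)
  ultimately show ?thesis by (simp add: image_image)
qed

lemma measure_flat_simplex:
  fixes xs :: "'a::euclidean_space list"
  assumes len: "length xs = Suc k" and B: "orthonormal B" "card B = k"
    and sub: "convex hull (set xs) \<subseteq> (+) p ` span B"
  shows "measure (flat_lborel p B) (convex hull (set xs)) =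
     enn2real (corner_simplex_vol k * euclid_ball_vol k / coeff_ball_vol k (\<lambda>i. xs ! Suc i - xs ! 0))"
proof -
  let ?x = "xs ! 0" and ?v = "\<lambda>i. xs ! Suc i - xs ! 0" and ?S = "convex hull (set xs)"
  let ?A = "convex hull (insert 0 (?v ` {..<k}))"
  have S: "?S \<in> sets borel" by (intro borel_compact finite_imp_compact_convex_hull) simp
  have A_eq: "?A = (\<lambda>x. - ?x + x) ` ?S"
    unfolding nth_minus_image[OF len] using convex_hull_translation[of "- ?x" "set xs"] by simp
  have A: "?A \<in> sets borel" by (intro borel_compact finite_imp_compact_convex_hull) simp
  have in_span: "y - p \<in> span B" if "y \<in> set xs" for y
    using sub hull_inc[OF that, of convex] by auto
  have x: "?x \<in> set xs" using len by (cases xs) auto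
  have v: "?v ` {..<k} \<subseteq> span B"
  proof clarify
    fix i assume "i < k"
    then have "xs ! Suc i \<in> set xs" using len by auto
    then have "(xs ! Suc i - p) - (?x - p) \<in> span B"
      using x by (intro span_diff in_span)
    then show "xs ! Suc i - ?x \<in> span B" by simp
  qed
  have "emeasure (flat_lborel p B) ?S = (\<integral>\<^sup>+y. indicator ?S y \<partial>flat_lborel p B)"
    using S by (simp add: flat_lborel_def)
  also have "\<dots> = (\<integral>\<^sup>+f. indicator ?S (p + (\<Sum>b\<in>B. f b *\<^sub>R b)) \<partial>(\<Pi>\<^sub>M b\<in>B. lborel))"
    unfolding flat_lborel_def using S by (subst nn_integral_distr) auto
  also have "\<dots> = (\<integral>\<^sup>+f. indicator ?A ((\<Sum>b\<in>B. f b *\<^sub>R b) + (p - ?x)) \<partial>(\<Pi>\<^sub>M b\<in>B. lborel))"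
    unfolding A_eq by (intro nn_integral_cong)
      (auto simp: indicator_def image_iff algebra_simps intro!: bexI[of _ "p + _"])
  also have "\<dots> = (\<integral>\<^sup>+y. indicator ?A (y + (p - ?x)) \<partial>lin_image B (\<lambda>b. b))"
    using A by (subst nn_integral_lin_image) auto
  also have "\<dots> = (\<integral>\<^sup>+y. indicator ?A y \<partial>lin_image B (\<lambda>b. b))"
    using A in_span[OF x] span_neg[OF in_span[OF x]] orthonormal_imp(2)[OF B(1)]
    by (intro nn_integral_lin_image_shift) auto
  also have "\<dots> = emeasure (lin_image B (\<lambda>b. b)) ?A" using A by simp
  also have "\<dots> = corner_simplex_vol k * euclid_ball_vol k / coeff_ball_vol k ?v"
    by (rule lin_image_orthonormal_simplex[OF B v])
  finally show ?thesis by (simp add: measure_def)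
qed

text \<open>
  The choice in the definition of \<open>kvol\<close> is immaterial, and the volume is an explicit function of the edge vectors that
  is measurable by Fubini's theorem and visibly homogeneous.
\<close>

theorem kvol_simplex:
  fixes xs :: "'a::euclidean_space list"
  assumes len: "length xs = Suc k" and k: "k \<le> DIM('a)"
  shows "kvol k (convex hull (set xs)) =
     enn2real (corner_simplex_vol k * euclid_ball_vol k / coeff_ball_vol k (\<lambda>i. xs ! Suc i - xs ! 0))"
proof -
  let ?v = "\<lambda>i. xs ! Suc i - xs ! 0"
  have "dim (?v ` {..<k}) \<le> card (?v ` {..<k})" by (intro dim_le_card') auto
  also have "\<dots> \<le> k" using card_image_le[of "{..<k}" ?v] by simp
  finally obtain B where B: "orthonormal B" "card B = k" "?v ` {..<k} \<subseteq> span B"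
    using orthonormal_superspace[OF _ k] by metis
  have "(\<lambda>x. x - xs ! 0) ` set xs \<subseteq> span B"
    unfolding nth_minus_image[OF len, symmetric] using B by (auto intro: span_zero)
  then have "set xs \<subseteq> (+) (xs ! 0) ` span B"
    by (force simp: image_iff)
  moreover have "convex ((+) (xs ! 0) ` span B)"
    by (intro convex_translation subspace_imp_convex subspace_span)
  ultimately have sub: "convex hull (set xs) \<subseteq> (+) (xs ! 0) ` span B"
    by (intro hull_minimal)
  show ?thesis
    unfolding kvol_def
  proof (rule some_equality)
    show "\<exists>p B. orthonormal B \<and> card B = k \<and> convex hull (set xs) \<subseteq> (+) p ` span B \<and>
        enn2real (corner_simplex_vol k * euclid_ball_vol k / coeff_ball_vol k ?v) =
        measure (flat_lborel p B) (convex hull (set xs))"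
      using B sub measure_flat_simplex[OF len B(1,2) sub] by metis
  next
    fix w assume "\<exists>p B. orthonormal B \<and> card B = k \<and> convex hull (set xs) \<subseteq> (+) p ` span B \<and>
        w = measure (flat_lborel p B) (convex hull (set xs))"
    then show "w = enn2real (corner_simplex_vol k * euclid_ball_vol k / coeff_ball_vol k ?v)"
      using measure_flat_simplex[OF len] by metis
  qed
qed

lemma coeff_ball_vol_cong: "(\<And>i. i < k \<Longrightarrow> v i = w i) \<Longrightarrow> coeff_ball_vol k v = coeff_ball_vol k w"
  unfolding coeff_ball_vol_def
  by (simp add: emeasure_lin_image)

lemma coeff_ball_vol_scale:
  fixes v :: "nat \<Rightarrow> 'a::euclidean_space"
  assumes s: "s > 0"
  shows "coeff_ball_vol k v = ennreal (s ^ k) * coeff_ball_vol k (\<lambda>i. s *\<^sub>R v i)"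
proof -
  have "coeff_ball_vol k v = (\<integral>\<^sup>+f. indicator (ball 0 1) (\<Sum>i<k. f i *\<^sub>R v i) \<partial>(\<Pi>\<^sub>M i\<in>{..<k}. lborel))"
    by (simp add: coeff_ball_vol_def emeasure_lin_image)
  also have "\<dots> = ennreal (s ^ k) *
      (\<integral>\<^sup>+f. indicator (ball 0 1) (\<Sum>i<k. (\<lambda>i\<in>{..<k}. 0 + s *\<^sub>R f i) i *\<^sub>R v i) \<partial>(\<Pi>\<^sub>M i\<in>{..<k}. lborel))"
    by (subst nn_integral_PiM_lborel_affine[OF finite_lessThan s, of _ _ "\<lambda>_. 0"])
      (rule measurable_compose[OF combo_measurable], simp, simp only: DIM_real card_lessThan mult_1)
  also have "(\<integral>\<^sup>+f. indicator (ball 0 1) (\<Sum>i<k. (\<lambda>i\<in>{..<k}. 0 + s *\<^sub>R f i) i *\<^sub>R v i) \<partial>(\<Pi>\<^sub>M i\<in>{..<k}. lborel)) =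
      coeff_ball_vol k (\<lambda>i. s *\<^sub>R v i)"
    unfolding coeff_ball_vol_def by (subst emeasure_lin_image)
      (auto intro!: nn_integral_cong arg_cong[where f="indicator _"] sum.cong simp: mult.commute)
  finally show ?thesis .
qed

lemma coeff_ball_vol_measurable [measurable]:
  assumes V: "\<And>i. i < k \<Longrightarrow> (\<lambda>\<omega>. V \<omega> i :: 'a::euclidean_space) \<in> borel_measurable N"
  shows "(\<lambda>\<omega>. coeff_ball_vol k (V \<omega>)) \<in> borel_measurable N"
proof -
  interpret sigma_finite_measure "\<Pi>\<^sub>M i\<in>{..<k}. (lborel::real measure)"
    by (rule lborel_product.sigma_finite) simp
  have "(\<lambda>\<omega>. \<integral>\<^sup>+f. indicator (ball 0 1) (\<Sum>i<k. f i *\<^sub>R V \<omega> i) \<partial>(\<Pi>\<^sub>M i\<in>{..<k}. lborel)) \<in> borel_measurable N"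
  proof (rule borel_measurable_nn_integral)
    have "(\<lambda>p. \<Sum>i<k. snd p i *\<^sub>R V (fst p) i) \<in> borel_measurable (N \<Otimes>\<^sub>M (\<Pi>\<^sub>M i\<in>{..<k}. lborel))"
      using V by (intro borel_measurable_sum borel_measurable_scaleR measurable_compose[OF measurable_fst]) auto
    then show "(\<lambda>(\<omega>, f). indicator (ball 0 1) (\<Sum>i<k. f i *\<^sub>R V \<omega> i))
        \<in> borel_measurable (N \<Otimes>\<^sub>M (\<Pi>\<^sub>M i\<in>{..<k}. lborel))"
      unfolding case_prod_beta' by (rule measurable_compose) simp
  qed
  then show ?thesis by (simp add: coeff_ball_vol_def emeasure_lin_image)
qed

lemma kvol_affine:
  fixes xs :: "'a::euclidean_space list"
  assumes len: "length xs = Suc k" and k: "k \<le> DIM('a)" and s: "s > 0"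
  shows "kvol k (convex hull (set (map (\<lambda>x. a + s *\<^sub>R x) xs))) = s ^ k * kvol k (convex hull (set xs))"
proof -
  let ?C = "corner_simplex_vol k * euclid_ball_vol k"
  let ?v = "\<lambda>i. xs ! Suc i - xs ! 0"
  have "coeff_ball_vol k (\<lambda>i. map (\<lambda>x. a + s *\<^sub>R x) xs ! Suc i - map (\<lambda>x. a + s *\<^sub>R x) xs ! 0) =
      coeff_ball_vol k (\<lambda>i. s *\<^sub>R ?v i)"
    using len by (intro coeff_ball_vol_cong) (simp add: scaleR_diff_right)
  moreover have "?C / coeff_ball_vol k (\<lambda>i. s *\<^sub>R ?v i) = ennreal (s ^ k) * (?C / coeff_ball_vol k ?v)"
  proof -
    have "ennreal (s ^ k) * (?C / coeff_ball_vol k ?v) =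
        (?C * ennreal (s ^ k)) / (coeff_ball_vol k (\<lambda>i. s *\<^sub>R ?v i) * ennreal (s ^ k))"
      by (subst coeff_ball_vol_scale[OF s]) (simp add: ennreal_times_divide mult.commute)
    also have "\<dots> = ?C / coeff_ball_vol k (\<lambda>i. s *\<^sub>R ?v i)"
      using s by (intro divide_mult_eq) auto
    finally show ?thesis by simp
  qed
  ultimately show ?thesis
    using kvol_simplex[OF len k] kvol_simplex[of "map (\<lambda>x. a + s *\<^sub>R x) xs" k] len k s
    by (simp add: enn2real_mult)
qed

section \<open>Powers of the volume as functions of the vertices\<close>

lemma Delta_pow_nonneg [simp]: "Delta_pow s \<alpha> xs \<ge> 0"
  by (simp add: Delta_pow_def)

lemma Delta_pow_affine:
  fixes xs :: "'a::euclidean_space list"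
  assumes len: "length xs = Suc k" and k: "k \<le> DIM('a) \<or> \<alpha> = 0" and s: "s > 0"
  shows "Delta_pow s \<alpha> (map (\<lambda>x. a + s *\<^sub>R x) xs) = s powr (\<alpha> * real k) * Delta_pow 1 \<alpha> xs"
proof -
  have "norm ((a + s *\<^sub>R x) - (a + s *\<^sub>R y)) = s * norm (x - y)" for x y :: 'a
    using s by (simp flip: scaleR_diff_right)
  then have "norm ((a + s *\<^sub>R x) - (a + s *\<^sub>R y)) \<le> s \<longleftrightarrow> norm (x - y) \<le> 1" for x y :: 'a
    using s by simp
  moreover have "kvol k (convex hull (set (map (\<lambda>x. a + s *\<^sub>R x) xs))) powr \<alpha> =
      s powr (\<alpha> * real k) * kvol k (convex hull (set xs)) powr \<alpha>" if "k \<le> DIM('a)"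
  proof -
    have "(s ^ k) powr \<alpha> = s powr (\<alpha> * real k)"
      using s by (simp flip: powr_realpow add: powr_powr mult.commute)
    then show ?thesis
      using s by (simp add: kvol_affine[OF len that s, of a] powr_mult kvol_simplex[OF len that] del: set_map)
  qed
  ultimately show ?thesis
    using k len s by (auto simp: Delta_pow_def simp del: set_map) (auto simp: Delta_pow_def)
qed

text \<open>
  The vertices are given as measurable functions, so that the same lemma serves simplices with vertex \<open>0\<close> and simplices
  whose vertices are components of a tuple.
\<close>

lemma Delta_pow_measurable:
  fixes fs :: "('w \<Rightarrow> 'a::euclidean_space) list"
  assumes len: "length fs = Suc k" and k: "k \<le> DIM('a) \<or> \<alpha> = 0"
    and fs: "\<And>f. f \<in> set fs \<Longrightarrow> f \<in> borel_measurable N"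
  shows "(\<lambda>\<omega>. Delta_pow s \<alpha> (map (\<lambda>f. f \<omega>) fs)) \<in> borel_measurable N"
proof -
  have close: "{\<omega> \<in> space N. \<forall>x\<in>set (map (\<lambda>f. f \<omega>) fs). \<forall>y\<in>set (map (\<lambda>f. f \<omega>) fs). norm (x - y) \<le> s} \<in> sets N"
    using fs by simp measurable
  have "(\<lambda>\<omega>. if \<alpha> = 0 then 1 else kvol (length (map (\<lambda>f. f \<omega>) fs) - 1)
      (convex hull (set (map (\<lambda>f. f \<omega>) fs))) powr \<alpha>) \<in> borel_measurable N"
  proof (cases "\<alpha> = 0")
    case False
    then have k: "k \<le> DIM('a)" using k by simp
    have "(\<lambda>\<omega>. (fs ! Suc i) \<omega> - (fs ! 0) \<omega>) \<in> borel_measurable N" if "i < k" for i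
      using that len fs by (intro borel_measurable_diff) auto
    moreover have "coeff_ball_vol k (\<lambda>i. map (\<lambda>f. f \<omega>) fs ! Suc i - map (\<lambda>f. f \<omega>) fs ! 0) =
        coeff_ball_vol k (\<lambda>i. (fs ! Suc i) \<omega> - (fs ! 0) \<omega>)" for \<omega>
      using len by (intro coeff_ball_vol_cong) simp
    ultimately show ?thesis
      using len kvol_simplex[of "map (\<lambda>f. f _) fs" k] k False
      by (simp del: set_map)
  qed simp
  then show ?thesis
    unfolding Delta_pow_def by (intro measurable_If[OF _ borel_measurable_const close])
qed

section \<open>The multivariate Mecke formula\<close>

lemma sets_intensity: "W \<in> sets borel \<Longrightarrow> B \<in> sets (intensity W t) \<longleftrightarrow> B \<in> sets borel \<and> B \<subseteq> W"
  by (auto simp: intensity_def sets_restrict_space_iff)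

lemma space_intensity: "space (intensity W t) = W"
  by (simp add: intensity_def space_scale_measure space_restrict_space)

lemma measure_intensity:
  assumes "t \<ge> 0" "W \<in> sets borel" "B \<subseteq> W"
  shows "measure (intensity W t) B = t * measure lborel B"
  using assms by (simp add: intensity_def measure_restrict_space)

text \<open>
  The tuples of distinct points, as functions on an initial segment so that they are points of a product space.
\<close>

definition inj_tuples :: "nat \<Rightarrow> 'a set \<Rightarrow> (nat \<Rightarrow> 'a) set" where
  "inj_tuples r X = {x \<in> {..<r} \<rightarrow>\<^sub>E X. inj_on x {..<r}}"

lemma finite_inj_tuples [simp]: "finite X \<Longrightarrow> finite (inj_tuples r X)"
  by (simp add: inj_tuples_def finite_PiE)

lemma card_inj_tuples: "finite X \<Longrightarrow> card (inj_tuples r X) = (\<Prod>i<r. card X - i)"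
  unfolding inj_tuples_def by (subst card_inj_on_subset_funcset) (auto simp: atLeast0LessThan)

lemma falling_fact: "(\<Prod>i<m. n + m - i) * fact n = (fact (n + m) :: nat)"
  by (induction m) (simp_all add: prod.lessThan_Suc_shift algebra_simps del: prod.lessThan_Suc)

text \<open>
  The falling factorial cancels part of the factorial in the Poisson weight and thereby shifts the exponential series by
  \<open>m\<close> terms.
\<close>

lemma poisson_factorial_moment_sums:
  fixes \<mu> :: real
  shows "(\<lambda>n. real (\<Prod>i<m. n - i) * (\<mu> ^ n / fact n * exp (- \<mu>))) sums \<mu> ^ m"
proof -
  let ?f = "\<lambda>n. real (\<Prod>i<m. n - i) * (\<mu> ^ n / fact n * exp (- \<mu>))"
  have "?f (n + m) = (\<mu> ^ m * exp (- \<mu>)) * (\<mu> ^ n / fact n)" for n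
  proof -
    have "real (\<Prod>i<m. n + m - i) * fact n = fact (n + m)"
      using arg_cong[OF falling_fact[of n m], of real] by (simp del: of_nat_prod)
    then have "real (\<Prod>i<m. n + m - i) = fact (n + m) / fact n"
      by (simp add: field_simps)
    then show ?thesis by (simp add: power_add field_simps)
  qed
  moreover have "(\<lambda>n. (\<mu> ^ m * exp (- \<mu>)) * (\<mu> ^ n / fact n)) sums ((\<mu> ^ m * exp (- \<mu>)) * exp \<mu>)"
    using exp_converges[of \<mu>] by (intro sums_mult) (simp add: divide_inverse_commute)
  ultimately have "(\<lambda>n. ?f (n + m)) sums \<mu> ^ m"
    by (simp add: mult.assoc flip: exp_add)
  moreover have "(\<Sum>n<m. ?f n) = 0"
    by (intro sum.neutral) auto
  ultimately show ?thesis
    using sums_iff_shift[of ?f m "\<mu> ^ m"] by (simp only: add_0_right)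
qed

lemma AE_PiM_lborel_neq:
  assumes I: "finite I" and ij: "i \<in> I" "j \<in> I" "i \<noteq> j"
  shows "AE x in (\<Pi>\<^sub>M i\<in>I. (lborel :: 'a::euclidean_space measure)). x i \<noteq> x j"
proof -
  define J where "J = I - {i}"
  have J: "finite J" "i \<notin> J" "I = insert i J" "j \<in> J" using I ij by (auto simp: J_def)
  let ?P = "\<Pi>\<^sub>M i\<in>I. (lborel :: 'a measure)"
  have m: "{x \<in> space ?P. x i = x j} \<in> sets ?P"
    using ij by measurable
  have "{x \<in> space ?P. x i = x j} = {x. x i = x j} \<inter> space ?P" by auto
  then have m': "(indicator {x. x i = x j} :: _ \<Rightarrow> ennreal) \<in> borel_measurable ?P"
    using m by (simp add: borel_measurable_indicator_iff)
  have "emeasure ?P {x \<in> space ?P. x i = x j} = (\<integral>\<^sup>+x. indicator {x. x i = x j} x \<partial>?P)"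
    by (subst nn_integral_indicator[OF m, symmetric]) (auto intro!: nn_integral_cong simp: indicator_def)
  also have "\<dots> = (\<integral>\<^sup>+x. (\<integral>\<^sup>+y. indicator {x. x i = x j} (x(i := y)) \<partial>lborel) \<partial>(\<Pi>\<^sub>M i\<in>J. (lborel :: 'a measure)))"
    using m' unfolding J(3) by (rule lborel_product.product_nn_integral_insert[OF J(1,2)])
  also have "\<dots> = (\<integral>\<^sup>+x. (0::ennreal) \<partial>(\<Pi>\<^sub>M i\<in>J. (lborel :: 'a measure)))"
  proof (rule nn_integral_cong)
    fix x :: "'b \<Rightarrow> 'a"
    have "(\<integral>\<^sup>+y. indicator {x. x i = x j} (x(i := y)) \<partial>lborel) = (\<integral>\<^sup>+y. indicator {x j} y \<partial>lborel)"
      using ij by (intro nn_integral_cong) (auto simp: indicator_def)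
    also have "\<dots> = (0::ennreal)" by simp
    finally show "(\<integral>\<^sup>+y. indicator {x. x i = x j} (x(i := y)) \<partial>lborel) = (0::ennreal)" .
  qed
  finally show ?thesis
    by (intro AE_I[where N="{x \<in> space ?P. x i = x j}"]) (use m in auto)
qed

lemma AE_PiM_lborel_inj:
  assumes "finite I"
  shows "AE x in (\<Pi>\<^sub>M i\<in>I. (lborel :: 'a::euclidean_space measure)). inj_on x I"
proof -
  have "AE x in (\<Pi>\<^sub>M i\<in>I. (lborel :: 'a measure)). \<forall>i\<in>I. \<forall>j\<in>I - {i}. x i \<noteq> x j"
    using assms by (intro AE_finite_allI) (auto intro: AE_PiM_lborel_neq)
  then show ?thesis by (rule AE_mp) (auto intro!: AE_I2 inj_onI)
qed

text \<open>
  On a box with disjoint sides the number of tuples of points of the process is a product of independent counts. These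
  boxes generate the measurable sets off the diagonals, and the diagonals are null sets.
\<close>

definition disjoint_boxes :: "nat \<Rightarrow> (nat \<Rightarrow> 'a::euclidean_space) set set" where
  "disjoint_boxes r = {Pi\<^sub>E {..<r} B | B. (\<forall>i<r. B i \<in> sets borel) \<and> disjoint_family_on B {..<r}}"

lemma Int_stable_disjoint_boxes: "Int_stable (disjoint_boxes r)"
proof (rule Int_stableI)
  fix a b :: "(nat \<Rightarrow> 'a) set" assume "a \<in> disjoint_boxes r" "b \<in> disjoint_boxes r"
  then obtain A B where "a = Pi\<^sub>E {..<r} A" "\<forall>i<r. A i \<in> sets borel" "disjoint_family_on A {..<r}"
      "b = Pi\<^sub>E {..<r} B" "\<forall>i<r. B i \<in> sets borel"
    by (auto simp: disjoint_boxes_def)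
  then show "a \<inter> b \<in> disjoint_boxes r"
    unfolding disjoint_boxes_def disjoint_family_on_def
    by (intro CollectI exI[of _ "\<lambda>i. A i \<inter> B i"]) (simp add: PiE_Int, blast)
qed

lemma disjoint_box_inj:
  assumes B: "disjoint_family_on B {..<r}" and x: "x \<in> Pi\<^sub>E {..<r} B"
  shows "x \<in> inj_tuples r UNIV"
proof -
  have "inj_on x {..<r}"
  proof (rule inj_onI, rule ccontr)
    fix i j assume ij: "i \<in> {..<r}" "j \<in> {..<r}" "x i = x j" "i \<noteq> j"
    then have "x i \<in> B i \<inter> B j" using x by (metis IntI PiE_mem)
    then show False using B ij by (auto simp: disjoint_family_on_def)
  qed
  then show ?thesis using x by (auto simp: inj_tuples_def PiE_iff)
qed

lemma disjoint_boxes_inj: "disjoint_boxes r \<subseteq> Pow (inj_tuples r UNIV)"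
proof (clarsimp simp: disjoint_boxes_def)
  fix B x assume "disjoint_family_on B {..<r}" "x \<in> Pi\<^sub>E {..<r} B"
  then show "x \<in> inj_tuples r UNIV" by (rule disjoint_box_inj)
qed

lemma finite_separation:
  fixes x :: "'i \<Rightarrow> 'a::metric_space"
  assumes I: "finite I" and inj: "inj_on x I"
  shows "\<exists>e>0. \<forall>i\<in>I. \<forall>j\<in>I. i \<noteq> j \<longrightarrow> 2 * e \<le> dist (x i) (x j)"
proof -
  \<comment> \<open>The element 1 only keeps the set nonempty.\<close>
  define S where "S = insert 1 ((\<lambda>(i, j). dist (x i) (x j)) ` {(i, j) \<in> I \<times> I. i \<noteq> j})"
  have "finite {(i, j) \<in> I \<times> I. i \<noteq> j}"
    by (rule finite_subset[OF _ finite_cartesian_product[OF I I]]) auto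
  then have S: "finite S" "S \<noteq> {}"
    by (simp_all add: S_def)
  have "\<forall>s\<in>S. s > 0" using inj by (auto simp: S_def inj_on_def)
  then have "Min S > 0" using S by simp
  moreover have "Min S \<le> dist (x i) (x j)" if "i \<in> I" "j \<in> I" "i \<noteq> j" for i j
    using S that by (intro Min_le) (auto simp: S_def)
  ultimately show ?thesis by (intro exI[of _ "Min S / 2"]) auto
qed

text \<open>
  Distinct points have disjoint neighbourhoods from a countable basis, so the part of a box off the diagonals is a
  countable union of boxes with disjoint sides.
\<close>

lemma box_Int_inj_in_sigma:
  assumes B: "\<And>i. i < r \<Longrightarrow> B i \<in> sets (borel :: 'a::euclidean_space measure)"
  shows "Pi\<^sub>E {..<r} B \<inter> inj_tuples r UNIV \<in> sigma_sets (inj_tuples r UNIV) (disjoint_boxes r)"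
proof -
  obtain \<B> :: "'a set set" where \<B>: "countable \<B>" "topological_basis \<B>"
    using ex_countable_basis by blast
  \<comment> \<open>Disjoint basic sets, one for each coordinate; there are countably many choices.\<close>
  define K where "K = {U \<in> {..<r} \<rightarrow>\<^sub>E \<B>. disjoint_family_on U {..<r}}"
  have K: "countable K"
    unfolding K_def using \<B>(1)
    by (intro countable_subset[OF _ countable_PiE[of "{..<r}" "\<lambda>_. \<B>"]]) auto
  have U_borel: "U i \<in> sets borel" if "U \<in> K" "i < r" for U i
    using that topological_basis_open[OF \<B>(2)] by (auto simp: K_def PiE_iff intro!: borel_open)
  have "Pi\<^sub>E {..<r} B \<inter> inj_tuples r UNIV = \<Union> ((\<lambda>U. \<Pi>\<^sub>E i\<in>{..<r}. B i \<inter> U i) ` K)"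
  proof (intro set_eqI iffI)
    fix x assume x: "x \<in> Pi\<^sub>E {..<r} B \<inter> inj_tuples r UNIV"
    then have "inj_on x {..<r}" by (simp add: inj_tuples_def)
    then obtain e where e: "e > 0" "\<And>i j. i < r \<Longrightarrow> j < r \<Longrightarrow> i \<noteq> j \<Longrightarrow> 2 * e \<le> dist (x i) (x j)"
      using finite_separation[of "{..<r}" x] by auto
    have "\<exists>U\<in>\<B>. x i \<in> U \<and> U \<subseteq> ball (x i) e" for i
      using topological_basisE[OF \<B>(2) open_ball, of "x i" "x i" e] e(1) by (metis centre_in_ball)
    then obtain U where U: "\<And>i. U i \<in> \<B>" "\<And>i. x i \<in> U i" "\<And>i. U i \<subseteq> ball (x i) e"
      by metis
    have "U i \<inter> U j = {}" if "i < r" "j < r" "i \<noteq> j" for i j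
    proof (rule ccontr)
      assume "U i \<inter> U j \<noteq> {}"
      then obtain y where "y \<in> U i" "y \<in> U j" by blast
      then have "dist (x i) y < e" "dist (x j) y < e" using U(3)[of i] U(3)[of j] by auto
      then have "dist (x i) (x j) < 2 * e"
        using dist_triangle_half_l[of "x i" y "2 * e" "x j"] by (simp add: dist_commute)
      then show False using e(2)[OF that] by simp
    qed
    then have "restrict U {..<r} \<in> K"
      using U(1) by (auto simp: K_def disjoint_family_on_def)
    moreover have "x \<in> (\<Pi>\<^sub>E i\<in>{..<r}. B i \<inter> restrict U {..<r} i)"
      using x U(2) by (auto simp: PiE_iff)
    ultimately show "x \<in> \<Union> ((\<lambda>U. \<Pi>\<^sub>E i\<in>{..<r}. B i \<inter> U i) ` K)" by blast
  next
    fix x assume "x \<in> \<Union> ((\<lambda>U. \<Pi>\<^sub>E i\<in>{..<r}. B i \<inter> U i) ` K)"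
    then obtain U where U: "U \<in> K" "x \<in> (\<Pi>\<^sub>E i\<in>{..<r}. B i \<inter> U i)" by blast
    then have "x \<in> Pi\<^sub>E {..<r} U" "x \<in> Pi\<^sub>E {..<r} B" by (auto simp: PiE_iff)
    with U(1) show "x \<in> Pi\<^sub>E {..<r} B \<inter> inj_tuples r UNIV"
      by (auto simp: K_def intro: disjoint_box_inj)
  qed
  also have "\<dots> \<in> sigma_sets (inj_tuples r UNIV) (disjoint_boxes r)"
  proof (rule sigma_sets_UNION)
    show "countable ((\<lambda>U. \<Pi>\<^sub>E i\<in>{..<r}. B i \<inter> U i) ` K)" using K by simp
  next
    fix b assume "b \<in> (\<lambda>U. \<Pi>\<^sub>E i\<in>{..<r}. B i \<inter> U i) ` K"
    then obtain U where U: "U \<in> K" "b = (\<Pi>\<^sub>E i\<in>{..<r}. B i \<inter> U i)" by blast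
    have "disjoint_family_on (\<lambda>i. B i \<inter> U i) {..<r}"
      using U(1) unfolding K_def disjoint_family_on_def by blast
    then have "b \<in> disjoint_boxes r"
      unfolding disjoint_boxes_def U(2) using B U_borel[OF U(1)]
      by (intro CollectI exI[of _ "\<lambda>i. B i \<inter> U i"]) auto
    then show "b \<in> sigma_sets (inj_tuples r UNIV) (disjoint_boxes r)" by (rule sigma_sets.Basic)
  qed
  finally show ?thesis .
qed

lemma sets_PiM_Int_inj:
  assumes E: "E \<in> sets (\<Pi>\<^sub>M i\<in>{..<r}. (lborel :: 'a::euclidean_space measure))"
  shows "E \<inter> inj_tuples r UNIV \<in> sigma_sets (inj_tuples r UNIV) (disjoint_boxes r)"
proof -
  let ?D = "inj_tuples r (UNIV :: 'a set)" and ?\<Sigma> = "sigma_sets (inj_tuples r UNIV) (disjoint_boxes r)"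
  interpret sigma_algebra ?D ?\<Sigma>
    using disjoint_boxes_inj by (rule sigma_algebra_sigma_sets)
  have "E \<in> sigma_sets ({..<r} \<rightarrow>\<^sub>E UNIV) {Pi\<^sub>E {..<r} X | X. X \<in> {..<r} \<rightarrow> sets (borel :: 'a measure)}"
    using E by (simp add: sets_PiM prod_algebra_eq_finite)
  then show ?thesis
  proof (induction rule: sigma_sets.induct)
    case (Basic a)
    then show ?case by (auto intro!: box_Int_inj_in_sigma)
  next
    case Empty
    then show ?case by simp
  next
    case (Compl a)
    have "({..<r} \<rightarrow>\<^sub>E UNIV) \<inter> ?D = ?D" by (auto simp: inj_tuples_def)
    then have "(({..<r} \<rightarrow>\<^sub>E UNIV) - a) \<inter> ?D = ?D - (a \<inter> ?D)" by auto
    then show ?case using Compl by auto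
  next
    case (Union a)
    have "(\<Union>i. a i) \<inter> ?D = (\<Union>i. a i \<inter> ?D)" by auto
    then show ?case using Union.IH by (metis sigma_sets.Union)
  qed
qed

lemma disjoint_boxes_in_sets:
  assumes "E \<in> sigma_sets (inj_tuples r UNIV) (disjoint_boxes r)"
  shows "E \<in> sets (\<Pi>\<^sub>M i\<in>{..<r}. (lborel :: 'a::euclidean_space measure))"
proof -
  let ?P = "\<Pi>\<^sub>M i\<in>{..<r}. (lborel :: 'a measure)"
  have D: "inj_tuples r UNIV \<in> sets ?P"
  proof -
    have eq: "{x \<in> space ?P. x i = x j} \<in> sets ?P" if "i \<in> {..<r}" "j \<in> {..<r}" for i j
      using that by measurable
    have "inj_tuples r UNIV = {x \<in> space ?P. \<forall>i\<in>{..<r}. \<forall>j\<in>{..<r}. x i = x j \<longrightarrow> i = j}"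
      by (auto simp: inj_tuples_def space_PiM inj_on_def)
    also have "\<dots> \<in> sets ?P"
      by (intro sets.sets_Collect_finite_All sets.sets_Collect_imp sets.sets_Collect_const eq) auto
    finally show ?thesis .
  qed
  show ?thesis
    using assms
  proof (induction rule: sigma_sets.induct)
    case (Basic a)
    then show ?case by (auto simp: disjoint_boxes_def intro!: sets_PiM_I_finite)
  qed (use D in auto)
qed

lemma measurable_nn_integral_cong:
  assumes "\<And>x. x \<in> space M \<Longrightarrow> f x = g x"
    and "g \<in> borel_measurable M \<and> (\<integral>\<^sup>+x. g x \<partial>M) = c"
  shows "f \<in> borel_measurable M \<and> (\<integral>\<^sup>+x. f x \<partial>M) = c"
  using assms by (auto cong: measurable_cong nn_integral_cong)

text \<open>
  The laws are stated for Borel sets \<open>B\<close> of the whole space: the points of the process lie in \<open>W\<close>, so \<open>B\<close> and \<open>B \<inter> W\<close>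
  contain the same ones.
\<close>

locale poisson_window =
  fixes M :: "'w measure" and W :: "'a::euclidean_space set" and t :: real and \<eta> :: "'w \<Rightarrow> 'a set"
  assumes pp: "poisson_process M (intensity W t) \<eta>"
    and W [measurable]: "W \<in> sets borel" and W_finite: "emeasure lborel W < \<infinity>" and t: "t > 0"
begin

sublocale prob_space M
  using pp by (simp add: poisson_process_def)

lemma finite_\<eta> [simp]: "\<omega> \<in> space M \<Longrightarrow> finite (\<eta> \<omega>)"
  and \<eta>_sub: "\<omega> \<in> space M \<Longrightarrow> \<eta> \<omega> \<subseteq> W"
  using pp by (auto simp: poisson_process_def space_intensity)

lemma count_window: "\<omega> \<in> space M \<Longrightarrow> \<eta> \<omega> \<inter> (B \<inter> W) = \<eta> \<omega> \<inter> B"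
  using \<eta>_sub by auto

lemma count_measurable:
  assumes "B \<in> sets borel"
  shows "(\<lambda>\<omega>. card (\<eta> \<omega> \<inter> B)) \<in> M \<rightarrow>\<^sub>M count_space UNIV"
proof -
  have "B \<inter> W \<in> sets (intensity W t)" using assms W by (simp add: sets_intensity)
  then have "(\<lambda>\<omega>. card (\<eta> \<omega> \<inter> (B \<inter> W))) \<in> M \<rightarrow>\<^sub>M count_space UNIV"
    using pp by (simp add: poisson_process_def)
  then show ?thesis by (subst measurable_cong[symmetric]) (simp_all add: count_window)
qed

lemma count_prob:
  assumes "B \<in> sets borel"
  shows "prob {\<omega> \<in> space M. card (\<eta> \<omega> \<inter> B) = n} =
    (t * measure lborel (B \<inter> W)) ^ n / fact n * exp (- (t * measure lborel (B \<inter> W)))"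
proof -
  have "B \<inter> W \<in> sets (intensity W t)" using assms W by (simp add: sets_intensity)
  then have "prob {\<omega> \<in> space M. card (\<eta> \<omega> \<inter> (B \<inter> W)) = n} =
      measure (intensity W t) (B \<inter> W) ^ n / fact n * exp (- measure (intensity W t) (B \<inter> W))"
    using pp by (simp add: poisson_process_def)
  moreover have "{\<omega> \<in> space M. card (\<eta> \<omega> \<inter> (B \<inter> W)) = n} = {\<omega> \<in> space M. card (\<eta> \<omega> \<inter> B) = n}"
    using count_window by auto
  ultimately show ?thesis using t W by (simp add: measure_intensity)
qed

lemma count_indep:
  fixes B :: "nat \<Rightarrow> 'a set"
  assumes B: "\<And>i. i < r \<Longrightarrow> B i \<in> sets borel" "disjoint_family_on B {..<r}"
  shows "indep_vars (\<lambda>_. count_space UNIV) (\<lambda>i \<omega>. card (\<eta> \<omega> \<inter> (B i \<inter> W))) {..<r}"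
proof -
  have *: "(\<lambda>i. B i \<inter> W) ` {..<r} \<subseteq> sets (intensity W t)"
    using B W by (auto simp: sets_intensity)
  have **: "disjoint_family_on (\<lambda>i. B i \<inter> W) {..<r}"
    using B(2) by (auto simp: disjoint_family_on_def)
  have "\<forall>r (B :: nat \<Rightarrow> 'a set). B ` {..<r} \<subseteq> sets (intensity W t) \<and> disjoint_family_on B {..<r} \<longrightarrow>
      indep_vars (\<lambda>_. count_space UNIV) (\<lambda>i \<omega>. card (\<eta> \<omega> \<inter> B i)) {..<r}"
    using pp unfolding poisson_process_def by (elim conjE) assumption
  from this[rule_format, OF conjI[OF * **]] show ?thesis .
qed

lemma factorial_moment:
  assumes B: "B \<in> sets borel"
  shows "(\<integral>\<^sup>+\<omega>. of_nat (\<Prod>i<m. card (\<eta> \<omega> \<inter> B) - i) \<partial>M) = ennreal ((t * measure lborel (B \<inter> W)) ^ m)"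
proof -
  let ?N = "\<lambda>\<omega>. card (\<eta> \<omega> \<inter> B)" and ?\<mu> = "t * measure lborel (B \<inter> W)"
  let ?f = "\<lambda>n. \<Prod>i<m. n - i :: nat"
  note N [measurable] = count_measurable[OF B]
  have [measurable]: "{\<omega> \<in> space M. ?N \<omega> = n} \<in> sets M" for n by measurable
  have "(\<integral>\<^sup>+\<omega>. of_nat (?f (?N \<omega>)) \<partial>M) = (\<integral>\<^sup>+\<omega>. (\<Sum>n. of_nat (?f n) * indicator {\<omega> \<in> space M. ?N \<omega> = n} \<omega>) \<partial>M)"
  proof (rule nn_integral_cong)
    fix \<omega> assume "\<omega> \<in> space M"
    then have "(\<Sum>n. of_nat (?f n) * indicator {\<omega> \<in> space M. ?N \<omega> = n} \<omega> :: ennreal) =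
        (\<Sum>n\<in>{?N \<omega>}. of_nat (?f n) * indicator {\<omega> \<in> space M. ?N \<omega> = n} \<omega>)"
      by (intro suminf_finite) (auto simp: indicator_def)
    also have "\<dots> = of_nat (?f (?N \<omega>))"
      using \<open>\<omega> \<in> space M\<close> by simp
    finally show "of_nat (?f (?N \<omega>)) =
        (\<Sum>n. of_nat (?f n) * indicator {\<omega> \<in> space M. ?N \<omega> = n} \<omega> :: ennreal)" ..
  qed
  also have "\<dots> = (\<Sum>n. of_nat (?f n) * emeasure M {\<omega> \<in> space M. ?N \<omega> = n})"
    by (subst nn_integral_suminf) (simp_all add: nn_integral_cmult)
  also have "\<dots> = (\<Sum>n. ennreal (real (?f n) * (?\<mu> ^ n / fact n * exp (- ?\<mu>))))"
    by (intro suminf_cong, subst ennreal_mult') (simp_all add: emeasure_eq_measure count_prob[OF B]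
        ennreal_of_nat_eq_real_of_nat del: of_nat_prod)
  also have "\<dots> = ennreal (?\<mu> ^ m)"
    using poisson_factorial_moment_sums[of m ?\<mu>] t
    by (intro suminf_ennreal_eq) (auto simp del: of_nat_prod)
  finally show ?thesis .
qed

lemma emeasure_window_box:
  fixes B :: "nat \<Rightarrow> 'a set"
  assumes "\<And>i. i < r \<Longrightarrow> B i \<in> sets borel"
  shows "emeasure (\<Pi>\<^sub>M i\<in>{..<r}. lborel) (Pi\<^sub>E {..<r} B \<inter> ({..<r} \<rightarrow>\<^sub>E W)) =
    (\<Prod>i<r. ennreal (measure lborel (B i \<inter> W)))"
proof -
  have "emeasure lborel (B i \<inter> W) \<noteq> \<infinity>" for i
    using W_finite emeasure_mono[of "B i \<inter> W" W lborel] by (auto simp: top_unique less_top)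
  then show ?thesis
    using assms by (subst PiE_Int, subst lborel_product.emeasure_PiM[OF finite_lessThan])
      (auto simp: emeasure_eq_ennreal_measure)
qed

text \<open>
  A Dynkin argument. On a generating box both sides are the product of the means of the counts. Passing to complements
  needs that the total mass is finite and equal on both sides; it is the factorial moment of the number of all points.
\<close>

lemma mecke_set:
  assumes E: "E \<in> sigma_sets (inj_tuples r UNIV) (disjoint_boxes r)"
  shows "(\<lambda>\<omega>. emeasure (count_space UNIV) (inj_tuples r (\<eta> \<omega>) \<inter> E)) \<in> borel_measurable M \<and>
    (\<integral>\<^sup>+\<omega>. emeasure (count_space UNIV) (inj_tuples r (\<eta> \<omega>) \<inter> E) \<partial>M) =
      ennreal (t ^ r) * emeasure (\<Pi>\<^sub>M i\<in>{..<r}. lborel) (E \<inter> ({..<r} \<rightarrow>\<^sub>E W))"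
  (is "?P E")
proof -
  let ?L = "\<Pi>\<^sub>M i\<in>{..<r}. (lborel :: 'a measure)" and ?D = "inj_tuples r (UNIV :: 'a set)"
  let ?N = "\<lambda>E \<omega>. emeasure (count_space UNIV) (inj_tuples r (\<eta> \<omega>) \<inter> E)"
  let ?W = "{..<r} \<rightarrow>\<^sub>E W"
  have W': "?W \<in> sets ?L" using W by (intro sets_PiM_I_finite) auto
  have D: "?D \<in> sets ?L" by (intro disjoint_boxes_in_sets sigma_sets_top)
  have full: "?P ?D"
  proof -
    have eq: "?N ?D \<omega> = of_nat (\<Prod>i<r. card (\<eta> \<omega> \<inter> UNIV) - i)"
      if "\<omega> \<in> space M" for \<omega>
    proof -
      have "inj_tuples r (\<eta> \<omega>) \<inter> ?D = inj_tuples r (\<eta> \<omega>)" by (auto simp: inj_tuples_def)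
      then show ?thesis using that by (simp add: card_inj_tuples del: of_nat_prod)
    qed
    have [measurable]: "(\<lambda>\<omega>. card (\<eta> \<omega> \<inter> UNIV)) \<in> M \<rightarrow>\<^sub>M count_space UNIV"
      by (rule count_measurable) simp
    have "AE x in ?L. x \<in> ?D \<inter> ?W \<longleftrightarrow> x \<in> ?W"
      using AE_PiM_lborel_inj[of "{..<r}", where 'a='a] by (auto simp: inj_tuples_def PiE_iff)
    then have "emeasure ?L (?D \<inter> ?W) = emeasure ?L ?W"
      using D W' by (intro emeasure_eq_AE) auto
    also have "\<dots> = (\<Prod>i<r. ennreal (measure lborel W))"
      using emeasure_window_box[of r "\<lambda>_. UNIV"] by (simp add: PiE_Int)
    finally have "ennreal (t ^ r) * emeasure ?L (?D \<inter> ?W) = ennreal ((t * measure lborel (UNIV \<inter> W)) ^ r)"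
      using t by (simp add: power_mult_distrib ennreal_mult ennreal_power)
    moreover have "(\<lambda>\<omega>. of_nat (\<Prod>i<r. card (\<eta> \<omega> \<inter> UNIV) - i) :: ennreal) \<in> borel_measurable M"
      by measurable
    ultimately show ?thesis
      using factorial_moment[of UNIV r]
      by (intro measurable_nn_integral_cong[OF eq]) auto
  qed
  show ?thesis
    using Int_stable_disjoint_boxes disjoint_boxes_inj E
  proof (induction rule: sigma_sets_induct_disjoint)
    case (basic A)
    then obtain B where B: "A = Pi\<^sub>E {..<r} B" "\<And>i. i < r \<Longrightarrow> B i \<in> sets borel" "disjoint_family_on B {..<r}"
      by (auto simp: disjoint_boxes_def)
    have eq: "?N A \<omega> = (\<Prod>i<r. of_nat (card (\<eta> \<omega> \<inter> B i)))"
      if "\<omega> \<in> space M" for \<omega>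
    proof -
      have "A \<subseteq> ?D" using basic disjoint_boxes_inj by blast
      then have "inj_tuples r (\<eta> \<omega>) \<inter> A = (\<Pi>\<^sub>E i\<in>{..<r}. \<eta> \<omega> \<inter> B i)"
        unfolding B by (auto simp: inj_tuples_def PiE_iff subset_iff)
      then show ?thesis using that by (simp add: card_PiE finite_PiE)
    qed
    have [measurable]: "(\<lambda>\<omega>. card (\<eta> \<omega> \<inter> B i)) \<in> M \<rightarrow>\<^sub>M count_space UNIV" if "i < r" for i
      using B(2)[OF that] by (rule count_measurable)
    have meas: "(\<lambda>\<omega>. \<Prod>i<r. of_nat (card (\<eta> \<omega> \<inter> B i)) :: ennreal) \<in> borel_measurable M"
    proof (rule borel_measurable_prod_ennreal)
      fix i assume "i \<in> {..<r}"
      then show "(\<lambda>\<omega>. of_nat (card (\<eta> \<omega> \<inter> B i)) :: ennreal) \<in> borel_measurable M"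
        using measurable_compose[OF count_measurable[OF B(2)], of i of_nat borel] by simp
    qed
    have "(\<integral>\<^sup>+\<omega>. (\<Prod>i<r. of_nat (card (\<eta> \<omega> \<inter> B i))) \<partial>M) =
        (\<integral>\<^sup>+\<omega>. (\<Prod>i<r. of_nat (card (\<eta> \<omega> \<inter> (B i \<inter> W)))) \<partial>M)"
      by (intro nn_integral_cong) (simp add: count_window)
    also have "\<dots> = (\<Prod>i<r. \<integral>\<^sup>+\<omega>. of_nat (card (\<eta> \<omega> \<inter> (B i \<inter> W))) \<partial>M)"
    proof (rule indep_vars_nn_integral)
      show "indep_vars (\<lambda>_. borel) (\<lambda>i \<omega>. of_nat (card (\<eta> \<omega> \<inter> (B i \<inter> W))) :: ennreal) {..<r}"
        by (rule indep_vars_compose2[OF count_indep[OF B(2,3)], where Y="\<lambda>_. of_nat"]) auto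
    qed auto
    also have "\<dots> = (\<Prod>i<r. ennreal (t * measure lborel (B i \<inter> W)))"
    proof (rule prod.cong)
      fix i assume "i \<in> {..<r}"
      then have "B i \<inter> W \<in> sets borel" using B(2) W by auto
      from factorial_moment[OF this, of 1]
      show "(\<integral>\<^sup>+\<omega>. of_nat (card (\<eta> \<omega> \<inter> (B i \<inter> W))) \<partial>M) = ennreal (t * measure lborel (B i \<inter> W))"
        by (simp add: Int_assoc)
    qed simp
    also have "\<dots> = ennreal (t ^ r) * emeasure ?L (A \<inter> ?W)"
      unfolding B(1) using t
      by (subst emeasure_window_box[OF B(2)]) (simp_all add: ennreal_mult prod.distrib ennreal_power)
    finally show ?case
      using meas by (intro measurable_nn_integral_cong[OF eq]) auto
  next
    case empty
    then show ?case by simp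
  next
    case (compl A)
    have A_sets: "A \<in> sets ?L" using compl(1) by (rule disjoint_boxes_in_sets)
    have A_sub: "A \<subseteq> ?D"
      using compl(1) disjoint_boxes_inj by (meson sigma_sets_into_sp)
    have eq: "?N (?D - A) \<omega> = ?N ?D \<omega> - ?N A \<omega>" if "\<omega> \<in> space M" for \<omega>
    proof -
      have "inj_tuples r (\<eta> \<omega>) \<inter> (?D - A) = (inj_tuples r (\<eta> \<omega>) \<inter> ?D) - (inj_tuples r (\<eta> \<omega>) \<inter> A)"
        by auto
      then show ?thesis
        using that A_sub by (simp only:) (subst emeasure_Diff, auto)
    qed
    have fin: "emeasure ?L (A \<inter> ?W) \<noteq> \<infinity>"
    proof -
      have "emeasure ?L (A \<inter> ?W) \<le> emeasure ?L ?W" using W' by (intro emeasure_mono) auto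
      also have "\<dots> = (\<Prod>i<r. ennreal (measure lborel W))"
        using emeasure_window_box[of r "\<lambda>_. UNIV"] by (simp add: PiE_Int)
      also have "\<dots> < \<infinity>" by (simp add: ennreal_power power_less_top_ennreal)
      finally show ?thesis by simp
    qed
    have "(\<integral>\<^sup>+\<omega>. ?N ?D \<omega> - ?N A \<omega> \<partial>M) =
        ennreal (t ^ r) * emeasure ?L (?D \<inter> ?W) - ennreal (t ^ r) * emeasure ?L (A \<inter> ?W)"
      using full compl(2) fin A_sub
      by (subst nn_integral_diff) (auto intro!: AE_I2 emeasure_mono card_mono simp: ennreal_mult_eq_top_iff)
    also have "\<dots> = ennreal (t ^ r) * (emeasure ?L (?D \<inter> ?W) - emeasure ?L (A \<inter> ?W))"
      by (simp add: ennreal_right_diff_distrib)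
    also have "emeasure ?L (?D \<inter> ?W) - emeasure ?L (A \<inter> ?W) = emeasure ?L ((?D - A) \<inter> ?W)"
      using A_sub A_sets D W' fin by (subst emeasure_Diff[symmetric]) (auto intro!: arg_cong[where f="emeasure _"])
    finally have "(\<integral>\<^sup>+\<omega>. ?N ?D \<omega> - ?N A \<omega> \<partial>M) =
        ennreal (t ^ r) * emeasure ?L ((?D - A) \<inter> ?W)" .
    moreover have "(\<lambda>\<omega>. ?N ?D \<omega> - ?N A \<omega>) \<in> borel_measurable M"
      using full compl(2) by (intro borel_measurable_minus_ennreal) auto
    ultimately show ?case by (intro measurable_nn_integral_cong[OF eq] conjI)
  next
    case (union A)
    have A_sets: "A i \<in> sets ?L" for i using union(2) by (intro disjoint_boxes_in_sets) auto
    have eq: "?N (\<Union>i. A i) \<omega> =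
        (\<Sum>i. ?N (A i) \<omega>)" for \<omega>
      using union(1) unfolding Int_UN_distrib
      by (intro suminf_emeasure[symmetric]) (auto simp: disjoint_family_on_def)
    have "(\<integral>\<^sup>+\<omega>. (\<Sum>i. ?N (A i) \<omega>) \<partial>M) =
        (\<Sum>i. ennreal (t ^ r) * emeasure ?L (A i \<inter> ?W))"
      using union(3) by (subst nn_integral_suminf) auto
    also have "\<dots> = ennreal (t ^ r) * (\<Sum>i. emeasure ?L (A i \<inter> ?W))"
      by (rule ennreal_suminf_cmult)
    also have "(\<Sum>i. emeasure ?L (A i \<inter> ?W)) = emeasure ?L (\<Union>i. A i \<inter> ?W)"
      using union(1) A_sets W' by (intro suminf_emeasure) (auto simp: disjoint_family_on_def)
    finally show ?case
      unfolding eq using union(3) by (intro conjI borel_measurable_suminf_order) auto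
  qed
qed

text \<open>
  The general case follows from indicators by the usual approximation, since the inner sum is finite.
\<close>

theorem mecke:
  assumes F: "F \<in> borel_measurable (\<Pi>\<^sub>M i\<in>{..<r}. (lborel :: 'a measure))"
  shows "(\<lambda>\<omega>. \<Sum>x\<in>inj_tuples r (\<eta> \<omega>). F x :: ennreal) \<in> borel_measurable M"
    and "(\<integral>\<^sup>+\<omega>. (\<Sum>x\<in>inj_tuples r (\<eta> \<omega>). F x) \<partial>M) =
      ennreal (t ^ r) * (\<integral>\<^sup>+x. F x * indicator ({..<r} \<rightarrow>\<^sub>E W) x \<partial>(\<Pi>\<^sub>M i\<in>{..<r}. lborel))"
proof -
  let ?L = "\<Pi>\<^sub>M i\<in>{..<r}. (lborel :: 'a measure)"
  let ?W = "{..<r} \<rightarrow>\<^sub>E W" and ?T = "\<lambda>\<omega>. inj_tuples r (\<eta> \<omega>)"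
  have W' [measurable]: "?W \<in> sets ?L" using W by (intro sets_PiM_I_finite) auto
  from F have "(\<lambda>\<omega>. \<Sum>x\<in>?T \<omega>. F x :: ennreal) \<in> borel_measurable M \<and>
    (\<integral>\<^sup>+\<omega>. (\<Sum>x\<in>?T \<omega>. F x) \<partial>M) = ennreal (t ^ r) * (\<integral>\<^sup>+x. F x * indicator ?W x \<partial>?L)"
  proof (induction rule: borel_measurable_induct)
    case (cong f g)
    have "(\<Sum>x\<in>?T \<omega>. f x) = (\<Sum>x\<in>?T \<omega>. g x)" for \<omega>
      using cong(3) by (intro sum.cong) (auto simp: inj_tuples_def space_PiM PiE_iff)
    moreover have "(\<integral>\<^sup>+x. f x * indicator ?W x \<partial>?L) = (\<integral>\<^sup>+x. g x * indicator ?W x \<partial>?L)"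
      using cong(3) by (intro nn_integral_cong) simp
    ultimately show ?case using cong(4) by simp
  next
    case (set A)
    let ?A = "A \<inter> inj_tuples r UNIV"
    have eq: "emeasure (count_space UNIV) (?T \<omega> \<inter> ?A) = (\<Sum>x\<in>?T \<omega>. indicator A x)" if "\<omega> \<in> space M" for \<omega>
    proof -
      have "?T \<omega> \<inter> ?A = ?T \<omega> \<inter> A" by (auto simp: inj_tuples_def)
      then show ?thesis using that by (simp add: indicator_def sum.If_cases Int_def)
    qed
    have "AE x in ?L. x \<in> ?A \<inter> ?W \<longleftrightarrow> x \<in> A \<inter> ?W"
      using AE_PiM_lborel_inj[of "{..<r}", where 'a='a] by (auto simp: inj_tuples_def PiE_iff)
    then have "emeasure ?L (?A \<inter> ?W) = emeasure ?L (A \<inter> ?W)"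
      using set disjoint_boxes_in_sets[OF sets_PiM_Int_inj[OF set]]
      by (intro emeasure_eq_AE) auto
    also have "\<dots> = (\<integral>\<^sup>+x. indicator A x * indicator ?W x \<partial>?L)"
      using set by (simp add: indicator_inter_arith[symmetric])
    finally show ?case
      using mecke_set[OF sets_PiM_Int_inj[OF set]]
      by (intro measurable_nn_integral_cong[OF eq[symmetric]]) auto
  next
    case (mult u c)
    then show ?case
      by (auto simp: sum_distrib_left[symmetric] nn_integral_cmult mult.assoc mult.left_commute)
  next
    case (add u v)
    then show ?case
      by (auto simp: sum.distrib nn_integral_add distrib_right distrib_left)
  next
    case (seq U)
    have sum_SUP: "(\<Sum>x\<in>?T \<omega>. (SUP i. U i) x) = (SUP i. \<Sum>x\<in>?T \<omega>. U i x)" for \<omega>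
      using seq(3) unfolding SUP_apply
      by (intro ennreal_SUP_sum[symmetric]) (auto simp: incseq_def le_fun_def)
    have inc: "incseq (\<lambda>i \<omega>. \<Sum>x\<in>?T \<omega>. U i x)"
      using seq(3) by (auto simp: incseq_def le_fun_def intro!: sum_mono)
    have inc': "incseq (\<lambda>i x. U i x * indicator ?W x)"
      using seq(3) by (auto simp: incseq_def le_fun_def intro!: mult_right_mono)
    have "(\<integral>\<^sup>+\<omega>. (\<Sum>x\<in>?T \<omega>. (SUP i. U i) x) \<partial>M) = (SUP i. \<integral>\<^sup>+\<omega>. (\<Sum>x\<in>?T \<omega>. U i x) \<partial>M)"
      unfolding sum_SUP using inc seq by (intro nn_integral_monotone_convergence_SUP) auto
    also have "\<dots> = (SUP i. ennreal (t ^ r) * (\<integral>\<^sup>+x. U i x * indicator ?W x \<partial>?L))"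
      using seq by simp
    also have "\<dots> = ennreal (t ^ r) * (SUP i. \<integral>\<^sup>+x. U i x * indicator ?W x \<partial>?L)"
      by (simp add: SUP_mult_left_ennreal)
    also have "(SUP i. \<integral>\<^sup>+x. U i x * indicator ?W x \<partial>?L) = (\<integral>\<^sup>+x. (SUP i. U i x * indicator ?W x) \<partial>?L)"
      using inc' seq(1) by (intro nn_integral_monotone_convergence_SUP[symmetric]) auto
    also have "\<dots> = (\<integral>\<^sup>+x. (SUP i. U i) x * indicator ?W x \<partial>?L)"
      by (intro nn_integral_cong) (simp add: SUP_mult_right_ennreal SUP_apply image_comp)
    finally show ?case
      using seq(5) unfolding sum_SUP by (auto intro: borel_measurable_SUP)
  qed
  then show "(\<lambda>\<omega>. \<Sum>x\<in>?T \<omega>. F x :: ennreal) \<in> borel_measurable M"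
    "(\<integral>\<^sup>+\<omega>. (\<Sum>x\<in>?T \<omega>. F x) \<partial>M) = ennreal (t ^ r) * (\<integral>\<^sup>+x. F x * indicator ?W x \<partial>?L)"
    by auto
qed

end

section \<open>Pairs of simplices with a given number of common vertices\<close>

text \<open>
  Functions on a disjoint union are pairs of functions.
\<close>

lemma card_PiE_split:
  assumes "I \<inter> J = {}"
    and "\<And>x y. (\<And>i. i \<in> I \<Longrightarrow> x i = y i) \<Longrightarrow> P x = P y"
    and "\<And>x y. (\<And>i. i \<in> J \<Longrightarrow> x i = y i) \<Longrightarrow> Q x = Q y"
  shows "card {x \<in> extensional (I \<union> J). P x \<and> Q x} =
    card {x \<in> extensional I. P x} * card {x \<in> extensional J. Q x}"
proof -
  have "bij_betw (\<lambda>x. (restrict x I, restrict x J)) {x \<in> extensional (I \<union> J). P x \<and> Q x}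
      ({x \<in> extensional I. P x} \<times> {x \<in> extensional J. Q x})"
  proof (rule bij_betw_byWitness[where f' = "\<lambda>(x, y). merge I J (x, y)"])
    show "\<forall>x\<in>{x \<in> extensional (I \<union> J). P x \<and> Q x}.
        (\<lambda>(x, y). merge I J (x, y)) (restrict x I, restrict x J) = x"
      by (auto simp: merge_def extensional_def fun_eq_iff)
    show "\<forall>z\<in>{x \<in> extensional I. P x} \<times> {x \<in> extensional J. Q x}.
        (\<lambda>x. (restrict x I, restrict x J)) ((\<lambda>(x, y). merge I J (x, y)) z) = z"
      using assms(1) by (auto simp: merge_def extensional_def fun_eq_iff)
    show "(\<lambda>x. (restrict x I, restrict x J)) ` {x \<in> extensional (I \<union> J). P x \<and> Q x}
        \<subseteq> {x \<in> extensional I. P x} \<times> {x \<in> extensional J. Q x}"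
    proof clarsimp
      fix x assume "P x" "Q x"
      then show "P (restrict x I) \<and> Q (restrict x J)"
        using assms(2)[of "restrict x I" x] assms(3)[of "restrict x J" x] by simp
    qed
    show "(\<lambda>(x, y). merge I J (x, y)) ` ({x \<in> extensional I. P x} \<times> {x \<in> extensional J. Q x})
        \<subseteq> {x \<in> extensional (I \<union> J). P x \<and> Q x}"
    proof (rule image_subsetI, clarify)
      fix x y assume "P x" "Q y"
      moreover have "P (merge I J (x, y)) = P x" by (rule assms(2)) (simp add: merge_def)
      moreover have "Q (merge I J (x, y)) = Q y"
        using assms(1) by (intro assms(3)) (auto simp: merge_def)
      ultimately show "merge I J (x, y) \<in> extensional (I \<union> J) \<and>
          P (merge I J (x, y)) \<and> Q (merge I J (x, y))"
        by (simp add: merge_def extensional_def)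
    qed
  qed
  from bij_betw_same_card[OF this] show ?thesis by (simp add: card_cartesian_product)
qed

lemma card_extensional_bij:
  assumes "finite I" "finite A" "card I = card A"
  shows "card {x \<in> extensional I. bij_betw x I A} = fact (card I)"
proof -
  have "{x \<in> extensional I. bij_betw x I A} = {x \<in> I \<rightarrow>\<^sub>E A. inj_on x I}"
  proof (intro set_eqI iffI)
    fix x assume "x \<in> {x \<in> extensional I. bij_betw x I A}"
    then show "x \<in> {x \<in> I \<rightarrow>\<^sub>E A. inj_on x I}"
      by (auto simp: bij_betw_def PiE_def)
  next
    fix x assume x: "x \<in> {x \<in> I \<rightarrow>\<^sub>E A. inj_on x I}"
    then have "x ` I = A" using assms by (intro card_subset_eq) (auto simp: card_image)
    then show "x \<in> {x \<in> extensional I. bij_betw x I A}"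
      using x by (auto simp: bij_betw_def PiE_def)
  qed
  then have "card {x \<in> extensional I. bij_betw x I A} = (\<Prod>i<card I. card A - i)"
    using assms by (simp add: card_inj_on_subset_funcset atLeast0LessThan)
  also have "\<dots> = fact (card I)"
    using falling_fact[of 0 "card I"] assms by simp
  finally show ?thesis .
qed

text \<open>
  Such a function consists of three bijections: between the intersections and between each of the two differences.
\<close>

lemma card_inj_with_images:
  assumes R: "finite R" "P \<union> Q = R"
    and X: "finite X" "A \<subseteq> X" "B \<subseteq> X"
    and cards: "card A = card P" "card B = card Q" "card (A \<inter> B) = card (P \<inter> Q)"
  shows "card {x \<in> R \<rightarrow>\<^sub>E X. inj_on x R \<and> x ` P = A \<and> x ` Q = B} =
    fact (card (P \<inter> Q)) * fact (card (P - Q)) * fact (card (Q - P))"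
proof -
  have fin: "finite P" "finite Q" "finite A" "finite B"
    using R X by (auto intro: finite_subset)
  let ?b = "\<lambda>I A x. bij_betw x I A"
  have "{x \<in> R \<rightarrow>\<^sub>E X. inj_on x R \<and> x ` P = A \<and> x ` Q = B} =
      {x \<in> extensional ((P \<inter> Q) \<union> ((P - Q) \<union> (Q - P))).
        ?b (P \<inter> Q) (A \<inter> B) x \<and> (?b (P - Q) (A - B) x \<and> ?b (Q - P) (B - A) x)}"
    (is "?L = ?S")
  proof (intro set_eqI iffI)
    have un: "(P \<inter> Q) \<union> ((P - Q) \<union> (Q - P)) = R" using R by auto
    {
      fix x assume x: "x \<in> ?L"
      then have inj: "inj_on x R" and AB: "x ` P = A" "x ` Q = B" by auto
      have "x ` (P \<inter> Q) = A \<inter> B"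
        using inj_on_image_Int[OF inj, of P Q] AB R by auto
      moreover have "x ` (P - Q) = A - B" "x ` (Q - P) = B - A"
        using inj_on_image_set_diff[OF inj, of P Q] inj_on_image_set_diff[OF inj, of Q P] AB R by auto
      ultimately show "x \<in> ?S"
        unfolding un using x R by (auto simp: bij_betw_def PiE_def intro: inj_on_subset[OF inj])
    }
    {
      fix x assume x: "x \<in> ?S"
      then have b: "?b (P \<inter> Q) (A \<inter> B) x" "?b (P - Q) (A - B) x" "?b (Q - P) (B - A) x"
        and ext: "x \<in> extensional R" unfolding un by auto
      have "?b ((P - Q) \<union> (Q - P)) ((A - B) \<union> (B - A)) x"
        by (rule bij_betw_combine[OF b(2,3)]) auto
      then have "?b ((P \<inter> Q) \<union> ((P - Q) \<union> (Q - P))) ((A \<inter> B) \<union> ((A - B) \<union> (B - A))) x"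
        by (rule bij_betw_combine[OF b(1)]) auto
      then have bR: "?b R ((A \<inter> B) \<union> ((A - B) \<union> (B - A))) x" unfolding un .
      then have inj: "inj_on x R" and im: "x ` R \<subseteq> X" using X by (auto simp: bij_betw_def)
      have "x ` P = x ` (P \<inter> Q) \<union> x ` (P - Q)" "x ` Q = x ` (P \<inter> Q) \<union> x ` (Q - P)" by auto
      then have "x ` P = A" "x ` Q = B" using b by (auto simp: bij_betw_def)
      then show "x \<in> ?L" using inj im ext by (auto simp: PiE_def)
    }
  qed
  moreover have "card ?S = card {x \<in> extensional (P \<inter> Q). ?b (P \<inter> Q) (A \<inter> B) x} *
      card {x \<in> extensional ((P - Q) \<union> (Q - P)). ?b (P - Q) (A - B) x \<and> ?b (Q - P) (B - A) x}"
  proof (rule card_PiE_split)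
    fix x y :: "'a \<Rightarrow> 'b" assume eq: "\<And>i. i \<in> (P - Q) \<union> (Q - P) \<Longrightarrow> x i = y i"
    have "?b (P - Q) (A - B) x = ?b (P - Q) (A - B) y" "?b (Q - P) (B - A) x = ?b (Q - P) (B - A) y"
      by (rule bij_betw_cong, simp add: eq)+
    then show "(?b (P - Q) (A - B) x \<and> ?b (Q - P) (B - A) x) = (?b (P - Q) (A - B) y \<and> ?b (Q - P) (B - A) y)"
      by simp
  next
    fix x y :: "'a \<Rightarrow> 'b" assume "\<And>i. i \<in> P \<inter> Q \<Longrightarrow> x i = y i"
    then show "?b (P \<inter> Q) (A \<inter> B) x = ?b (P \<inter> Q) (A \<inter> B) y" by (rule bij_betw_cong)
  qed auto
  moreover have "card {x \<in> extensional ((P - Q) \<union> (Q - P)). ?b (P - Q) (A - B) x \<and> ?b (Q - P) (B - A) x} =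
      card {x \<in> extensional (P - Q). ?b (P - Q) (A - B) x} * card {x \<in> extensional (Q - P). ?b (Q - P) (B - A) x}"
    by (rule card_PiE_split) (blast, (rule bij_betw_cong, simp)+)
  moreover have "card (A - B) = card (P - Q)" "card (B - A) = card (Q - P)"
    using fin cards by (simp_all add: card_Diff_subset_Int Int_commute)
  ultimately show ?thesis
    using fin cards by (simp add: card_extensional_bij)
qed

text \<open>
  Every pair of sets with the prescribed cardinalities arises from the same number of tuples. This is where the three
  factorials in the denominators of the limiting matrices come from.
\<close>

lemma sum_inj_tuples:
  fixes h g :: "'a set \<Rightarrow> 'b::comm_semiring_1"
  assumes X: "finite X" and R: "P \<union> Q = {..<r}"
  shows "(\<Sum>x\<in>inj_tuples r X. h (x ` P) * g (x ` Q)) =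
    of_nat (fact (card (P \<inter> Q)) * fact (card (P - Q)) * fact (card (Q - P))) *
    (\<Sum>(A, B)\<in>{(A, B). A \<subseteq> X \<and> B \<subseteq> X \<and> card A = card P \<and> card B = card Q \<and>
        card (A \<inter> B) = card (P \<inter> Q)}. h A * g B)"
proof -
  let ?T = "{(A, B). A \<subseteq> X \<and> B \<subseteq> X \<and> card A = card P \<and> card B = card Q \<and> card (A \<inter> B) = card (P \<inter> Q)}"
  let ?c = "fact (card (P \<inter> Q)) * fact (card (P - Q)) * fact (card (Q - P)) :: nat"
  have T: "finite ?T" using X by (intro finite_subset[OF _ finite_cartesian_product[of "Pow X" "Pow X"]]) auto
  have "(\<lambda>x. (x ` P, x ` Q)) ` inj_tuples r X \<subseteq> ?T"
  proof clarsimp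
    fix x assume "x \<in> inj_tuples r X"
    then have inj: "inj_on x {..<r}" and im: "x ` {..<r} \<subseteq> X" by (auto simp: inj_tuples_def)
    have "x ` P \<inter> x ` Q = x ` (P \<inter> Q)"
      using inj_on_image_Int[OF inj, of P Q] R by auto
    then show "x ` P \<subseteq> X \<and> x ` Q \<subseteq> X \<and> card (x ` P) = card P \<and> card (x ` Q) = card Q \<and>
        card (x ` P \<inter> x ` Q) = card (P \<inter> Q)"
    proof -
      have sub: "P \<subseteq> {..<r}" "Q \<subseteq> {..<r}" "P \<inter> Q \<subseteq> {..<r}" using R by auto
      have "card (x ` S) = card S" if "S \<subseteq> {..<r}" for S
        using inj_on_subset[OF inj that] by (rule card_image)
      moreover have "x ` P \<subseteq> X" "x ` Q \<subseteq> X" using sub im by (meson image_mono order_trans)+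
      ultimately show ?thesis using sub \<open>x ` P \<inter> x ` Q = x ` (P \<inter> Q)\<close> by simp
    qed
  qed
  then have "(\<Sum>x\<in>inj_tuples r X. h (x ` P) * g (x ` Q)) =
      (\<Sum>T\<in>?T. \<Sum>x\<in>{x \<in> inj_tuples r X. (x ` P, x ` Q) = T}. h (x ` P) * g (x ` Q))"
    using X T by (intro sum.group[symmetric] finite_inj_tuples)
  also have "\<dots> = (\<Sum>(A, B)\<in>?T. of_nat ?c * (h A * g B))"
  proof (rule sum.cong[OF refl], clarify)
    fix A B assume AB: "A \<subseteq> X" "B \<subseteq> X" "card A = card P" "card B = card Q" "card (A \<inter> B) = card (P \<inter> Q)"
    have "(\<Sum>x\<in>{x \<in> inj_tuples r X. (x ` P, x ` Q) = (A, B)}. h (x ` P) * g (x ` Q)) =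
        (\<Sum>x\<in>{x \<in> {..<r} \<rightarrow>\<^sub>E X. inj_on x {..<r} \<and> x ` P = A \<and> x ` Q = B}. h A * g B)"
      by (intro sum.cong) (auto simp: inj_tuples_def)
    also have "\<dots> = of_nat ?c * (h A * g B)"
      unfolding sum_constant using card_inj_with_images[OF finite_lessThan R X AB] by simp
    finally show "(\<Sum>x\<in>{x \<in> inj_tuples r X. (x ` P, x ` Q) = (A, B)}. h (x ` P) * g (x ` Q)) =
        of_nat ?c * (h A * g B)" .
  qed
  finally show ?thesis by (simp add: sum_distrib_left case_prod_beta')
qed

definition subset_sum :: "nat \<Rightarrow> ('a set \<Rightarrow> 'b::comm_semiring_1) \<Rightarrow> 'a set \<Rightarrow> 'b" where
  "subset_sum k h X = (\<Sum>A | A \<subseteq> X \<and> card A = k. h A)"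

lemma sum_inj_tuples_single:
  fixes h :: "'a set \<Rightarrow> 'b::comm_semiring_1"
  assumes X: "finite X"
  shows "(\<Sum>x\<in>inj_tuples k X. h (x ` {..<k})) = of_nat (fact k) * subset_sum k h X"
proof -
  have "{(A, B). A \<subseteq> X \<and> B \<subseteq> X \<and> card A = k \<and> card B = card {} \<and> card (A \<inter> B) = card ({..<k} \<inter> ({} :: nat set))} =
      (\<lambda>A. (A, {})) ` {A. A \<subseteq> X \<and> card A = k}"
  proof -
    have "card B = 0 \<longleftrightarrow> B = {}" if "B \<subseteq> X" for B
      using finite_subset[OF that X] by simp
    then show ?thesis by auto
  qed
  then show ?thesis
    using sum_inj_tuples[OF X, of "{..<k}" "{}" k h "\<lambda>_. 1"]
    by (simp add: subset_sum_def sum.reindex inj_on_def)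
qed

lemma subset_sum_mult:
  fixes h g :: "'a set \<Rightarrow> 'b::comm_semiring_1"
  assumes X: "finite X"
  shows "subset_sum a h X * subset_sum b g X =
    (\<Sum>m\<le>min a b. \<Sum>(A, B)\<in>{(A, B). A \<subseteq> X \<and> B \<subseteq> X \<and> card A = a \<and> card B = b \<and> card (A \<inter> B) = m}. h A * g B)"
proof -
  let ?S = "\<lambda>k. {A. A \<subseteq> X \<and> card A = k}"
  have fin: "finite (?S k)" for k using X by (intro finite_subset[OF _ finite_Pow_iff[THEN iffD2, OF X]]) auto
  have "subset_sum a h X * subset_sum b g X = (\<Sum>(A, B)\<in>?S a \<times> ?S b. h A * g B)"
    unfolding subset_sum_def by (simp add: sum_product sum.cartesian_product)
  also have "\<dots> = (\<Sum>m\<in>{..min a b}. \<Sum>p\<in>{p \<in> ?S a \<times> ?S b. card (fst p \<inter> snd p) = m}. case p of (A, B) \<Rightarrow> h A * g B)"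
  proof (rule sum.group[symmetric])
    show "(\<lambda>p. card (fst p \<inter> snd p)) ` (?S a \<times> ?S b) \<subseteq> {..min a b}"
      using X by (auto intro!: card_mono dest: finite_subset)
  qed (use fin in auto)
  also have "\<dots> = (\<Sum>m\<le>min a b. \<Sum>(A, B)\<in>{(A, B). A \<subseteq> X \<and> B \<subseteq> X \<and> card A = a \<and> card B = b \<and> card (A \<inter> B) = m}. h A * g B)"
    by (intro sum.cong) auto
  finally show ?thesis .
qed

text \<open>
  \<open>Delta_pow\<close> depends only on the set of vertices once their number is fixed; \<open>k\<close> is kept as a parameter because a
  tuple with repetitions has fewer than \<open>k + 1\<close> distinct entries.
\<close>

definition simplex_weight :: "real \<Rightarrow> real \<Rightarrow> nat \<Rightarrow> 'a::euclidean_space set \<Rightarrow> real" where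
  "simplex_weight s \<alpha> k A =
     (if \<forall>x\<in>A. \<forall>y\<in>A. norm (x - y) \<le> s
      then (if \<alpha> = 0 then 1 else kvol k (convex hull A) powr \<alpha>) else 0)"

lemma Delta_pow_eq_weight: "length xs = Suc k \<Longrightarrow> Delta_pow s \<alpha> xs = simplex_weight s \<alpha> k (set xs)"
  by (simp add: Delta_pow_def simplex_weight_def)

lemma simplex_weight_nonneg [simp]: "simplex_weight s \<alpha> k A \<ge> 0"
  by (simp add: simplex_weight_def)

lemma vol_power_eq_subset_sum:
  assumes X: "finite X"
  shows "vol_power s k \<alpha> X = subset_sum (Suc k) (simplex_weight s \<alpha> k) X"
proof -
  let ?L = "{xs. length xs = k + 1 \<and> distinct xs \<and> set xs \<subseteq> X}"
  have "bij_betw (\<lambda>x. map x [0..<Suc k]) (inj_tuples (Suc k) X) ?L"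
  proof (rule bij_betw_byWitness[where f' = "\<lambda>xs. \<lambda>i\<in>{..<Suc k}. xs ! i"])
    show "\<forall>x\<in>inj_tuples (Suc k) X. (\<lambda>i\<in>{..<Suc k}. map x [0..<Suc k] ! i) = x"
      by (auto simp: inj_tuples_def PiE_iff extensional_def fun_eq_iff simp del: upt_Suc)
    show "\<forall>xs\<in>?L. map (\<lambda>i\<in>{..<Suc k}. xs ! i) [0..<Suc k] = xs"
      by (auto intro!: nth_equalityI simp del: upt_Suc)
    show "(\<lambda>x. map x [0..<Suc k]) ` inj_tuples (Suc k) X \<subseteq> ?L"
      by (auto simp: inj_tuples_def distinct_map atLeast0LessThan PiE_iff simp del: upt_Suc)
    show "(\<lambda>xs. \<lambda>i\<in>{..<Suc k}. xs ! i) ` ?L \<subseteq> inj_tuples (Suc k) X"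
    proof clarify
      fix xs :: "'a list" assume xs: "length xs = k + 1" "distinct xs" "set xs \<subseteq> X"
      then have "xs ! i \<in> X" if "i < Suc k" for i
        using nth_mem[of i xs] that by auto
      moreover have "inj_on (\<lambda>i\<in>{..<Suc k}. xs ! i) {..<Suc k}"
        using xs by (intro inj_onI) (simp add: nth_eq_iff_index_eq)
      ultimately show "(\<lambda>i\<in>{..<Suc k}. xs ! i) \<in> inj_tuples (Suc k) X"
        by (simp add: inj_tuples_def)
    qed
  qed
  then have "(\<Sum>xs\<in>?L. Delta_pow s \<alpha> xs) = (\<Sum>x\<in>inj_tuples (Suc k) X. Delta_pow s \<alpha> (map x [0..<Suc k]))"
    by (rule sum.reindex_bij_betw[symmetric])
  also have "\<dots> = (\<Sum>x\<in>inj_tuples (Suc k) X. simplex_weight s \<alpha> k (x ` {..<Suc k}))"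
    by (intro sum.cong refl) (simp add: Delta_pow_eq_weight atLeast0LessThan del: upt_Suc)
  also have "\<dots> = fact (Suc k) * subset_sum (Suc k) (simplex_weight s \<alpha> k) X"
    by (subst sum_inj_tuples_single[OF X]) (simp add: algebra_simps)
  finally show ?thesis by (simp add: vol_power_def)
qed

section \<open>Convergence of the limiting integrals\<close>

lemma nn_integral_PiM_mult_disjoint:
  fixes f g :: "('i \<Rightarrow> 'a::euclidean_space) \<Rightarrow> ennreal"
  assumes AB: "finite A" "finite B" "A \<inter> B = {}"
    and f [measurable]: "f \<in> borel_measurable (\<Pi>\<^sub>M i\<in>A. lborel)"
    and g [measurable]: "g \<in> borel_measurable (\<Pi>\<^sub>M i\<in>B. lborel)"
    and fA: "\<And>x y. (\<And>i. i \<in> A \<Longrightarrow> x i = y i) \<Longrightarrow> f x = f y"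
    and gB: "\<And>x y. (\<And>i. i \<in> B \<Longrightarrow> x i = y i) \<Longrightarrow> g x = g y"
  shows "(\<integral>\<^sup>+x. f x * g x \<partial>(\<Pi>\<^sub>M i\<in>A \<union> B. lborel)) =
    (\<integral>\<^sup>+x. f x \<partial>(\<Pi>\<^sub>M i\<in>A. lborel)) * (\<integral>\<^sup>+x. g x \<partial>(\<Pi>\<^sub>M i\<in>B. lborel))"
proof -
  have restr: "f (restrict x A) = f x" "g (restrict x B) = g x" for x
    by (auto intro: fA gB)
  have "(\<lambda>x. f (restrict x A)) \<in> borel_measurable (\<Pi>\<^sub>M i\<in>A \<union> B. lborel)"
    by (rule measurable_compose[OF measurable_restrict_subset f]) auto
  moreover have "(\<lambda>x. g (restrict x B)) \<in> borel_measurable (\<Pi>\<^sub>M i\<in>A \<union> B. lborel)"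
    by (rule measurable_compose[OF measurable_restrict_subset g]) auto
  ultimately have [measurable]: "f \<in> borel_measurable (\<Pi>\<^sub>M i\<in>A \<union> B. lborel)"
      "g \<in> borel_measurable (\<Pi>\<^sub>M i\<in>A \<union> B. lborel)"
    by (simp_all add: restr)
  have "(\<integral>\<^sup>+x. f x * g x \<partial>(\<Pi>\<^sub>M i\<in>A \<union> B. lborel)) =
      (\<integral>\<^sup>+x. (\<integral>\<^sup>+y. f (merge A B (x, y)) * g (merge A B (x, y)) \<partial>(\<Pi>\<^sub>M i\<in>B. lborel)) \<partial>(\<Pi>\<^sub>M i\<in>A. lborel))"
    by (rule lborel_product.product_nn_integral_fold[OF AB(3,1,2)]) measurable
  also have "\<dots> = (\<integral>\<^sup>+x. (\<integral>\<^sup>+y. f x * g y \<partial>(\<Pi>\<^sub>M i\<in>B. lborel)) \<partial>(\<Pi>\<^sub>M i\<in>A. lborel))"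
  proof (intro nn_integral_cong arg_cong2[where f="(*)"])
    fix x y :: "'i \<Rightarrow> 'a"
    show "f (merge A B (x, y)) = f x" by (rule fA) (simp add: merge_def)
    show "g (merge A B (x, y)) = g y" using AB by (intro gB) (auto simp: merge_def)
  qed
  also have "\<dots> = (\<integral>\<^sup>+x. f x \<partial>(\<Pi>\<^sub>M i\<in>A. lborel)) * (\<integral>\<^sup>+x. g x \<partial>(\<Pi>\<^sub>M i\<in>B. lborel))"
    by (simp add: nn_integral_cmult nn_integral_multc)
  finally show ?thesis .
qed

lemma indicator_cball_measurable [measurable, simp]:
  "(indicator (cball (x :: 'a::euclidean_space) r) :: 'a \<Rightarrow> ennreal) \<in> borel_measurable borel"
  by (rule borel_measurable_indicator) (rule borel_closed, simp)

lemma prod_indicator_cball_measurable: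
  assumes "D \<subseteq> J"
  shows "(\<lambda>x. \<Prod>i\<in>D. indicator (cball 0 1) (x i) :: ennreal) \<in> borel_measurable (\<Pi>\<^sub>M i\<in>J. (lborel :: 'a::euclidean_space measure))"
proof (rule borel_measurable_prod_ennreal)
  fix i assume "i \<in> D"
  then have "(\<lambda>x. x i) \<in> (\<Pi>\<^sub>M i\<in>J. (lborel :: 'a measure)) \<rightarrow>\<^sub>M lborel"
    using assms by (intro measurable_component_singleton) auto
  then show "(\<lambda>x. indicator (cball 0 1) (x i) :: ennreal) \<in> borel_measurable (\<Pi>\<^sub>M i\<in>J. (lborel :: 'a measure))"
    by (rule measurable_compose) simp
qed

lemma Delta_pow_close:
  assumes "Delta_pow s \<alpha> xs \<noteq> 0" "x \<in> set xs" "y \<in> set xs"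
  shows "norm (x - y) \<le> s"
  using assms by (auto simp: Delta_pow_def split: if_splits)

lemma mu_integrand_nonneg [simp]: "mu_integrand p q m \<alpha> \<beta> x \<ge> 0"
  by (simp add: mu_integrand_def)

text \<open>
  Each \<open>x i\<close> is a vertex of one of the two simplices, and both have \<open>0\<close> as a vertex and diameter at most 1. So \<open>\<mu>\<close>
  can be treated as an integral over the whole product space.
\<close>

lemma mu_integrand_support:
  assumes "mu_integrand p q m \<alpha> \<beta> x \<noteq> 0" and "1 \<le> m" "m \<le> p + 1" and "i \<in> {1..p + q + 1 - m}"
  shows "x i \<in> cball 0 1"
proof -
  have nz: "Delta_pow 1 \<alpha> (0 # map x [1..<p + 1]) \<noteq> 0"
      "Delta_pow 1 \<beta> (0 # map x [p + 2 - m..<p + q + 2 - m]) \<noteq> 0"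
    using assms(1) by (auto simp: mu_integrand_def simp del: upt_Suc)
  consider "i \<in> {1..<p + 1}" | "i \<in> {p + 2 - m..<p + q + 2 - m}" using assms by fastforce
  then have "norm (x i - 0) \<le> 1"
  proof cases
    case 1
    then show ?thesis by (intro Delta_pow_close[OF nz(1)]) (auto simp del: upt_Suc)
  next
    case 2
    then show ?thesis by (intro Delta_pow_close[OF nz(2)]) (auto simp del: upt_Suc)
  qed
  then show ?thesis by simp
qed

lemma mu_domain_redundant:
  assumes "1 \<le> m" "m \<le> p + 1" and "x \<in> space (\<Pi>\<^sub>M i\<in>{1..p + q + 1 - m}. lborel)"
  shows "indicator (mu_domain p q m) x *\<^sub>R mu_integrand p q m \<alpha> \<beta> x = mu_integrand p q m \<alpha> \<beta> x"
proof (cases "mu_integrand p q m \<alpha> \<beta> x = 0")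
  case False
  have "x \<in> mu_domain p q m"
    using mu_integrand_support[OF False assms(1,2)] assms(3)
    unfolding mu_domain_def by (intro PiE_I) (auto simp: space_PiM)
  then show ?thesis by simp
qed simp

lemma mu_converges_iff_integrable:
  assumes "1 \<le> m" "m \<le> p + 1"
  shows "mu_converges TYPE('a::euclidean_space) p q m \<alpha> \<beta> \<longleftrightarrow>
    integrable (\<Pi>\<^sub>M i\<in>{1..p + q + 1 - m}. (lborel::'a measure)) (mu_integrand p q m \<alpha> \<beta>)"
  unfolding mu_converges_def set_integrable_def
  by (intro Bochner_Integration.integrable_cong refl mu_domain_redundant[OF assms])

lemma mu_integral_eq:
  assumes "1 \<le> m" "m \<le> p + 1"
  shows "mu_integral TYPE('a::euclidean_space) p q m \<alpha> \<beta> =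
    (\<integral>x. mu_integrand p q m \<alpha> \<beta> x \<partial>(\<Pi>\<^sub>M i\<in>{1..p + q + 1 - m}. (lborel::'a measure)))"
  unfolding mu_integral_def set_lebesgue_integral_def
  by (intro Bochner_Integration.integral_cong refl mu_domain_redundant[OF assms])

lemma Delta_pow_coords_measurable:
  fixes js :: "nat list"
  assumes js: "length js = k" "set js \<subseteq> J" and k: "k \<le> DIM('a::euclidean_space) \<or> \<alpha> = 0"
  shows "(\<lambda>x. Delta_pow s \<alpha> (0 # map x js)) \<in> borel_measurable (\<Pi>\<^sub>M i\<in>J. (lborel::'a measure))"
proof -
  have "(\<lambda>x. Delta_pow s \<alpha> (map (\<lambda>f. f x) ((\<lambda>_. 0) # map (\<lambda>i x. x i) js)))
      \<in> borel_measurable (\<Pi>\<^sub>M i\<in>J. (lborel::'a measure))"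
  proof (rule Delta_pow_measurable[OF _ k])
    fix f :: "(nat \<Rightarrow> 'a) \<Rightarrow> 'a" assume "f \<in> set ((\<lambda>_. 0) # map (\<lambda>i x. x i) js)"
    then consider "f = (\<lambda>_. 0)" | i where "i \<in> J" "f = (\<lambda>x. x i)" using js by auto
    then show "f \<in> borel_measurable (\<Pi>\<^sub>M i\<in>J. (lborel::'a measure))"
      by cases simp_all
  qed (use js in simp)
  then show ?thesis by (simp add: comp_def)
qed

lemma mu_integrand_measurable:
  assumes "1 \<le> m" "m \<le> p + 1" "m \<le> q + 1"
    and "p \<le> DIM('a::euclidean_space) \<or> \<alpha> = 0" "q \<le> DIM('a) \<or> \<beta> = 0"
  shows "mu_integrand p q m \<alpha> \<beta> \<in> borel_measurable (\<Pi>\<^sub>M i\<in>{1..p + q + 1 - m}. (lborel::'a measure))"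
  unfolding mu_integrand_def using assms
  by (intro borel_measurable_times Delta_pow_coords_measurable[where k=p] Delta_pow_coords_measurable[where k=q])
    (auto simp del: upt_Suc)

text \<open>
  The functional has a finite variance, and its volume makes sense in dimension \<open>d\<close>; for \<open>\<alpha> = 0\<close> no volume enters.
\<close>

definition square_integrable_simplex :: "'a::euclidean_space itself \<Rightarrow> nat \<Rightarrow> real \<Rightarrow> bool" where
  "square_integrable_simplex T k \<alpha> \<longleftrightarrow> (k \<le> DIM('a) \<or> \<alpha> = 0) \<and> mu_converges T k k (k + 1) \<alpha> \<alpha>"

lemma square_integrable_simplex_0: "square_integrable_simplex TYPE('a::euclidean_space) 0 0"
  unfolding square_integrable_simplex_def mu_converges_def mu_domain_def set_integrable_def
  by (auto simp: mu_integrand_def Delta_pow_def PiM_empty)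

lemma square_integrable_simplexD:
  assumes H: "square_integrable_simplex TYPE('a::euclidean_space) k \<alpha>"
  shows "(\<integral>\<^sup>+x. ennreal ((Delta_pow 1 \<alpha> (0 # map x [1..<k + 1]))\<^sup>2) \<partial>(\<Pi>\<^sub>M i\<in>{1..k}. (lborel::'a measure))) < \<infinity>"
proof -
  have "integrable (\<Pi>\<^sub>M i\<in>{1..k}. (lborel::'a measure)) (mu_integrand k k (k + 1) \<alpha> \<alpha>)"
    using H mu_converges_iff_integrable[of "k + 1" k k \<alpha> \<alpha>, where 'a='a]
    by (simp add: square_integrable_simplex_def)
  moreover have "mu_integrand k k (k + 1) \<alpha> \<alpha> x = (Delta_pow 1 \<alpha> (0 # map x [1..<k + 1]))\<^sup>2" for x :: "nat \<Rightarrow> 'a"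
    by (simp add: mu_integrand_def power2_eq_square)
  ultimately show ?thesis
    by (simp add: integrable_iff_bounded del: upt_Suc)
qed

text \<open>
  The coordinates outside the simplex range over unit balls and contribute a finite factor. The offset \<open>c\<close> is needed
  because the coordinates of the second simplex in \<open>mu_integrand\<close> do not start at 1.
\<close>

lemma nn_integral_square_shifted_finite:
  assumes H: "square_integrable_simplex TYPE('a::euclidean_space) k \<alpha>" and B: "finite B" "{c + 1..c + k} \<inter> B = {}"
  shows "(\<integral>\<^sup>+x. ennreal ((Delta_pow 1 \<alpha> (0 # map x [c + 1..<c + k + 1]))\<^sup>2) *
      (\<Prod>i\<in>B. indicator (cball 0 1) (x i)) \<partial>(\<Pi>\<^sub>M i\<in>{c + 1..c + k} \<union> B. (lborel::'a measure))) < \<infinity>"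
proof -
  let ?f = "\<lambda>x :: nat \<Rightarrow> 'a. ennreal ((Delta_pow 1 \<alpha> (0 # map x [c + 1..<c + k + 1]))\<^sup>2)"
  let ?g = "\<lambda>x :: nat \<Rightarrow> 'a. \<Prod>i\<in>B. indicator (cball 0 1) (x i) :: ennreal"
  have k: "k \<le> DIM('a) \<or> \<alpha> = 0" using H by (simp add: square_integrable_simplex_def)
  have "(\<integral>\<^sup>+x. ?f x * ?g x \<partial>(\<Pi>\<^sub>M i\<in>{c + 1..c + k} \<union> B. (lborel::'a measure))) =
      (\<integral>\<^sup>+x. ?f x \<partial>(\<Pi>\<^sub>M i\<in>{c + 1..c + k}. (lborel::'a measure))) * (\<integral>\<^sup>+x. ?g x \<partial>(\<Pi>\<^sub>M i\<in>B. (lborel::'a measure)))"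
  proof (rule nn_integral_PiM_mult_disjoint)
    show "?f \<in> borel_measurable (\<Pi>\<^sub>M i\<in>{c + 1..c + k}. (lborel::'a measure))"
      using k by (intro measurable_compose[OF _ measurable_ennreal] borel_measurable_power
          Delta_pow_coords_measurable[where k=k]) (auto simp del: upt_Suc)
    show "?g \<in> borel_measurable (\<Pi>\<^sub>M i\<in>B. (lborel::'a measure))"
      by (rule prod_indicator_cball_measurable) simp
    fix x y :: "nat \<Rightarrow> 'a"
    { assume "\<And>i. i \<in> {c + 1..c + k} \<Longrightarrow> x i = y i"
      then have "map x [c + 1..<c + k + 1] = map y [c + 1..<c + k + 1]" by (intro map_cong) auto
      then show "?f x = ?f y" by (simp only:) }
    { assume "\<And>i. i \<in> B \<Longrightarrow> x i = y i"
      then show "?g x = ?g y" by (intro prod.cong) auto }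
  qed (use B in auto)
  moreover have "(\<integral>\<^sup>+x. ?f x \<partial>(\<Pi>\<^sub>M i\<in>{c + 1..c + k}. (lborel::'a measure))) < \<infinity>"
  proof -
    have \<sigma>: "bij_betw (\<lambda>i. c + i) {1..k} {c + 1..c + k}"
      by (rule bij_betw_byWitness[where f'="\<lambda>i. i - c"]) auto
    have "(\<integral>\<^sup>+x. ennreal ((Delta_pow 1 \<alpha> (0 # map x [1..<k + 1]))\<^sup>2) \<partial>(\<Pi>\<^sub>M i\<in>{1..k}. (lborel::'a measure))) =
        (\<integral>\<^sup>+x. ennreal ((Delta_pow 1 \<alpha> (0 # map (\<lambda>i\<in>{1..k}. x (c + i)) [1..<k + 1]))\<^sup>2)
          \<partial>(\<Pi>\<^sub>M i\<in>{c + 1..c + k}. (lborel::'a measure)))"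
      using k by (intro nn_integral_PiM_lborel_reindex[OF _ \<sigma>] measurable_compose[OF _ measurable_ennreal]
          borel_measurable_power Delta_pow_coords_measurable[where k=k]) (auto simp del: upt_Suc)
    also have "\<dots> = (\<integral>\<^sup>+x. ?f x \<partial>(\<Pi>\<^sub>M i\<in>{c + 1..c + k}. (lborel::'a measure)))"
    proof (rule nn_integral_cong)
      fix x :: "nat \<Rightarrow> 'a"
      have "map (\<lambda>i\<in>{1..k}. x (c + i)) [1..<k + 1] = map x [c + 1..<c + k + 1]"
        by (rule nth_equalityI) (auto simp del: upt_Suc)
      then show "ennreal ((Delta_pow 1 \<alpha> (0 # map (\<lambda>i\<in>{1..k}. x (c + i)) [1..<k + 1]))\<^sup>2) = ?f x"
        by (simp only:)
    qed
    finally show ?thesis using square_integrable_simplexD[OF H] by simp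
  qed
  moreover have "(\<integral>\<^sup>+x. ?g x \<partial>(\<Pi>\<^sub>M i\<in>B. (lborel::'a measure))) < \<infinity>"
  proof -
    have "(\<integral>\<^sup>+x. ?g x \<partial>(\<Pi>\<^sub>M i\<in>B. (lborel::'a measure))) = (\<Prod>i\<in>B. \<integral>\<^sup>+y. indicator (cball 0 1) y \<partial>(lborel::'a measure))"
      by (rule lborel_product.product_nn_integral_prod[OF B(1)]) simp
    also have "\<dots> < \<infinity>"
      using emeasure_bounded_finite[of "cball (0::'a) 1"]
      by (simp add: power_less_top_ennreal)
    finally show ?thesis .
  qed
  ultimately show ?thesis by (simp add: ennreal_mult_less_top del: upt_Suc)
qed

text \<open>
  The product of the two weights is at most the sum of their squares, and each square involves only the coordinates of one
  of the simplices.
\<close>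

lemma mu_converges_cross:
  assumes H: "square_integrable_simplex TYPE('a::euclidean_space) p \<alpha>" "square_integrable_simplex TYPE('a) q \<beta>"
    and m: "1 \<le> m" "m \<le> p + 1" "m \<le> q + 1"
  shows "integrable (\<Pi>\<^sub>M i\<in>{1..p + q + 1 - m}. (lborel::'a measure)) (mu_integrand p q m \<alpha> \<beta>)"
proof -
  let ?I = "{1..p + q + 1 - m}"
  let ?P = "\<Pi>\<^sub>M i\<in>?I. (lborel::'a measure)"
  \<comment> \<open>The coordinates outside the first and outside the second simplex, respectively.\<close>
  define B where "B = {p + 1..p + q + 1 - m}"
  define C where "C = {1..p + 1 - m}"
  define f where "f = (\<lambda>x :: nat \<Rightarrow> 'a. Delta_pow 1 \<alpha> (0 # map x [1..<p + 1]))"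
  define g where "g = (\<lambda>x :: nat \<Rightarrow> 'a. Delta_pow 1 \<beta> (0 # map x [p + 2 - m..<p + q + 2 - m]))"
  have fg_meas [measurable]: "f \<in> borel_measurable ?P" "g \<in> borel_measurable ?P"
    using H m unfolding f_def g_def square_integrable_simplex_def
    by (intro Delta_pow_coords_measurable[where k=p] Delta_pow_coords_measurable[where k=q];
        auto simp del: upt_Suc)+
  have ind [measurable]: "(\<lambda>x :: nat \<Rightarrow> 'a. \<Prod>i\<in>D. indicator (cball 0 1) (x i) :: ennreal) \<in> borel_measurable ?P"
    if "D \<subseteq> ?I" for D
    using that by (rule prod_indicator_cball_measurable)
  have BC: "B \<subseteq> ?I" "C \<subseteq> ?I" using m by (auto simp: B_def C_def)
  have "(\<integral>\<^sup>+x. ennreal (mu_integrand p q m \<alpha> \<beta> x) \<partial>?P) \<le>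
      (\<integral>\<^sup>+x. ennreal ((f x)\<^sup>2) * (\<Prod>i\<in>B. indicator (cball 0 1) (x i)) +
        ennreal ((g x)\<^sup>2) * (\<Prod>i\<in>C. indicator (cball 0 1) (x i)) \<partial>?P)"
  proof (rule nn_integral_mono)
    fix x :: "nat \<Rightarrow> 'a"
    show "ennreal (mu_integrand p q m \<alpha> \<beta> x) \<le> ennreal ((f x)\<^sup>2) * (\<Prod>i\<in>B. indicator (cball 0 1) (x i)) +
        ennreal ((g x)\<^sup>2) * (\<Prod>i\<in>C. indicator (cball 0 1) (x i))"
    proof (cases "mu_integrand p q m \<alpha> \<beta> x = 0")
      case False
      then have "\<And>i. i \<in> ?I \<Longrightarrow> x i \<in> cball 0 1" using mu_integrand_support m by blast
      then have one: "(\<Prod>i\<in>B. indicator (cball 0 1) (x i)) = (1::ennreal)" "(\<Prod>i\<in>C. indicator (cball 0 1) (x i)) = (1::ennreal)"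
        using BC by (auto intro!: prod.neutral simp: subset_iff)
      have "2 * f x * g x \<le> (f x)\<^sup>2 + (g x)\<^sup>2" by (rule sum_squares_bound)
      moreover have "f x * g x \<ge> 0" by (simp add: f_def g_def)
      ultimately have "f x * g x \<le> (f x)\<^sup>2 + (g x)\<^sup>2" by simp
      moreover have "mu_integrand p q m \<alpha> \<beta> x = f x * g x"
        by (simp only: mu_integrand_def f_def g_def)
      ultimately show ?thesis
        unfolding one by (simp flip: ennreal_plus)
    qed simp
  qed
  also have "\<dots> = (\<integral>\<^sup>+x. ennreal ((f x)\<^sup>2) * (\<Prod>i\<in>B. indicator (cball 0 1) (x i)) \<partial>?P) +
      (\<integral>\<^sup>+x. ennreal ((g x)\<^sup>2) * (\<Prod>i\<in>C. indicator (cball 0 1) (x i)) \<partial>?P)"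
    using ind[OF BC(1)] ind[OF BC(2)]
    by (intro nn_integral_add borel_measurable_times_ennreal measurable_compose[OF _ measurable_ennreal]
        borel_measurable_power fg_meas)
  also have "\<dots> < \<infinity>"
  proof -
    have I1: "?I = {0 + 1..0 + p} \<union> B" using m by (auto simp: B_def)
    have "(\<integral>\<^sup>+x. ennreal ((f x)\<^sup>2) * (\<Prod>i\<in>B. indicator (cball 0 1) (x i)) \<partial>?P) < \<infinity>"
      using nn_integral_square_shifted_finite[OF H(1), of B 0] unfolding I1 f_def
      by (simp add: B_def del: upt_Suc)
    moreover have I2: "?I = {(p + 1 - m) + 1..(p + 1 - m) + q} \<union> C" using m by (auto simp: C_def)
    have e: "(p + 1 - m) + 1 = p + 2 - m" "(p + 1 - m) + q + 1 = p + q + 2 - m" using m by auto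
    have "(\<integral>\<^sup>+x. ennreal ((g x)\<^sup>2) * (\<Prod>i\<in>C. indicator (cball 0 1) (x i)) \<partial>?P) < \<infinity>"
      using nn_integral_square_shifted_finite[OF H(2), of C "p + 1 - m"] unfolding I2 g_def e
      by (simp add: C_def del: upt_Suc)
    ultimately show ?thesis by simp
  qed
  finally show ?thesis
    using H m mu_integrand_measurable[of m p q \<alpha> \<beta>, where 'a='a]
    by (simp add: integrable_iff_bounded square_integrable_simplex_def)
qed

section \<open>Rescaled integrals over the window\<close>

text \<open>
  What is left of the integrand after the substitution \<open>x\<^sub>i = x\<^sub>0 + s y\<^sub>i\<close>; the pair consists of
  \<open>x\<^sub>0\<close> and \<open>y\<close>.
\<close>

definition window_kernel ::
  "'a::euclidean_space set \<Rightarrow> nat \<Rightarrow> nat \<Rightarrow> nat \<Rightarrow> real \<Rightarrow> real \<Rightarrow> real \<Rightarrow> 'a \<times> (nat \<Rightarrow> 'a) \<Rightarrow> real" where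
  "window_kernel W p q m \<alpha> \<beta> s z =
     indicator W (fst z) * (\<Prod>i\<in>{1..p + q + 1 - m}. indicator W (fst z + s *\<^sub>R snd z i)) *
     mu_integrand p q m \<alpha> \<beta> (snd z)"

definition window_integral ::
  "'a::euclidean_space set \<Rightarrow> nat \<Rightarrow> nat \<Rightarrow> nat \<Rightarrow> real \<Rightarrow> real \<Rightarrow> real \<Rightarrow> real" where
  "window_integral W p q m \<alpha> \<beta> s =
     (\<integral>z. window_kernel W p q m \<alpha> \<beta> s z \<partial>(lborel \<Otimes>\<^sub>M (\<Pi>\<^sub>M i\<in>{1..p + q + 1 - m}. lborel)))"

context
  fixes W :: "'a::euclidean_space set" and p q m :: nat and \<alpha> \<beta> :: real
  assumes W: "compact W" "convex W" "measure lborel W = 1"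
    and H: "square_integrable_simplex TYPE('a) p \<alpha>" "square_integrable_simplex TYPE('a) q \<beta>"
    and m: "1 \<le> m" "m \<le> p + 1" "m \<le> q + 1"
begin

private abbreviation "I \<equiv> {1..p + q + 1 - m}"
private abbreviation "P \<equiv> (\<Pi>\<^sub>M i\<in>I. (lborel::'a measure))"

private lemma W_borel [measurable]: "W \<in> sets borel"
  using W(1) by (rule borel_compact)

private lemma integrand_measurable [measurable]: "mu_integrand p q m \<alpha> \<beta> \<in> borel_measurable P"
  using H m by (intro mu_integrand_measurable) (auto simp: square_integrable_simplex_def)

private lemma window_kernel_measurable [measurable]:
  "window_kernel W p q m \<alpha> \<beta> s \<in> borel_measurable (lborel \<Otimes>\<^sub>M P)"
proof -
  have "(\<lambda>z. fst z + s *\<^sub>R snd z i) \<in> borel_measurable (lborel \<Otimes>\<^sub>M P)" if "i \<in> I" for i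
  proof -
    have "(\<lambda>z. snd z i) \<in> (lborel \<Otimes>\<^sub>M P) \<rightarrow>\<^sub>M (lborel :: 'a measure)"
      by (rule measurable_compose[OF measurable_snd measurable_component_singleton[OF that]])
    then have "(\<lambda>z. snd z i) \<in> borel_measurable (lborel \<Otimes>\<^sub>M P)" by simp
    moreover have "(\<lambda>z. fst z) \<in> borel_measurable ((lborel :: 'a measure) \<Otimes>\<^sub>M P)" by measurable
    ultimately show ?thesis
      by (intro borel_measurable_add borel_measurable_scaleR borel_measurable_const)
  qed
  then have "(\<lambda>z. indicator W (fst z + s *\<^sub>R snd z i) :: real) \<in> borel_measurable (lborel \<Otimes>\<^sub>M P)" if "i \<in> I" for i
    using that by (intro measurable_compose[OF _ borel_measurable_indicator[OF W_borel]])
  moreover have "(\<lambda>z. mu_integrand p q m \<alpha> \<beta> (snd z)) \<in> borel_measurable (lborel \<Otimes>\<^sub>M P)"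
    by measurable
  moreover have "(\<lambda>z. indicator W (fst z) :: real) \<in> borel_measurable (lborel \<Otimes>\<^sub>M P)"
    by measurable
  ultimately show ?thesis
    unfolding window_kernel_def by (intro borel_measurable_times borel_measurable_prod)
qed

private lemma pair_sigma: "pair_sigma_finite (lborel :: 'a measure) P"
  by (intro pair_sigma_finite.intro lborel.sigma_finite_measure_axioms lborel_product.sigma_finite) simp

private lemma dominating_measurable [measurable]:
  "(\<lambda>z. indicator W (fst z) * mu_integrand p q m \<alpha> \<beta> (snd z)) \<in> borel_measurable (lborel \<Otimes>\<^sub>M P)"
  by measurable

private lemma dominating_nn_integral:
  "(\<integral>\<^sup>+z. ennreal (indicator W (fst z) * mu_integrand p q m \<alpha> \<beta> (snd z)) \<partial>(lborel \<Otimes>\<^sub>M P)) =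
    ennreal (\<integral>x. mu_integrand p q m \<alpha> \<beta> x \<partial>P)"
proof -
  interpret pair_sigma_finite "lborel :: 'a measure" P by (rule pair_sigma)
  have W1: "emeasure lborel W = 1"
    using W(3) emeasure_bounded_finite[OF compact_imp_bounded[OF W(1)]]
    by (simp add: emeasure_eq_ennreal_measure less_top)
  have "(\<integral>\<^sup>+z. ennreal (indicator W (fst z) * mu_integrand p q m \<alpha> \<beta> (snd z)) \<partial>(lborel \<Otimes>\<^sub>M P)) =
      (\<integral>\<^sup>+x. (\<integral>\<^sup>+y. ennreal (indicator W x * mu_integrand p q m \<alpha> \<beta> y) \<partial>P) \<partial>lborel)"
    by (subst M2.nn_integral_fst[symmetric]) (rule measurable_compose[OF dominating_measurable], simp, simp)
  also have "\<dots> = (\<integral>\<^sup>+x. indicator W x * (\<integral>\<^sup>+y. ennreal (mu_integrand p q m \<alpha> \<beta> y) \<partial>P) \<partial>lborel)"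
    by (intro nn_integral_cong) (simp split: split_indicator)
  also have "\<dots> = (\<integral>\<^sup>+y. ennreal (mu_integrand p q m \<alpha> \<beta> y) \<partial>P)"
    using W1 by (simp add: nn_integral_multc)
  also have "\<dots> = ennreal (\<integral>x. mu_integrand p q m \<alpha> \<beta> x \<partial>P)"
    by (intro nn_integral_eq_integral mu_converges_cross H m) simp
  finally show ?thesis .
qed

private lemma dominating_integrable:
  "integrable (lborel \<Otimes>\<^sub>M P) (\<lambda>z. indicator W (fst z) * mu_integrand p q m \<alpha> \<beta> (snd z))"
  by (rule integrableI_nonneg[OF dominating_measurable])
    (simp, simp only: dominating_nn_integral ennreal_less_top infinity_ennreal_def)

private lemma window_kernel_le:
  "window_kernel W p q m \<alpha> \<beta> s z \<le> indicator W (fst z) * mu_integrand p q m \<alpha> \<beta> (snd z)"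
proof -
  have "(\<Prod>i\<in>I. indicator W (fst z + s *\<^sub>R snd z i)) \<le> (1::real)"
    by (intro prod_le_1) (auto split: split_indicator)
  then show ?thesis
    unfolding window_kernel_def by (intro mult_right_mono mult_left_le) auto
qed

private lemma window_kernel_nonneg: "window_kernel W p q m \<alpha> \<beta> s z \<ge> 0"
  unfolding window_kernel_def by (intro mult_nonneg_nonneg prod_nonneg) auto

private lemma window_kernel_integrable: "integrable (lborel \<Otimes>\<^sub>M P) (window_kernel W p q m \<alpha> \<beta> s)"
  using window_kernel_le window_kernel_nonneg
  by (intro Bochner_Integration.integrable_bound[OF dominating_integrable window_kernel_measurable] AE_I2) auto

lemma window_integral_nonneg: "window_integral W p q m \<alpha> \<beta> s \<ge> 0"
  unfolding window_integral_def by (intro integral_nonneg_AE AE_I2 window_kernel_nonneg)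

lemma nn_window_integral:
  "(\<integral>\<^sup>+x. (\<integral>\<^sup>+y. ennreal (window_kernel W p q m \<alpha> \<beta> s (x, y)) \<partial>P) \<partial>lborel) =
    ennreal (window_integral W p q m \<alpha> \<beta> s)"
proof -
  interpret pair_sigma_finite "lborel :: 'a measure" P by (rule pair_sigma)
  have "(\<integral>\<^sup>+x. (\<integral>\<^sup>+y. ennreal (window_kernel W p q m \<alpha> \<beta> s (x, y)) \<partial>P) \<partial>lborel) =
      (\<integral>\<^sup>+z. ennreal (window_kernel W p q m \<alpha> \<beta> s z) \<partial>(lborel \<Otimes>\<^sub>M P))"
    by (rule M2.nn_integral_fst) measurable
  also have "\<dots> = ennreal (window_integral W p q m \<alpha> \<beta> s)"
    unfolding window_integral_def
    by (intro nn_integral_eq_integral window_kernel_integrable AE_I2 window_kernel_nonneg)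
  finally show ?thesis .
qed

lemma nn_window_integral_measurable:
  "(\<lambda>x. \<integral>\<^sup>+y. ennreal (window_kernel W p q m \<alpha> \<beta> s (x, y)) \<partial>P) \<in> borel_measurable lborel"
proof -
  interpret pair_sigma_finite "lborel :: 'a measure" P by (rule pair_sigma)
  show ?thesis by (rule M2.borel_measurable_nn_integral_fst) measurable
qed

text \<open>
  For \<open>x\<^sub>0\<close> in the interior of \<open>W\<close> all the window conditions hold eventually; the boundary of a convex set is a null
  set. The kernel without window conditions dominates.
\<close>

lemma window_integral_tendsto:
  fixes \<delta> :: "real \<Rightarrow> real"
  assumes \<delta>: "(\<delta> \<longlongrightarrow> 0) at_top"
  shows "((\<lambda>t. window_integral W p q m \<alpha> \<beta> (\<delta> t)) \<longlongrightarrow> mu_integral TYPE('a) p q m \<alpha> \<beta>) at_top"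
proof -
  interpret pair_sigma_finite "lborel :: 'a measure" P by (rule pair_sigma)
  have "negligible (frontier W)" using W(2) by (rule negligible_convex_frontier)
  then have fr: "frontier W \<in> null_sets lborel"
    by (simp add: negligible_iff_null_sets null_sets_completion_iff)
  have "frontier W \<times> space P \<in> null_sets (lborel \<Otimes>\<^sub>M P)"
  proof (rule null_setsI)
    have "emeasure (lborel \<Otimes>\<^sub>M P) (frontier W \<times> space P) = emeasure lborel (frontier W) * emeasure P (space P)"
      by (rule M2.emeasure_pair_measure_Times) auto
    then show "emeasure (lborel \<Otimes>\<^sub>M P) (frontier W \<times> space P) = 0"
      using null_setsD1[OF fr] by (simp only: mult_zero_left)
  qed auto
  then have "AE z in lborel \<Otimes>\<^sub>M P. z \<notin> frontier W \<times> space P" by (rule AE_not_in)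
  then have "AE z in lborel \<Otimes>\<^sub>M P. fst z \<notin> frontier W"
    by (rule AE_mp) (auto intro!: AE_I2 simp: space_pair_measure)
  then have lim: "AE z in lborel \<Otimes>\<^sub>M P. ((\<lambda>t. window_kernel W p q m \<alpha> \<beta> (\<delta> t) z) \<longlongrightarrow>
      indicator W (fst z) * mu_integrand p q m \<alpha> \<beta> (snd z)) at_top"
  proof (rule AE_mp, intro AE_I2 impI)
    fix z :: "'a \<times> (nat \<Rightarrow> 'a)" assume z: "fst z \<notin> frontier W"
    show "((\<lambda>t. window_kernel W p q m \<alpha> \<beta> (\<delta> t) z) \<longlongrightarrow>
        indicator W (fst z) * mu_integrand p q m \<alpha> \<beta> (snd z)) at_top"
    proof (cases "fst z \<in> W")
      case False
      then show ?thesis by (simp add: window_kernel_def)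
    next
      case True
      then have int: "fst z \<in> interior W"
        using z W(1) by (auto simp: frontier_def compact_imp_closed)
      have "eventually (\<lambda>t. \<forall>i\<in>I. fst z + \<delta> t *\<^sub>R snd z i \<in> interior W) at_top"
      proof (rule eventually_ball_finite[OF finite_atLeastAtMost], rule ballI)
        fix i
        have "((\<lambda>t. fst z + \<delta> t *\<^sub>R snd z i) \<longlongrightarrow> fst z + 0 *\<^sub>R snd z i) at_top"
          by (intro tendsto_intros \<delta>)
        then show "eventually (\<lambda>t. fst z + \<delta> t *\<^sub>R snd z i \<in> interior W) at_top"
          using int by (intro topological_tendstoD[OF _ open_interior]) auto
      qed
      then have "eventually (\<lambda>t. window_kernel W p q m \<alpha> \<beta> (\<delta> t) z =
          indicator W (fst z) * mu_integrand p q m \<alpha> \<beta> (snd z)) at_top"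
      proof eventually_elim
        case (elim t)
        then have "(\<Prod>i\<in>I. indicator W (fst z + \<delta> t *\<^sub>R snd z i)) = (1::real)"
          using interior_subset by (intro prod.neutral) (auto simp: indicator_def)
        then show ?case by (simp add: window_kernel_def)
      qed
      then show ?thesis by (rule tendsto_eventually)
    qed
  qed
  have "((\<lambda>t. window_integral W p q m \<alpha> \<beta> (\<delta> t)) \<longlongrightarrow>
      (\<integral>z. indicator W (fst z) * mu_integrand p q m \<alpha> \<beta> (snd z) \<partial>(lborel \<Otimes>\<^sub>M P))) at_top"
    unfolding window_integral_def
  proof (rule integral_dominated_convergence_at_top[OF _ _ dominating_integrable lim])
    show "\<forall>\<^sub>F t in at_top. AE z in lborel \<Otimes>\<^sub>M P. norm (window_kernel W p q m \<alpha> \<beta> (\<delta> t) z)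
        \<le> indicator W (fst z) * mu_integrand p q m \<alpha> \<beta> (snd z)"
      using window_kernel_le window_kernel_nonneg by (intro always_eventually allI AE_I2) simp
  qed measurable
  also have "(\<integral>z. indicator W (fst z) * mu_integrand p q m \<alpha> \<beta> (snd z) \<partial>(lborel \<Otimes>\<^sub>M P)) =
      (\<integral>x. mu_integrand p q m \<alpha> \<beta> x \<partial>P)"
    by (subst integral_eq_nn_integral[OF dominating_measurable], simp, unfold dominating_nn_integral)
      (simp add: integral_nonneg_AE)
  also have "\<dots> = mu_integral TYPE('a) p q m \<alpha> \<beta>"
    using m by (intro mu_integral_eq[symmetric]) auto
  finally show ?thesis .
qed

end

section \<open>First and second moments of the functionals\<close>

lemma Delta_pow_tuple_measurable:
  fixes js :: "nat list"
  assumes js: "length js = Suc k" "set js \<subseteq> J" and k: "k \<le> DIM('a::euclidean_space) \<or> \<alpha> = 0"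
  shows "(\<lambda>x. Delta_pow s \<alpha> (map x js)) \<in> borel_measurable (\<Pi>\<^sub>M i\<in>J. (lborel::'a measure))"
proof -
  have "(\<lambda>x. Delta_pow s \<alpha> (map (\<lambda>f. f x) (map (\<lambda>i x. x i) js)))
      \<in> borel_measurable (\<Pi>\<^sub>M i\<in>J. (lborel::'a measure))"
  proof (rule Delta_pow_measurable[OF _ k])
    fix f :: "(nat \<Rightarrow> 'a) \<Rightarrow> 'a" assume "f \<in> set (map (\<lambda>i x. x i) js)"
    then obtain i where "i \<in> J" "f = (\<lambda>x. x i)" using js by auto
    then show "f \<in> borel_measurable (\<Pi>\<^sub>M i\<in>J. (lborel::'a measure))" by simp
  qed (use js in simp)
  then show ?thesis by (simp add: comp_def)
qed

lemma simplex_weight_tuple_measurable: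
  fixes J S :: "nat set"
  assumes S: "finite S" "card S = Suc k" "S \<subseteq> J" and k: "k \<le> DIM('a::euclidean_space) \<or> \<alpha> = 0"
  shows "(\<lambda>x. simplex_weight s \<alpha> k (x ` S)) \<in> borel_measurable (\<Pi>\<^sub>M i\<in>J. (lborel::'a measure))"
proof -
  have "(\<lambda>x. Delta_pow s \<alpha> (map x (sorted_list_of_set S))) \<in> borel_measurable (\<Pi>\<^sub>M i\<in>J. (lborel::'a measure))"
    using S by (intro Delta_pow_tuple_measurable[OF _ _ k]) auto
  then show ?thesis using S by (simp add: Delta_pow_eq_weight)
qed

text \<open>
  A product form of the indicator of \<open>W ^ J\<close>. It does not test extensionality, so it factorizes over disjoint index sets
  and is unaffected by changes outside \<open>J\<close>.
\<close>

definition window_indicator :: "'a set \<Rightarrow> 'i set \<Rightarrow> ('i \<Rightarrow> 'a) \<Rightarrow> ennreal" where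
  "window_indicator W J x = (\<Prod>i\<in>J. indicator W (x i))"

lemma window_indicator_measurable:
  assumes "W \<in> sets borel"
  shows "window_indicator W J \<in> borel_measurable (\<Pi>\<^sub>M i\<in>J. (lborel::'a::euclidean_space measure))"
  unfolding window_indicator_def
proof (rule borel_measurable_prod_ennreal)
  fix i assume "i \<in> J"
  then have "(\<lambda>x. x i) \<in> (\<Pi>\<^sub>M i\<in>J. (lborel :: 'a measure)) \<rightarrow>\<^sub>M lborel"
    by (rule measurable_component_singleton)
  then show "(\<lambda>x. indicator W (x i) :: ennreal) \<in> borel_measurable (\<Pi>\<^sub>M i\<in>J. (lborel :: 'a measure))"
    by (rule measurable_compose) (simp add: borel_measurable_indicator assms)
qed

lemma indicator_PiE_eq_window_indicator:
  assumes "finite J" "x \<in> extensional J"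
  shows "indicator (J \<rightarrow>\<^sub>E W) x = window_indicator W J x"
proof (cases "\<forall>i\<in>J. x i \<in> W")
  case True
  then show ?thesis using assms by (auto simp: window_indicator_def PiE_def Pi_def)
next
  case False
  then have "window_indicator W J x = 0"
    using assms(1) by (auto simp: window_indicator_def prod_zero_iff indicator_def)
  moreover have "x \<notin> (J \<rightarrow>\<^sub>E W)" using False by auto
  ultimately show ?thesis by simp
qed

text \<open>
  The first simplex has the vertices \<open>0, \<dots>, p\<close> of a tuple. The second one is numbered as in \<open>mu_integrand\<close>, with the base
  point \<open>0\<close> and the last \<open>m - 1\<close> vertices of the first simplex in common.
\<close>

definition second_simplex :: "nat \<Rightarrow> nat \<Rightarrow> nat \<Rightarrow> nat set" where
  "second_simplex p q m = insert 0 {p + 2 - m..<p + q + 2 - m}"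

lemma second_simplex_card:
  assumes "1 \<le> m" "m \<le> p + 1" "m \<le> q + 1"
  shows "{..<Suc p} \<union> second_simplex p q m = {..<p + q + 2 - m}"
    and "card (second_simplex p q m) = Suc q"
    and "card ({..<Suc p} \<inter> second_simplex p q m) = m"
    and "card ({..<Suc p} - second_simplex p q m) = p + 1 - m"
    and "card (second_simplex p q m - {..<Suc p}) = q + 1 - m"
    and "finite (second_simplex p q m)"
proof -
  let ?Q = "second_simplex p q m"
  show un: "{..<Suc p} \<union> ?Q = {..<p + q + 2 - m}" using assms by (auto simp: second_simplex_def)
  show fin: "finite ?Q" by (simp add: second_simplex_def)
  show cQ: "card ?Q = Suc q" using assms by (simp add: second_simplex_def)
  have "{..<Suc p} \<inter> ?Q = insert 0 {p + 2 - m..<Suc p}"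
    using assms by (auto simp: second_simplex_def)
  then show int: "card ({..<Suc p} \<inter> ?Q) = m" using assms by simp
  show "card ({..<Suc p} - ?Q) = p + 1 - m"
    using int by (simp add: card_Diff_subset_Int)
  show "card (?Q - {..<Suc p}) = q + 1 - m"
    using int cQ fin by (simp add: card_Diff_subset_Int Int_commute)
qed

text \<open>
  Integrate over the base point \<open>x 0\<close> last, and substitute \<open>x i = x 0 + s y i\<close> in the other variables. Both simplices
  contain the base point, so both volumes scale.
\<close>

lemma nn_integral_overlap_tuple:
  fixes W :: "'a::euclidean_space set"
  assumes W: "compact W" "convex W" "measure lborel W = 1"
    and H: "square_integrable_simplex TYPE('a) p \<alpha>" "square_integrable_simplex TYPE('a) q \<beta>"
    and m: "1 \<le> m" "m \<le> p + 1" "m \<le> q + 1" and s: "s > 0"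
  shows "(\<integral>\<^sup>+x. ennreal (simplex_weight s \<alpha> p (x ` {..<Suc p}) * simplex_weight s \<beta> q (x ` second_simplex p q m)) *
      window_indicator W {..<p + q + 2 - m} x \<partial>(\<Pi>\<^sub>M i\<in>{..<p + q + 2 - m}. lborel)) =
    ennreal (s ^ (DIM('a) * (p + q + 1 - m)) * s powr (\<alpha> * p + \<beta> * q) * window_integral W p q m \<alpha> \<beta> s)"
proof -
  let ?I = "{1..p + q + 1 - m}" and ?R = "{..<p + q + 2 - m}"
  define F where "F = (\<lambda>x :: nat \<Rightarrow> 'a. ennreal (simplex_weight s \<alpha> p (x ` {..<Suc p}) *
      simplex_weight s \<beta> q (x ` second_simplex p q m)) * window_indicator W ?R x)"
  have R: "?R = insert 0 ?I" using m by auto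
  have good: "p \<le> DIM('a) \<or> \<alpha> = 0" "q \<le> DIM('a) \<or> \<beta> = 0"
    using H by (auto simp: square_integrable_simplex_def)
  note ss = second_simplex_card[OF m]
  have sub: "{..<Suc p} \<subseteq> ?R" "second_simplex p q m \<subseteq> ?R"
    unfolding ss(1)[symmetric] by (rule Un_upper1, rule Un_upper2)
  have F_meas: "F \<in> borel_measurable (\<Pi>\<^sub>M i\<in>?R. lborel)"
  proof -
    have "(\<lambda>x. simplex_weight s \<alpha> p (x ` {..<Suc p})) \<in> borel_measurable (\<Pi>\<^sub>M i\<in>?R. (lborel :: 'a measure))"
      by (rule simplex_weight_tuple_measurable[OF _ _ sub(1) good(1)]) simp_all
    moreover have "(\<lambda>x. simplex_weight s \<beta> q (x ` second_simplex p q m)) \<in> borel_measurable (\<Pi>\<^sub>M i\<in>?R. (lborel :: 'a measure))"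
      by (rule simplex_weight_tuple_measurable[OF ss(6,2) sub(2) good(2)])
    moreover have "window_indicator W ?R \<in> borel_measurable (\<Pi>\<^sub>M i\<in>?R. (lborel :: 'a measure))"
      by (intro window_indicator_measurable borel_compact W)
    ultimately show ?thesis
      unfolding F_def
      by (intro borel_measurable_times_ennreal measurable_compose[OF _ measurable_ennreal] borel_measurable_times)
  qed
  have upd_meas: "(\<lambda>x. F (x(0 := y))) \<in> borel_measurable (\<Pi>\<^sub>M i\<in>?I. lborel)" for y
  proof -
    have "(\<lambda>x. (x, y)) \<in> (\<Pi>\<^sub>M i\<in>?I. (lborel :: 'a measure)) \<rightarrow>\<^sub>M (\<Pi>\<^sub>M i\<in>?I. (lborel :: 'a measure)) \<Otimes>\<^sub>M lborel"
      by measurable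
    from measurable_compose[OF measurable_compose[OF this measurable_add_dim] F_meas[unfolded R]]
    show ?thesis by simp
  qed
  have key: "F ((\<lambda>i\<in>?I. y + s *\<^sub>R x i)(0 := y)) =
      ennreal (s powr (\<alpha> * p + \<beta> * q)) * ennreal (window_kernel W p q m \<alpha> \<beta> s (y, x))" for x y
  proof -
    let ?z = "(\<lambda>i\<in>?I. y + s *\<^sub>R x i)(0 := y)" and ?T = "\<lambda>v. y + s *\<^sub>R v"
    have im: "?z ` {..<Suc p} = set (map ?T (0 # map x [1..<p + 1]))"
    proof -
      have "{..<Suc p} = insert 0 {1..<p + 1}" by auto
      then show ?thesis using m by (auto simp: image_iff simp del: upt_Suc)
    qed
    have im': "?z ` second_simplex p q m = set (map ?T (0 # map x [p + 2 - m..<p + q + 2 - m]))"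
    proof -
      have "i \<in> ?I" if "i \<in> {p + 2 - m..<p + q + 2 - m}" for i using that m by auto
      then have "?z ` {p + 2 - m..<p + q + 2 - m} = (\<lambda>i. ?T (x i)) ` {p + 2 - m..<p + q + 2 - m}"
        by (intro image_cong) auto
      moreover have "?z ` second_simplex p q m = insert y (?z ` {p + 2 - m..<p + q + 2 - m})"
        unfolding second_simplex_def image_insert by (simp only: fun_upd_same)
      ultimately have "?z ` second_simplex p q m = insert y ((\<lambda>i. ?T (x i)) ` {p + 2 - m..<p + q + 2 - m})"
        by (simp only:)
      then show ?thesis by (simp only: list.set list.map set_map set_upt image_image scaleR_zero_right add_0_right)
    qed
    have "simplex_weight s \<alpha> p (?z ` {..<Suc p}) = Delta_pow s \<alpha> (map ?T (0 # map x [1..<p + 1]))"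
      unfolding im by (rule Delta_pow_eq_weight[symmetric]) (simp del: upt_Suc)
    also have "\<dots> = s powr (\<alpha> * p) * Delta_pow 1 \<alpha> (0 # map x [1..<p + 1])"
      by (rule Delta_pow_affine[OF _ good(1) s]) (simp del: upt_Suc)
    finally have 1: "simplex_weight s \<alpha> p (?z ` {..<Suc p}) = s powr (\<alpha> * p) * Delta_pow 1 \<alpha> (0 # map x [1..<p + 1])" .
    have "simplex_weight s \<beta> q (?z ` second_simplex p q m) =
        Delta_pow s \<beta> (map ?T (0 # map x [p + 2 - m..<p + q + 2 - m]))"
      unfolding im' using m by (intro Delta_pow_eq_weight[symmetric]) (simp del: upt_Suc)
    also have "\<dots> = s powr (\<beta> * q) * Delta_pow 1 \<beta> (0 # map x [p + 2 - m..<p + q + 2 - m])"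
      using m by (intro Delta_pow_affine[OF _ good(2) s]) (simp del: upt_Suc)
    finally have 2: "simplex_weight s \<beta> q (?z ` second_simplex p q m) =
        s powr (\<beta> * q) * Delta_pow 1 \<beta> (0 # map x [p + 2 - m..<p + q + 2 - m])" .
    have 3: "window_indicator W ?R ?z = ennreal (indicator W y * (\<Prod>i\<in>?I. indicator W (y + s *\<^sub>R x i)))"
    proof -
      have "window_indicator W ?R ?z = indicator W y * (\<Prod>i\<in>?I. indicator W (?z i))"
        unfolding window_indicator_def R by (subst prod.insert) auto
      also have "(\<Prod>i\<in>?I. indicator W (?z i)) = (\<Prod>i\<in>?I. ennreal (indicator W (y + s *\<^sub>R x i)))"
        by (intro prod.cong) (auto simp: ennreal_indicator)
      also have "indicator W y * (\<Prod>i\<in>?I. ennreal (indicator W (y + s *\<^sub>R x i))) =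
          ennreal (indicator W y * (\<Prod>i\<in>?I. indicator W (y + s *\<^sub>R x i)))"
        by (subst prod_ennreal, simp, subst ennreal_mult) (auto intro: prod_nonneg simp: ennreal_indicator)
      finally show ?thesis .
    qed
    have "F ?z = ennreal ((s powr (\<alpha> * p) * s powr (\<beta> * q)) * mu_integrand p q m \<alpha> \<beta> x) *
        ennreal (indicator W y * (\<Prod>i\<in>?I. indicator W (y + s *\<^sub>R x i)))"
      unfolding F_def 1 2 3 mu_integrand_def by (simp only: mult_ac)
    also have "\<dots> = ennreal (s powr (\<alpha> * p) * s powr (\<beta> * q)) * ennreal (window_kernel W p q m \<alpha> \<beta> s (y, x))"
      unfolding window_kernel_def fst_conv snd_conv
      by (subst (1 2) ennreal_mult[symmetric]) (auto intro!: prod_nonneg mult_nonneg_nonneg simp: mult_ac)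
    finally show ?thesis by (simp add: powr_add)
  qed
  have kernel_meas: "(\<lambda>x. F ((\<lambda>i\<in>?I. y + s *\<^sub>R x i)(0 := y))) \<in> borel_measurable (\<Pi>\<^sub>M i\<in>?I. lborel)" for y
  proof -
    have "(\<lambda>x. \<lambda>i\<in>?I. y + s *\<^sub>R x i) \<in> (\<Pi>\<^sub>M i\<in>?I. (lborel :: 'a measure)) \<rightarrow>\<^sub>M (\<Pi>\<^sub>M i\<in>?I. lborel)"
      by measurable
    from measurable_compose[OF this upd_meas[of y]] show ?thesis .
  qed
  have c_pos: "s powr (\<alpha> * p + \<beta> * q) > 0" using s by simp
  have inner: "(\<integral>\<^sup>+x. F (x(0 := y)) \<partial>(\<Pi>\<^sub>M i\<in>?I. lborel)) =
      ennreal (s ^ (DIM('a) * (p + q + 1 - m)) * s powr (\<alpha> * p + \<beta> * q)) *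
      (\<integral>\<^sup>+x. ennreal (window_kernel W p q m \<alpha> \<beta> s (y, x)) \<partial>(\<Pi>\<^sub>M i\<in>?I. lborel))" for y
  proof -
    \<comment> \<open>The kernel is a constant multiple of the substituted \<open>F\<close>, hence measurable.\<close>
    have K: "(\<lambda>x. ennreal (window_kernel W p q m \<alpha> \<beta> s (y, x))) \<in> borel_measurable (\<Pi>\<^sub>M i\<in>?I. lborel)"
    proof -
      have "ennreal (window_kernel W p q m \<alpha> \<beta> s (y, x)) =
          ennreal (1 / s powr (\<alpha> * p + \<beta> * q)) * F ((\<lambda>i\<in>?I. y + s *\<^sub>R x i)(0 := y))" for x
        unfolding key using c_pos
        by (simp add: mult.assoc[symmetric] ennreal_mult[symmetric] del: ennreal_mult')
      then show ?thesis using kernel_meas[of y] by (simp only:) (intro borel_measurable_times_ennreal borel_measurable_const)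
    qed
    have "(\<integral>\<^sup>+x. F (x(0 := y)) \<partial>(\<Pi>\<^sub>M i\<in>?I. lborel)) =
        ennreal (s ^ (DIM('a) * card ?I)) * (\<integral>\<^sup>+x. F ((\<lambda>i\<in>?I. y + s *\<^sub>R x i)(0 := y)) \<partial>(\<Pi>\<^sub>M i\<in>?I. lborel))"
      by (rule nn_integral_PiM_lborel_affine[OF _ s upd_meas]) simp
    also have "(\<integral>\<^sup>+x. F ((\<lambda>i\<in>?I. y + s *\<^sub>R x i)(0 := y)) \<partial>(\<Pi>\<^sub>M i\<in>?I. lborel)) =
        ennreal (s powr (\<alpha> * p + \<beta> * q)) * (\<integral>\<^sup>+x. ennreal (window_kernel W p q m \<alpha> \<beta> s (y, x)) \<partial>(\<Pi>\<^sub>M i\<in>?I. lborel))"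
      unfolding key by (rule nn_integral_cmult[OF K])
    finally show ?thesis using s by (simp add: ennreal_mult mult.assoc fun_upd_def)
  qed
  have meas_y: "(\<lambda>y. \<integral>\<^sup>+x. ennreal (window_kernel W p q m \<alpha> \<beta> s (y, x)) \<partial>(\<Pi>\<^sub>M i\<in>?I. lborel)) \<in> borel_measurable lborel"
    by (rule nn_window_integral_measurable[OF W H m])
  have "(\<integral>\<^sup>+x. F x \<partial>(\<Pi>\<^sub>M i\<in>?R. lborel)) = (\<integral>\<^sup>+y. (\<integral>\<^sup>+x. F (x(0 := y)) \<partial>(\<Pi>\<^sub>M i\<in>?I. lborel)) \<partial>lborel)"
    using F_meas unfolding R by (intro lborel_product.product_nn_integral_insert_rev) auto
  also have "\<dots> = ennreal (s ^ (DIM('a) * (p + q + 1 - m)) * s powr (\<alpha> * p + \<beta> * q)) *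
      ennreal (window_integral W p q m \<alpha> \<beta> s)"
    unfolding inner nn_integral_cmult[OF meas_y] nn_window_integral[OF W H m] ..
  finally show ?thesis
    using s by (simp add: F_def ennreal_mult window_integral_nonneg[OF W H m])
qed

definition overlap_sum :: "nat \<Rightarrow> nat \<Rightarrow> nat \<Rightarrow> ('a set \<Rightarrow> real) \<Rightarrow> ('a set \<Rightarrow> real) \<Rightarrow> 'a set \<Rightarrow> real" where
  "overlap_sum a b m h g X =
    (\<Sum>(A, B)\<in>{(A, B). A \<subseteq> X \<and> B \<subseteq> X \<and> card A = a \<and> card B = b \<and> card (A \<inter> B) = m}. h A * g B)"

lemma overlap_sum_nonneg: "(\<And>A. h A \<ge> 0) \<Longrightarrow> (\<And>A. g A \<ge> 0) \<Longrightarrow> overlap_sum a b m h g X \<ge> 0"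
  unfolding overlap_sum_def by (intro sum_nonneg) auto

text \<open>
  The mean is the case \<open>q = 0\<close>, \<open>\<beta> = 0\<close>, \<open>m = 1\<close> of the pair integrals: the second simplex is then the base point alone,
  with weight 1.
\<close>

definition mean_const :: "'a::euclidean_space set \<Rightarrow> real \<Rightarrow> real \<Rightarrow> nat \<Rightarrow> real \<Rightarrow> real" where
  "mean_const W t s p \<alpha> =
    t ^ Suc p * (s ^ (DIM('a) * p) * s powr (\<alpha> * p) * window_integral W p 0 1 \<alpha> 0 s) / fact (Suc p)"

definition cov_term :: "'a::euclidean_space set \<Rightarrow> real \<Rightarrow> real \<Rightarrow> nat \<Rightarrow> nat \<Rightarrow> real \<Rightarrow> real \<Rightarrow> nat \<Rightarrow> real" where
  "cov_term W t s p q \<alpha> \<beta> m =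
    t ^ (p + q + 2 - m) * (s ^ (DIM('a) * (p + q + 1 - m)) * s powr (\<alpha> * p + \<beta> * q) * window_integral W p q m \<alpha> \<beta> s) /
    (fact m * fact (p + 1 - m) * fact (q + 1 - m))"

context poisson_window
begin

text \<open>
  The common part of the expectations below: \<open>G\<close> is a sum over tuples divided by the number \<open>c\<close> of tuples that
  describe the same configuration.
\<close>

lemma nn_integral_inj_tuples_scaled:
  fixes G :: "'a set \<Rightarrow> real" and F :: "(nat \<Rightarrow> 'a) \<Rightarrow> real"
  assumes F: "F \<in> borel_measurable (\<Pi>\<^sub>M i\<in>{..<r}. lborel)" "\<And>x. F x \<ge> 0"
    and c: "c > 0"
    and eq: "\<And>X. finite X \<Longrightarrow> (\<Sum>x\<in>inj_tuples r X. F x) = c * G X"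
    and int: "(\<integral>\<^sup>+x. ennreal (F x) * window_indicator W {..<r} x \<partial>(\<Pi>\<^sub>M i\<in>{..<r}. lborel)) = ennreal v"
    and v: "v \<ge> 0"
  shows "(\<lambda>\<omega>. ennreal (G (\<eta> \<omega>))) \<in> borel_measurable M \<and>
    (\<integral>\<^sup>+\<omega>. ennreal (G (\<eta> \<omega>)) \<partial>M) = ennreal (t ^ r * v / c)"
proof (rule measurable_nn_integral_cong)
  let ?S = "\<lambda>\<omega>. \<Sum>x\<in>inj_tuples r (\<eta> \<omega>). ennreal (F x)"
  fix \<omega> assume "\<omega> \<in> space M"
  then have "G (\<eta> \<omega>) = (1 / c) * (\<Sum>x\<in>inj_tuples r (\<eta> \<omega>). F x)"
    using eq[of "\<eta> \<omega>"] c by simp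
  moreover have "?S \<omega> = ennreal (\<Sum>x\<in>inj_tuples r (\<eta> \<omega>). F x)"
    using F(2) by (intro sum_ennreal)
  ultimately show "ennreal (G (\<eta> \<omega>)) = ennreal (1 / c) * ?S \<omega>"
    using c by (simp only:) (rule ennreal_mult', simp)
next
  have F': "(\<lambda>x. ennreal (F x)) \<in> borel_measurable (\<Pi>\<^sub>M i\<in>{..<r}. lborel)" using F(1) by measurable
  note mk = mecke[OF F']
  have "(\<integral>\<^sup>+x. ennreal (F x) * indicator ({..<r} \<rightarrow>\<^sub>E W) x \<partial>(\<Pi>\<^sub>M i\<in>{..<r}. lborel)) =
      (\<integral>\<^sup>+x. ennreal (F x) * window_indicator W {..<r} x \<partial>(\<Pi>\<^sub>M i\<in>{..<r}. lborel))"
    by (intro nn_integral_cong arg_cong2[where f="(*)"] refl indicator_PiE_eq_window_indicator)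
      (auto simp: space_PiM PiE_def)
  with int mk(2) have "(\<integral>\<^sup>+\<omega>. (\<Sum>x\<in>inj_tuples r (\<eta> \<omega>). ennreal (F x)) \<partial>M) = ennreal (t ^ r) * ennreal v" by simp
  then have "(\<integral>\<^sup>+\<omega>. ennreal (1 / c) * (\<Sum>x\<in>inj_tuples r (\<eta> \<omega>). ennreal (F x)) \<partial>M) = ennreal (t ^ r * v / c)"
    using t v c mk(1) by (simp add: nn_integral_cmult flip: ennreal_mult)
  with mk(1) show "(\<lambda>\<omega>. ennreal (1 / c) * (\<Sum>x\<in>inj_tuples r (\<eta> \<omega>). ennreal (F x))) \<in> borel_measurable M \<and>
      (\<integral>\<^sup>+\<omega>. ennreal (1 / c) * (\<Sum>x\<in>inj_tuples r (\<eta> \<omega>). ennreal (F x)) \<partial>M) = ennreal (t ^ r * v / c)"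
    by auto
qed

context
  fixes s :: real and p :: nat and \<alpha> :: real
  assumes cW: "compact W" "convex W" "measure lborel W = 1" and s: "s > 0"
    and Hp: "square_integrable_simplex TYPE('a) p \<alpha>"
begin

lemma nn_integral_weight_tuple:
  "(\<integral>\<^sup>+x. ennreal (simplex_weight s \<alpha> p (x ` {..<Suc p})) * window_indicator W {..<Suc p} x \<partial>(\<Pi>\<^sub>M i\<in>{..<Suc p}. lborel)) =
    ennreal (s ^ (DIM('a) * p) * s powr (\<alpha> * p) * window_integral W p 0 1 \<alpha> 0 s)"
proof -
  \<comment> \<open>A single point has weight 1, so this pair integral involves only the first simplex.\<close>
  have "simplex_weight s 0 0 (x ` second_simplex p 0 1) = 1" for x :: "nat \<Rightarrow> 'a"
    using s by (simp add: simplex_weight_def second_simplex_def)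
  then show ?thesis
    using nn_integral_overlap_tuple[OF cW Hp square_integrable_simplex_0, of 1 s] s by simp
qed

lemma mean_const_nonneg: "mean_const W t s p \<alpha> \<ge> 0"
  using s t window_integral_nonneg[OF cW Hp square_integrable_simplex_0, of 1 s]
  by (simp add: mean_const_def)

lemma nn_integral_vol_power:
  "(\<lambda>\<omega>. ennreal (vol_power s p \<alpha> (\<eta> \<omega>))) \<in> borel_measurable M \<and>
    (\<integral>\<^sup>+\<omega>. ennreal (vol_power s p \<alpha> (\<eta> \<omega>)) \<partial>M) = ennreal (mean_const W t s p \<alpha>)"
  unfolding mean_const_def
proof (rule nn_integral_inj_tuples_scaled[where F="\<lambda>x. simplex_weight s \<alpha> p (x ` {..<Suc p})"])
  show "(\<lambda>x. simplex_weight s \<alpha> p (x ` {..<Suc p})) \<in> borel_measurable (\<Pi>\<^sub>M i\<in>{..<Suc p}. (lborel :: 'a measure))"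
    using Hp by (intro simplex_weight_tuple_measurable) (auto simp: square_integrable_simplex_def)
  show "(\<Sum>x\<in>inj_tuples (Suc p) X. simplex_weight s \<alpha> p (x ` {..<Suc p})) = fact (Suc p) * vol_power s p \<alpha> X" if "finite X" for X
    using sum_inj_tuples_single[OF that, of "simplex_weight s \<alpha> p" "Suc p"] by (simp add: vol_power_eq_subset_sum[OF that] del: fact_Suc)
qed (use nn_integral_weight_tuple window_integral_nonneg[OF cW Hp square_integrable_simplex_0, of 1 s] s in auto)

end

context
  fixes s :: real and p q :: nat and \<alpha> \<beta> :: real
  assumes cW: "compact W" "convex W" "measure lborel W = 1" and s: "s > 0"
    and Hp: "square_integrable_simplex TYPE('a) p \<alpha>" and Hq: "square_integrable_simplex TYPE('a) q \<beta>"
begin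

private abbreviation "h \<equiv> simplex_weight s \<alpha> p :: 'a set \<Rightarrow> real"
private abbreviation "g \<equiv> simplex_weight s \<beta> q :: 'a set \<Rightarrow> real"

lemma nn_integral_overlap:
  assumes m: "1 \<le> m" "m \<le> p + 1" "m \<le> q + 1"
  shows "(\<lambda>\<omega>. ennreal (overlap_sum (Suc p) (Suc q) m h g (\<eta> \<omega>))) \<in> borel_measurable M \<and>
    (\<integral>\<^sup>+\<omega>. ennreal (overlap_sum (Suc p) (Suc q) m h g (\<eta> \<omega>)) \<partial>M) = ennreal (cov_term W t s p q \<alpha> \<beta> m)"
  unfolding cov_term_def
proof (rule nn_integral_inj_tuples_scaled)
  note ss = second_simplex_card[OF m]
  let ?r = "p + q + 2 - m"
  let ?F = "\<lambda>x. h (x ` {..<Suc p}) * g (x ` second_simplex p q m)"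
  have sub: "{..<Suc p} \<subseteq> {..<?r}" "second_simplex p q m \<subseteq> {..<?r}" 
    unfolding ss(1)[symmetric] by (rule Un_upper1, rule Un_upper2)
  show "?F \<in> borel_measurable (\<Pi>\<^sub>M i\<in>{..<?r}. lborel)"
    using Hp Hq unfolding square_integrable_simplex_def
    by (intro borel_measurable_times simplex_weight_tuple_measurable sub ss) simp_all
  show "?F x \<ge> 0" for x by simp
  show "(\<Sum>x\<in>inj_tuples ?r X. ?F x) =
      (fact m * fact (p + 1 - m) * fact (q + 1 - m)) * overlap_sum (Suc p) (Suc q) m h g X" if "finite X" for X
    using sum_inj_tuples[OF that ss(1), of h g] ss by (simp add: overlap_sum_def)
  show "(\<integral>\<^sup>+x. ennreal (?F x) * window_indicator W {..<?r} x \<partial>(\<Pi>\<^sub>M i\<in>{..<?r}. lborel)) =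
      ennreal (s ^ (DIM('a) * (p + q + 1 - m)) * s powr (\<alpha> * p + \<beta> * q) * window_integral W p q m \<alpha> \<beta> s)"
    by (rule nn_integral_overlap_tuple[OF cW Hp Hq m s])
  show "0 \<le> s ^ (DIM('a) * (p + q + 1 - m)) * s powr (\<alpha> * p + \<beta> * q) * window_integral W p q m \<alpha> \<beta> s"
    using s window_integral_nonneg[OF cW Hp Hq m] by simp
qed simp

text \<open>
  Without a common vertex the integrand is a product of functions of disjoint sets of variables, so the expectation is
  the product of the two means. In the covariance this term cancels.
\<close>

lemma nn_integral_disjoint_pairs:
  "(\<lambda>\<omega>. ennreal (overlap_sum (Suc p) (Suc q) 0 h g (\<eta> \<omega>))) \<in> borel_measurable M \<and>
    (\<integral>\<^sup>+\<omega>. ennreal (overlap_sum (Suc p) (Suc q) 0 h g (\<eta> \<omega>)) \<partial>M) =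
      ennreal (mean_const W t s p \<alpha> * mean_const W t s q \<beta>)"
proof -
  define Q where "Q = {Suc p..<p + q + 2}"
  define u where "u = s ^ (DIM('a) * p) * s powr (\<alpha> * p) * window_integral W p 0 1 \<alpha> 0 s"
  define v where "v = s ^ (DIM('a) * q) * s powr (\<beta> * q) * window_integral W q 0 1 \<beta> 0 s"
  have uv: "u \<ge> 0" "v \<ge> 0"
    using s window_integral_nonneg[OF cW Hp square_integrable_simplex_0, of 1 s]
      window_integral_nonneg[OF cW Hq square_integrable_simplex_0, of 1 s]
    by (simp_all add: u_def v_def)
  let ?r = "p + q + 2"
  have R: "{..<Suc p} \<union> Q = {..<?r}" and disj: "{..<Suc p} \<inter> Q = {}" and Q: "finite Q" "card Q = Suc q"
    by (auto simp: Q_def)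
  have diff: "{..<Suc p} - Q = {..<Suc p}" "Q - {..<Suc p} = Q" using disj by auto
  have good: "p \<le> DIM('a) \<or> \<alpha> = 0" "q \<le> DIM('a) \<or> \<beta> = 0"
    using Hp Hq by (auto simp: square_integrable_simplex_def)
  let ?F = "\<lambda>x. h (x ` {..<Suc p}) * g (x ` Q)"
  have "(\<lambda>\<omega>. ennreal (overlap_sum (Suc p) (Suc q) 0 h g (\<eta> \<omega>))) \<in> borel_measurable M \<and>
    (\<integral>\<^sup>+\<omega>. ennreal (overlap_sum (Suc p) (Suc q) 0 h g (\<eta> \<omega>)) \<partial>M) =
      ennreal (t ^ ?r * (u * v) / (fact (Suc p) * fact (Suc q)))"
  proof (rule nn_integral_inj_tuples_scaled)
    show "?F \<in> borel_measurable (\<Pi>\<^sub>M i\<in>{..<?r}. lborel)"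
      using good Q R by (intro borel_measurable_times simplex_weight_tuple_measurable) auto
    show "?F x \<ge> 0" for x by simp
    show "(\<Sum>x\<in>inj_tuples ?r X. ?F x) = (fact (Suc p) * fact (Suc q)) * overlap_sum (Suc p) (Suc q) 0 h g X"
      if "finite X" for X
      using sum_inj_tuples[OF that R, of h g] by (simp add: overlap_sum_def disj diff Q del: fact_Suc)
    show "(\<integral>\<^sup>+x. ennreal (?F x) * window_indicator W {..<?r} x \<partial>(\<Pi>\<^sub>M i\<in>{..<?r}. lborel)) = ennreal (u * v)"
    proof -
      let ?f = "\<lambda>x. ennreal (h (x ` {..<Suc p})) * window_indicator W {..<Suc p} x"
      let ?g = "\<lambda>x. ennreal (g (x ` Q)) * window_indicator W Q x"
      have "(\<integral>\<^sup>+x. ennreal (?F x) * window_indicator W {..<?r} x \<partial>(\<Pi>\<^sub>M i\<in>{..<?r}. lborel)) =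
          (\<integral>\<^sup>+x. ?f x * ?g x \<partial>(\<Pi>\<^sub>M i\<in>{..<Suc p} \<union> Q. lborel))"
        unfolding R[symmetric]
        by (intro nn_integral_cong) (simp add: window_indicator_def prod.union_disjoint[OF finite_lessThan Q(1) disj]
            ennreal_mult mult_ac)
      also have "\<dots> = (\<integral>\<^sup>+x. ?f x \<partial>(\<Pi>\<^sub>M i\<in>{..<Suc p}. lborel)) * (\<integral>\<^sup>+x. ?g x \<partial>(\<Pi>\<^sub>M i\<in>Q. lborel))"
      proof (rule nn_integral_PiM_mult_disjoint[OF finite_lessThan Q(1) disj])
        show "?f \<in> borel_measurable (\<Pi>\<^sub>M i\<in>{..<Suc p}. lborel)" "?g \<in> borel_measurable (\<Pi>\<^sub>M i\<in>Q. lborel)"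
          using good Q cW(1)
          by (intro borel_measurable_times_ennreal measurable_compose[OF _ measurable_ennreal]
              simplex_weight_tuple_measurable window_indicator_measurable borel_compact; simp)+
      next
        fix x y :: "nat \<Rightarrow> 'a" assume "\<And>i. i \<in> {..<Suc p} \<Longrightarrow> x i = y i"
        then have "x ` {..<Suc p} = y ` {..<Suc p}" "window_indicator W {..<Suc p} x = window_indicator W {..<Suc p} y"
          unfolding window_indicator_def by (auto intro!: image_cong prod.cong)
        then show "?f x = ?f y" by (simp only:)
      next
        fix x y :: "nat \<Rightarrow> 'a" assume "\<And>i. i \<in> Q \<Longrightarrow> x i = y i"
        then have "x ` Q = y ` Q" "window_indicator W Q x = window_indicator W Q y"
          unfolding window_indicator_def by (auto intro!: image_cong prod.cong)
        then show "?g x = ?g y" by (simp only:)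
      qed
      also have "(\<integral>\<^sup>+x. ?f x \<partial>(\<Pi>\<^sub>M i\<in>{..<Suc p}. lborel)) = ennreal u"
        unfolding u_def by (rule nn_integral_weight_tuple[OF cW s Hp])
      also have "(\<integral>\<^sup>+x. ?g x \<partial>(\<Pi>\<^sub>M i\<in>Q. lborel)) = ennreal v"
      proof -
        \<comment> \<open>Renumber the vertices of the second simplex, so that it becomes a first one.\<close>
        have \<sigma>: "bij_betw (\<lambda>i. Suc p + i) {..<Suc q} Q"
          by (rule bij_betw_byWitness[where f'="\<lambda>i. i - Suc p"]) (auto simp: Q_def)
        have "ennreal v = (\<integral>\<^sup>+x. ennreal (g (x ` {..<Suc q})) * window_indicator W {..<Suc q} x \<partial>(\<Pi>\<^sub>M i\<in>{..<Suc q}. lborel))"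
          unfolding v_def by (rule nn_integral_weight_tuple[OF cW s Hq, symmetric])
        also have "\<dots> = (\<integral>\<^sup>+x. ennreal (g ((\<lambda>i\<in>{..<Suc q}. x (Suc p + i)) ` {..<Suc q})) *
            window_indicator W {..<Suc q} (\<lambda>i\<in>{..<Suc q}. x (Suc p + i)) \<partial>(\<Pi>\<^sub>M i\<in>Q. lborel))"
          using good cW(1)
          by (intro nn_integral_PiM_lborel_reindex[OF Q(1) \<sigma>] borel_measurable_times_ennreal
              measurable_compose[OF _ measurable_ennreal]
              simplex_weight_tuple_measurable window_indicator_measurable borel_compact) simp_all
        also have "\<dots> = (\<integral>\<^sup>+x. ?g x \<partial>(\<Pi>\<^sub>M i\<in>Q. lborel))"
        proof (intro nn_integral_cong arg_cong2[where f="(*)"] arg_cong[where f=ennreal] arg_cong[where f=g])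
          fix x :: "nat \<Rightarrow> 'a"
          have "(\<lambda>i\<in>{..<Suc q}. x (Suc p + i)) ` {..<Suc q} = x ` ((\<lambda>i. Suc p + i) ` {..<Suc q})"
            unfolding image_image by (intro image_cong) auto
          then show "(\<lambda>i\<in>{..<Suc q}. x (Suc p + i)) ` {..<Suc q} = x ` Q"
            using \<sigma> by (simp only: bij_betw_def)
          have "window_indicator W Q x = (\<Prod>i\<in>{..<Suc q}. indicator W (x (Suc p + i)))"
            unfolding window_indicator_def by (rule prod.reindex_bij_betw[OF \<sigma>, symmetric])
          then show "window_indicator W {..<Suc q} (\<lambda>i\<in>{..<Suc q}. x (Suc p + i)) = window_indicator W Q x"
            by (simp add: window_indicator_def)
        qed
        finally show ?thesis by simp
      qed
      finally show ?thesis using uv by (simp add: ennreal_mult)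
    qed
  qed (use uv in auto)
  moreover have "t ^ ?r * (u * v) / (fact (Suc p) * fact (Suc q)) = mean_const W t s p \<alpha> * mean_const W t s q \<beta>"
  proof -
    have "t ^ ?r = t ^ Suc p * t ^ Suc q" by (simp add: power_add mult_ac)
    then show ?thesis unfolding mean_const_def u_def v_def by (simp add: mult_ac del: fact_Suc power_Suc)
  qed
  ultimately show ?thesis by simp
qed

theorem vol_power_moments:
  shows "integrable M (\<lambda>\<omega>. vol_power s p \<alpha> (\<eta> \<omega>))"
    and "integrable M (\<lambda>\<omega>. vol_power s p \<alpha> (\<eta> \<omega>) * vol_power s q \<beta> (\<eta> \<omega>))"
    and "covariance M (\<lambda>\<omega>. vol_power s p \<alpha> (\<eta> \<omega>)) (\<lambda>\<omega>. vol_power s q \<beta> (\<eta> \<omega>)) =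
      (\<Sum>m=1..min p q + 1. cov_term W t s p q \<alpha> \<beta> m)"
proof -
  let ?X = "\<lambda>\<omega>. vol_power s p \<alpha> (\<eta> \<omega>)" and ?Y = "\<lambda>\<omega>. vol_power s q \<beta> (\<eta> \<omega>)"
  let ?O = "\<lambda>m \<omega>. overlap_sum (Suc p) (Suc q) m h g (\<eta> \<omega>)"
  have nonneg: "vol_power s k \<gamma> Z \<ge> 0" for k \<gamma> and Z :: "'a set"
    unfolding vol_power_def by (intro divide_nonneg_nonneg sum_nonneg) auto
  have c_nonneg: "cov_term W t s p q \<alpha> \<beta> m \<ge> 0" if "m \<in> {1..min p q + 1}" for m
  proof -
    have "1 \<le> m" "m \<le> p + 1" "m \<le> q + 1" using that by auto
    from window_integral_nonneg[OF cW Hp Hq this, of s] show ?thesis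
      using s t unfolding cov_term_def
      by (intro divide_nonneg_nonneg mult_nonneg_nonneg) simp_all
  qed
  note mX = nn_integral_vol_power[OF cW s Hp] and mY = nn_integral_vol_power[OF cW s Hq]
  have X_meas: "?X \<in> borel_measurable M"
  proof -
    have "(\<lambda>\<omega>. enn2real (ennreal (?X \<omega>))) \<in> borel_measurable M" using mX by (intro borel_measurable_enn2real) simp
    then show ?thesis by (simp add: nonneg)
  qed
  have Y_meas: "?Y \<in> borel_measurable M"
  proof -
    have "(\<lambda>\<omega>. enn2real (ennreal (?Y \<omega>))) \<in> borel_measurable M" using mY by (intro borel_measurable_enn2real) simp
    then show ?thesis by (simp add: nonneg)
  qed
  have X: "has_bochner_integral M ?X (mean_const W t s p \<alpha>)"
    by (rule has_bochner_integral_nn_integral[OF X_meas])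
      (use mX nonneg mean_const_nonneg[OF cW s Hp] in auto)
  have Y: "has_bochner_integral M ?Y (mean_const W t s q \<beta>)"
    by (rule has_bochner_integral_nn_integral[OF Y_meas])
      (use mY nonneg mean_const_nonneg[OF cW s Hq] in auto)
  let ?E = "mean_const W t s p \<alpha> * mean_const W t s q \<beta> + (\<Sum>m=1..min p q + 1. cov_term W t s p q \<alpha> \<beta> m)"
  have O_meas: "(\<lambda>\<omega>. ennreal (?O m \<omega>)) \<in> borel_measurable M" if "m \<le> min p q + 1" for m
    using nn_integral_overlap[of m] nn_integral_disjoint_pairs that by (cases "m = 0") auto
  have "(\<integral>\<^sup>+\<omega>. ennreal (?X \<omega> * ?Y \<omega>) \<partial>M) = (\<integral>\<^sup>+\<omega>. (\<Sum>m\<le>min p q + 1. ennreal (?O m \<omega>)) \<partial>M)"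
  proof (rule nn_integral_cong)
    fix \<omega> assume "\<omega> \<in> space M"
    then have "?X \<omega> * ?Y \<omega> = (\<Sum>m\<le>min (Suc p) (Suc q). ?O m \<omega>)"
      using subset_sum_mult[of "\<eta> \<omega>" "Suc p" h "Suc q" g] by (simp add: vol_power_eq_subset_sum overlap_sum_def)
    moreover have "min (Suc p) (Suc q) = min p q + 1" by simp
    ultimately show "ennreal (?X \<omega> * ?Y \<omega>) = (\<Sum>m\<le>min p q + 1. ennreal (?O m \<omega>))"
      by (simp only: sum_ennreal overlap_sum_nonneg simplex_weight_nonneg)
  qed
  also have "\<dots> = (\<Sum>m\<le>min p q + 1. \<integral>\<^sup>+\<omega>. ennreal (?O m \<omega>) \<partial>M)"
    by (intro nn_integral_sum O_meas) simp
  also have "\<dots> = (\<integral>\<^sup>+\<omega>. ennreal (?O 0 \<omega>) \<partial>M) + (\<Sum>m=1..min p q + 1. \<integral>\<^sup>+\<omega>. ennreal (?O m \<omega>) \<partial>M)"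
  proof -
    have "{..min p q + 1} = insert 0 {1..min p q + 1}" by auto
    then show ?thesis by simp
  qed
  also have "\<dots> = ennreal (mean_const W t s p \<alpha> * mean_const W t s q \<beta>) +
      (\<Sum>m=1..min p q + 1. ennreal (cov_term W t s p q \<alpha> \<beta> m))"
    using nn_integral_disjoint_pairs nn_integral_overlap
    by (intro arg_cong2[where f="(+)"] sum.cong) auto
  also have "\<dots> = ennreal ?E"
    using mean_const_nonneg[OF cW s Hp] mean_const_nonneg[OF cW s Hq] c_nonneg
    by (subst sum_ennreal, fast, subst ennreal_plus) (auto intro!: sum_nonneg simp del: sum.cl_ivl_Suc)
  finally have nnXY: "(\<integral>\<^sup>+\<omega>. ennreal (?X \<omega> * ?Y \<omega>) \<partial>M) = ennreal ?E" .
  have XY: "has_bochner_integral M (\<lambda>\<omega>. ?X \<omega> * ?Y \<omega>) ?E"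
  proof (rule has_bochner_integral_nn_integral)
    show "(\<lambda>\<omega>. ?X \<omega> * ?Y \<omega>) \<in> borel_measurable M" using X_meas Y_meas by measurable
    show "AE \<omega> in M. 0 \<le> ?X \<omega> * ?Y \<omega>" by (simp add: nonneg)
    show "0 \<le> ?E"
      using mean_const_nonneg[OF cW s Hp] mean_const_nonneg[OF cW s Hq] c_nonneg
      by (intro add_nonneg_nonneg mult_nonneg_nonneg sum_nonneg) auto
  qed (rule nnXY)
  have iX: "integrable M ?X" and iY: "integrable M ?Y" and iXY: "integrable M (\<lambda>\<omega>. ?X \<omega> * ?Y \<omega>)"
    using X Y XY by (auto simp: has_bochner_integral_iff)
  show "integrable M ?X" "integrable M (\<lambda>\<omega>. ?X \<omega> * ?Y \<omega>)" by fact+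
  let ?a = "mean_const W t s p \<alpha>" and ?b = "mean_const W t s q \<beta>"
  have "covariance M ?X ?Y = (\<integral>\<omega>. ?X \<omega> * ?Y \<omega> - ?b * ?X \<omega> - ?a * ?Y \<omega> + ?a * ?b \<partial>M)"
    unfolding covariance_def using X Y
    by (intro Bochner_Integration.integral_cong) (simp_all add: has_bochner_integral_iff algebra_simps)
  also have "\<dots> = ?E - ?b * ?a - ?a * ?b + ?a * ?b"
    using X Y XY by (subst Bochner_Integration.integral_add Bochner_Integration.integral_diff; simp add: has_bochner_integral_iff prob_space)+
  finally show "covariance M ?X ?Y = (\<Sum>m=1..min p q + 1. cov_term W t s p q \<alpha> \<beta> m)" by simp
qed

end

end

section \<open>The normalization\<close>

definition max_power :: "nat \<Rightarrow> real \<Rightarrow> real" where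
  "max_power k u = max (u powr (real k / 2)) (u powr real k)"

text \<open>
  The exponent decreases linearly from \<open>k\<close> to \<open>k / 2\<close>, so the maximum is attained at an end.
\<close>

lemma Max_powers:
  assumes u: "u > 0"
  shows "Max ((\<lambda>m. u powr (real k - (real m - 1) / 2)) ` {1..k + 1}) = max_power k u"
proof (rule Max_eqI)
  fix y assume "y \<in> (\<lambda>m. u powr (real k - (real m - 1) / 2)) ` {1..k + 1}"
  then obtain m where m: "1 \<le> m" "m \<le> k + 1" "y = u powr (real k - (real m - 1) / 2)" by auto
  then have "real k / 2 \<le> real k - (real m - 1) / 2" "real k - (real m - 1) / 2 \<le> real k"
    by (auto simp: field_simps)
  then have "u \<ge> 1 \<Longrightarrow> y \<le> u powr real k" "u \<le> 1 \<Longrightarrow> y \<le> u powr (real k / 2)"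
    using m(3) u by (auto intro: powr_mono powr_mono')
  then show "y \<le> max_power k u" unfolding max_power_def by (cases "u \<ge> 1") auto
next
  have "u powr (real k / 2) \<in> (\<lambda>m. u powr (real k - (real m - 1) / 2)) ` {1..k + 1}"
    by (rule image_eqI[of _ _ "k + 1"]) (simp_all add: field_simps)
  moreover have "u powr real k \<in> (\<lambda>m. u powr (real k - (real m - 1) / 2)) ` {1..k + 1}"
    by (rule image_eqI[of _ _ 1]) simp_all
  ultimately show "max_power k u \<in> (\<lambda>m. u powr (real k - (real m - 1) / 2)) ` {1..k + 1}"
    unfolding max_power_def max_def by simp
qed simp

lemma max_power_pos: "u > 0 \<Longrightarrow> max_power k u > 0"
  by (simp add: max_power_def less_max_iff_disj)

lemma max_power_le_1: "0 < u \<Longrightarrow> u \<le> 1 \<Longrightarrow> max_power k u = u powr (real k / 2)"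
  unfolding max_power_def by (intro max_absorb1 powr_mono') auto

lemma max_power_ge_1: "1 \<le> u \<Longrightarrow> max_power k u = u powr real k"
  unfolding max_power_def by (intro max_absorb2 powr_mono) auto

text \<open>
  What the powers of \<open>t\<close> and \<open>s\<close> in the covariance term for \<open>m\<close> common vertices amount to after normalization, as a
  function of \<open>u = t s ^ d\<close>.
\<close>

definition growth_ratio :: "nat \<Rightarrow> nat \<Rightarrow> nat \<Rightarrow> real \<Rightarrow> real" where
  "growth_ratio p q m u = u powr (real p + real q + 1 - real m) / (max_power p u * max_power q u)"

lemma growth_ratio_le_1:
  assumes "0 < u" "u \<le> 1"
  shows "growth_ratio p q m u = u powr ((real p + real q + 2 - 2 * real m) / 2)"
proof -
  have "growth_ratio p q m u = u powr (real p + real q + 1 - real m - (real p / 2 + real q / 2))"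
    unfolding growth_ratio_def max_power_le_1[OF assms] powr_diff powr_add[symmetric] ..
  also have "real p + real q + 1 - real m - (real p / 2 + real q / 2) = (real p + real q + 2 - 2 * real m) / 2"
    by (simp add: field_simps)
  finally show ?thesis .
qed

lemma growth_ratio_ge_1:
  assumes "1 \<le> u"
  shows "growth_ratio p q m u = u powr (1 - real m)"
proof -
  have "growth_ratio p q m u = u powr (real p + real q + 1 - real m - (real p + real q))"
    unfolding growth_ratio_def max_power_ge_1[OF assms] powr_diff powr_add[symmetric] ..
  then show ?thesis by (simp add: algebra_simps)
qed

lemma growth_ratio_tendsto:
  assumes "c > 0" "(u \<longlongrightarrow> c) F"
  shows "((\<lambda>t. growth_ratio p q m (u t)) \<longlongrightarrow> growth_ratio p q m c) F"
  unfolding growth_ratio_def max_power_def using assms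
  by (intro tendsto_intros) (auto simp: max_def)

text \<open>
  Since \<open>m \<le> min p q + 1\<close>, the exponent in \<open>growth_ratio_le_1\<close> is nonnegative; it vanishes only if \<open>p = q = m - 1\<close>.
\<close>

lemma growth_ratio_tendsto_0:
  assumes u: "\<forall>\<^sub>F t in F. u t > 0" "(u \<longlongrightarrow> 0) F" and m: "m \<le> min p q + 1"
  shows "((\<lambda>t. growth_ratio p q m (u t)) \<longlongrightarrow> (if p + q + 2 - 2 * m = 0 then 1 else 0)) F"
proof -
  have "\<forall>\<^sub>F t in F. u t < 1" using u(2) by (rule order_tendstoD) simp
  with u(1) have ev: "\<forall>\<^sub>F t in F. growth_ratio p q m (u t) = u t powr ((real p + real q + 2 - 2 * real m) / 2)"
    by eventually_elim (simp add: growth_ratio_le_1)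
  have le: "2 * m \<le> p + q + 2" using m by auto
  have "((\<lambda>t. u t powr ((real p + real q + 2 - 2 * real m) / 2)) \<longlongrightarrow> (if p + q + 2 - 2 * m = 0 then 1 else 0)) F"
  proof (cases "2 * m = p + q + 2")
    case True
    then have "real p + real q + 2 - 2 * real m = 0" by (simp flip: of_nat_add of_nat_mult)
    moreover have "((\<lambda>t. u t powr 0) \<longlongrightarrow> 1) F"
      using u(1) by (intro tendsto_eventually) (auto elim: eventually_mono)
    ultimately show ?thesis using True by (simp only: div_0 diff_self_eq_0 refl if_True)
  next
    case False
    with le have "2 * m < p + q + 2" by simp
    then have "real (2 * m) < real (p + q + 2)" by (simp only: of_nat_less_iff)
    then have pos: "(real p + real q + 2 - 2 * real m) / 2 > 0" by simp
    have "((\<lambda>t. u t powr ((real p + real q + 2 - 2 * real m) / 2)) \<longlongrightarrow> 0 powr ((real p + real q + 2 - 2 * real m) / 2)) F"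
      using u pos by (intro tendsto_powr2 tendsto_const) (auto elim: eventually_mono)
    then show ?thesis using \<open>2 * m < p + q + 2\<close> by simp
  qed
  then show ?thesis using ev by (simp cong: tendsto_cong)
qed

lemma growth_ratio_tendsto_top:
  assumes u: "filterlim u at_top F" and m: "1 \<le> m"
  shows "((\<lambda>t. growth_ratio p q m (u t)) \<longlongrightarrow> (if m - 1 = 0 then 1 else 0)) F"
proof -
  have "\<forall>\<^sub>F t in F. u t \<ge> 1" using u by (simp add: filterlim_at_top)
  then have ev: "\<forall>\<^sub>F t in F. growth_ratio p q m (u t) = u t powr (1 - real m)"
    by eventually_elim (simp add: growth_ratio_ge_1)
  have "((\<lambda>t. u t powr (1 - real m)) \<longlongrightarrow> (if m - 1 = 0 then 1 else 0)) F"
  proof (cases "m = 1")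
    case True
    have "((\<lambda>t. u t powr 0) \<longlongrightarrow> 1) F"
      using \<open>\<forall>\<^sub>F t in F. u t \<ge> 1\<close> by (intro tendsto_eventually) (auto elim!: eventually_mono)
    then show ?thesis using True by simp
  next
    case False
    then show ?thesis using m tendsto_neg_powr[OF _ u, of "1 - real m"] by simp
  qed
  then show ?thesis using ev by (simp cong: tendsto_cong)
qed

lemma cov_term_normalized:
  fixes W :: "'a::euclidean_space set"
  assumes t: "t > 0" and s: "s > 0" and m: "1 \<le> m" "m \<le> min p q + 1"
  shows "cov_term W t s p q \<alpha> \<beta> m / (normalizer DIM('a) t p \<alpha> s * normalizer DIM('a) t q \<beta> s) =
    growth_ratio p q m (t * s ^ DIM('a)) *
    (window_integral W p q m \<alpha> \<beta> s / (fact m * fact (p + 1 - m) * fact (q + 1 - m)))"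
proof -
  let ?u = "t * s ^ DIM('a)" and ?f = "fact m * fact (p + 1 - m) * fact (q + 1 - m) :: real"
  let ?J = "window_integral W p q m \<alpha> \<beta> s" and ?e = "p + q + 1 - m"
  have u: "?u > 0" using t s by simp
  have "t ^ (p + q + 2 - m) = t * t ^ ?e" using m by (simp add: Suc_diff_le flip: power_Suc)
  then have num: "cov_term W t s p q \<alpha> \<beta> m = t * (s powr (\<alpha> * p) * s powr (\<beta> * q)) * ?u ^ ?e * (?J / ?f)"
    by (simp add: cov_term_def power_mult power_mult_distrib powr_add)
  have "?u ^ ?e = ?u powr (real p + real q + 1 - real m)"
    using u m by (simp flip: powr_realpow add: of_nat_diff add_ac)
  then have gr: "growth_ratio p q m ?u = ?u ^ ?e / (max_power p ?u * max_power q ?u)"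
    by (simp add: growth_ratio_def)
  have "normalizer DIM('a) t p \<alpha> s * normalizer DIM('a) t q \<beta> s =
      (sqrt t * sqrt t) * (s powr (\<alpha> * p) * s powr (\<beta> * q)) * (max_power p ?u * max_power q ?u)"
    unfolding normalizer_def Max_powers[OF u] by (simp only: mult_ac)
  then have den: "normalizer DIM('a) t p \<alpha> s * normalizer DIM('a) t q \<beta> s =
      t * (s powr (\<alpha> * p) * s powr (\<beta> * q)) * (max_power p ?u * max_power q ?u)"
    using t by simp
  have "t * (s powr (\<alpha> * p) * s powr (\<beta> * q)) \<noteq> 0" using t s by simp
  then show ?thesis
    unfolding num den gr
    by (metis (no_types, opaque_lifting) mult.assoc nonzero_mult_divide_mult_cancel_left times_divide_eq_left)
qed

section \<open>The limiting covariance matrix\<close>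

definition limit_coeff ::
  "'a::euclidean_space itself \<Rightarrow> nat \<Rightarrow> nat \<Rightarrow> real \<Rightarrow> real \<Rightarrow> nat \<Rightarrow> real" where
  "limit_coeff T p q \<alpha> \<beta> m = mu T p q m \<alpha> \<beta> / (fact m * fact (p + 1 - m) * fact (q + 1 - m))"

text \<open>
  The index \<open>i\<close> of the matrices and the number \<open>m\<close> of common vertices are related by \<open>i = p + q + 2 - 2 m\<close>; the condition in
  \<open>A_lt\<close> describes exactly the image of \<open>1 \<le> m \<le> p + 1\<close>. The weights \<open>x\<close> are arbitrary so that one lemma serves both
  regimes with these matrices: powers of \<open>c\<close>, or \<open>1\<close> at \<open>i = 0\<close> and \<open>0\<close> elsewhere.
\<close>

lemma sum_A_lt:
  assumes le: "k l \<le> k j" and N: "k l + k j \<le> N"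
  shows "(\<Sum>i=0..N. A_lt T k \<alpha> i l j * x i) =
    (\<Sum>m=1..k l + 1. limit_coeff T (k l) (k j) (\<alpha> l) (\<alpha> j) m * x (k l + k j + 2 - 2 * m))"
proof -
  let ?p = "k l" and ?q = "k j"
  let ?\<phi> = "\<lambda>m. ?p + ?q + 2 - 2 * m"
  have inj: "inj_on ?\<phi> {1..?p + 1}" using le by (auto simp: inj_on_def)
  have val: "A_lt T k \<alpha> (?\<phi> m) l j = limit_coeff T ?p ?q (\<alpha> l) (\<alpha> j) m" if "m \<in> {1..?p + 1}" for m
  proof -
    have "int (?\<phi> m) - \<bar>int ?p - int ?q\<bar> = 2 * int (?p + 1 - m)" using that le by auto
    moreover have "?p + 1 - m \<in> {0..min ?p ?q}" using that le by auto
    ultimately have "int (?\<phi> m) - \<bar>int ?p - int ?q\<bar> \<in> (\<lambda>i. 2 * int i) ` {0..min ?p ?q}"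
      by (rule image_eqI)
    moreover have halves: "?p + ?q + 2 - ?\<phi> m = 2 * m" "?\<phi> m + ?q - ?p = 2 * (?q + 1 - m)"
        "?\<phi> m + ?p - ?q = 2 * (?p + 1 - m)"
      using that le by auto
    ultimately show ?thesis
      unfolding A_lt_def limit_coeff_def halves by (simp add: mult_ac)
  qed
  have zero: "A_lt T k \<alpha> i l j = 0" if "i \<notin> ?\<phi> ` {1..?p + 1}" for i
  proof (rule ccontr)
    assume "A_lt T k \<alpha> i l j \<noteq> 0"
    then obtain a where a: "a \<le> ?p" "int i - \<bar>int ?p - int ?q\<bar> = 2 * int a"
      using le by (auto simp: A_lt_def split: if_splits)
    then have "i = ?\<phi> (?p + 1 - a)" using le by auto
    then show False using that a(1) by auto
  qed
  have "(\<Sum>i=0..N. A_lt T k \<alpha> i l j * x i) = (\<Sum>i\<in>?\<phi> ` {1..?p + 1}. A_lt T k \<alpha> i l j * x i)"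
    using N by (intro sum.mono_neutral_right) (auto simp: zero)
  also have "\<dots> = (\<Sum>m=1..?p + 1. A_lt T k \<alpha> (?\<phi> m) l j * x (?\<phi> m))"
    by (rule sum.reindex[OF inj, unfolded comp_def])
  also have "\<dots> = (\<Sum>m=1..?p + 1. limit_coeff T ?p ?q (\<alpha> l) (\<alpha> j) m * x (?\<phi> m))"
    by (intro sum.cong refl arg_cong2[where f="(*)"] val)
  finally show ?thesis .
qed

lemma sum_A_gt:
  assumes le: "k l \<le> k j" and N: "k l \<le> N"
  shows "(\<Sum>i=0..N. A_gt T k \<alpha> i l j * x i) =
    (\<Sum>m=1..k l + 1. limit_coeff T (k l) (k j) (\<alpha> l) (\<alpha> j) m * x (m - 1))"
proof -
  have "(\<Sum>i=0..N. A_gt T k \<alpha> i l j * x i) = (\<Sum>i=0..k l. A_gt T k \<alpha> i l j * x i)"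
    using le N by (intro sum.mono_neutral_right) (auto simp: A_gt_def)
  also have "\<dots> = (\<Sum>i=0..k l. limit_coeff T (k l) (k j) (\<alpha> l) (\<alpha> j) (i + 1) * x (i + 1 - 1))"
    using le by (intro sum.cong) (auto simp: A_gt_def limit_coeff_def)
  also have "\<dots> = (\<Sum>m=0 + 1..k l + 1. limit_coeff T (k l) (k j) (\<alpha> l) (\<alpha> j) m * x (m - 1))"
    by (rule sum.shift_bounds_cl_nat_ivl[symmetric])
  finally show ?thesis by simp
qed

text \<open>
  For \<open>p = q\<close> the two sides are different integrals by definition, which agree only after a permutation of the variables.
\<close>

lemma mu_commute: "p \<noteq> q \<Longrightarrow> mu T p q m \<alpha> \<beta> = mu T q p m \<beta> \<alpha>"
  by (simp add: mu_def)

lemma A_lt_commute: "k l \<noteq> k j \<Longrightarrow> A_lt T k \<alpha> m l j = A_lt T k \<alpha> m j l"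
  by (simp add: A_lt_def mu_commute[of "k l" "k j"] abs_minus_commute min.commute add.commute mult_ac)

lemma A_gt_commute: "k l \<noteq> k j \<Longrightarrow> A_gt T k \<alpha> m l j = A_gt T k \<alpha> m j l"
  by (simp add: A_gt_def mu_commute[of "k l" "k j"] min.commute mult_ac)

lemma covariance_commute: "covariance M X Y = covariance M Y X"
  unfolding covariance_def by (simp add: mult.commute)

lemma covariance_divide:
  "covariance M (\<lambda>\<omega>. X \<omega> / a) (\<lambda>\<omega>. Y \<omega> / b) = covariance M X Y / (a * b)"
proof -
  have "covariance M (\<lambda>\<omega>. X \<omega> / a) (\<lambda>\<omega>. Y \<omega> / b) =
      (\<integral>\<omega>. (X \<omega> - (\<integral>\<omega>'. X \<omega>' \<partial>M)) * (Y \<omega> - (\<integral>\<omega>'. Y \<omega>' \<partial>M)) / (a * b) \<partial>M)"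
    unfolding covariance_def by (simp add: diff_divide_distrib[symmetric])
  then show ?thesis by (simp add: covariance_def)
qed

locale rips_limit =
  fixes W :: "'a::euclidean_space set"
    and M :: "real \<Rightarrow> 'w measure"
    and \<eta> :: "real \<Rightarrow> 'w \<Rightarrow> 'a set"
    and \<delta> :: "real \<Rightarrow> real"
    and n :: nat and k :: "nat \<Rightarrow> nat" and \<alpha> :: "nat \<Rightarrow> real"
  assumes W: "compact W" "convex W" "measure lborel W = 1"
    and \<eta>: "\<forall>t>0. poisson_process (M t) (intensity W t) (\<eta> t)"
    and \<delta>: "\<forall>t>0. \<delta> t > 0" "(\<delta> \<longlongrightarrow> 0) at_top"
    and adm: "admissible DIM('a) n k \<alpha>"
    and fin: "\<forall>i\<in>{1..n}. mu_converges TYPE('a) (k i) (k i) (k i + 1) (\<alpha> i) (\<alpha> i)"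
begin

definition X :: "real \<Rightarrow> nat \<Rightarrow> 'w \<Rightarrow> real" where
  "X t i \<omega> = vol_power_hat t (\<delta> t) (k i) (\<alpha> i) (\<eta> t \<omega>)"

lemma square_integrable: "i \<in> {1..n} \<Longrightarrow> square_integrable_simplex TYPE('a) (k i) (\<alpha> i)"
  using adm fin unfolding square_integrable_simplex_def admissible_def
  by (metis not_le_imp_less)

lemma k_le: "i \<in> {1..n} \<Longrightarrow> k i \<le> k n"
  using adm by (auto simp: admissible_def)

lemma poisson_window: "t > 0 \<Longrightarrow> poisson_window (M t) W t (\<eta> t)"
  using \<eta> W(1) emeasure_bounded_finite[OF compact_imp_bounded[OF W(1)]]
  by (simp add: poisson_window_def borel_compact)

lemma moments:
  assumes t: "t > 0" and l: "l \<in> {1..n}" and j: "j \<in> {1..n}"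
  shows "integrable (M t) (X t l)" "integrable (M t) (\<lambda>\<omega>. X t l \<omega> * X t j \<omega>)"
    and "covariance (M t) (X t l) (X t j) =
      (\<Sum>m=1..min (k l) (k j) + 1. growth_ratio (k l) (k j) m (t * \<delta> t ^ DIM('a)) *
        (window_integral W (k l) (k j) m (\<alpha> l) (\<alpha> j) (\<delta> t) /
          (fact m * fact (k l + 1 - m) * fact (k j + 1 - m))))"
proof -
  interpret poisson_window "M t" W t "\<eta> t" using t by (rule poisson_window)
  have s: "\<delta> t > 0" using \<delta>(1) t by simp
  note mom = vol_power_moments[OF rips_limit.W[OF rips_limit_axioms] s square_integrable[OF l] square_integrable[OF j]]
  let ?V = "\<lambda>i \<omega>. vol_power (\<delta> t) (k i) (\<alpha> i) (\<eta> t \<omega>)"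
  let ?N = "\<lambda>i. normalizer DIM('a) t (k i) (\<alpha> i) (\<delta> t)"
  have X_eq: "X t i = (\<lambda>\<omega>. ?V i \<omega> / ?N i)" for i
    by (simp add: X_def vol_power_hat_def fun_eq_iff)
  show "integrable (M t) (X t l)"
    unfolding X_eq using mom(1) by (rule integrable_divide)
  have "integrable (M t) (\<lambda>\<omega>. ?V l \<omega> * ?V j \<omega> / (?N l * ?N j))"
    using mom(2) by (rule integrable_divide)
  then show "integrable (M t) (\<lambda>\<omega>. X t l \<omega> * X t j \<omega>)" by (simp add: X_eq)
  have "covariance (M t) (X t l) (X t j) =
      (\<Sum>m=1..min (k l) (k j) + 1. cov_term W t (\<delta> t) (k l) (k j) (\<alpha> l) (\<alpha> j) m / (?N l * ?N j))"
    unfolding X_eq covariance_divide mom(3) by (rule sum_divide_distrib)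
  also have "\<dots> = (\<Sum>m=1..min (k l) (k j) + 1. growth_ratio (k l) (k j) m (t * \<delta> t ^ DIM('a)) *
        (window_integral W (k l) (k j) m (\<alpha> l) (\<alpha> j) (\<delta> t) /
          (fact m * fact (k l + 1 - m) * fact (k j + 1 - m))))"
    by (intro sum.cong refl cov_term_normalized t s) auto
  finally show "covariance (M t) (X t l) (X t j) = \<dots>" .
qed

lemma covariance_tendsto:
  assumes l: "l \<in> {1..n}" and j: "j \<in> {1..n}" and le: "k l \<le> k j"
    and \<rho>: "\<And>m. m \<in> {1..k l + 1} \<Longrightarrow> ((\<lambda>t. growth_ratio (k l) (k j) m (t * \<delta> t ^ DIM('a))) \<longlongrightarrow> \<rho> m) at_top"
  shows "((\<lambda>t. covariance (M t) (X t l) (X t j)) \<longlongrightarrow>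
    (\<Sum>m=1..k l + 1. limit_coeff TYPE('a) (k l) (k j) (\<alpha> l) (\<alpha> j) m * \<rho> m)) at_top"
proof -
  let ?f = "\<lambda>m. fact m * fact (k l + 1 - m) * fact (k j + 1 - m) :: real"
  have "((\<lambda>t. \<Sum>m=1..k l + 1. growth_ratio (k l) (k j) m (t * \<delta> t ^ DIM('a)) *
        (window_integral W (k l) (k j) m (\<alpha> l) (\<alpha> j) (\<delta> t) / ?f m)) \<longlongrightarrow>
      (\<Sum>m=1..k l + 1. \<rho> m * (mu_integral TYPE('a) (k l) (k j) m (\<alpha> l) (\<alpha> j) / ?f m))) at_top"
  proof (intro tendsto_sum tendsto_mult tendsto_divide tendsto_const \<rho>)
    fix m assume "m \<in> {1..k l + 1}"
    then show "((\<lambda>t. window_integral W (k l) (k j) m (\<alpha> l) (\<alpha> j) (\<delta> t)) \<longlongrightarrow>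
        mu_integral TYPE('a) (k l) (k j) m (\<alpha> l) (\<alpha> j)) at_top"
      using le by (intro window_integral_tendsto W square_integrable l j \<delta>(2)) auto
  qed auto
  also have "(\<Sum>m=1..k l + 1. \<rho> m * (mu_integral TYPE('a) (k l) (k j) m (\<alpha> l) (\<alpha> j) / ?f m)) =
      (\<Sum>m=1..k l + 1. limit_coeff TYPE('a) (k l) (k j) (\<alpha> l) (\<alpha> j) m * \<rho> m)"
    using le by (intro sum.cong refl) (simp add: limit_coeff_def mu_def)
  finally show ?thesis
  proof (rule Lim_transform_eventually)
    show "\<forall>\<^sub>F t in at_top. (\<Sum>m=1..k l + 1. growth_ratio (k l) (k j) m (t * \<delta> t ^ DIM('a)) *
        (window_integral W (k l) (k j) m (\<alpha> l) (\<alpha> j) (\<delta> t) / ?f m)) = covariance (M t) (X t l) (X t j)"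
      using eventually_gt_at_top[of 0]
    proof eventually_elim
      case (elim t)
      then show ?case using moments(3)[OF elim l j] le by (simp add: min_absorb1)
    qed
  qed
qed

text \<open>
  \<open>mu\<close> is an integral with the smaller simplex first, so the limits are computed for \<open>k l \<le> k j\<close> and transferred by the
  symmetry of the covariance.
\<close>

lemma asymptotic_covarianceI:
  assumes sym: "\<And>l j. k l \<noteq> k j \<Longrightarrow> \<Sigma> l j = \<Sigma> j l"
    and lim: "\<And>l j. l \<in> {1..n} \<Longrightarrow> j \<in> {1..n} \<Longrightarrow> k l \<le> k j \<Longrightarrow>
      ((\<lambda>t. covariance (M t) (X t l) (X t j)) \<longlongrightarrow> \<Sigma> l j) at_top"
  shows "asymptotic_covariance n M X \<Sigma>"
  unfolding asymptotic_covariance_def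
proof (intro ballI conjI)
  fix l j assume l: "l \<in> {1..n}" and j: "j \<in> {1..n}"
  show "\<forall>\<^sub>F t in at_top. integrable (M t) (X t l) \<and> integrable (M t) (X t j) \<and>
      integrable (M t) (\<lambda>\<omega>. X t l \<omega> * X t j \<omega>)"
    using eventually_gt_at_top[of 0] by eventually_elim (intro conjI moments(1)[OF _ l j] moments(1)[OF _ j l] moments(2)[OF _ l j])
  show "((\<lambda>t. covariance (M t) (X t l) (X t j)) \<longlongrightarrow> \<Sigma> l j) at_top"
  proof (cases "k l \<le> k j")
    case True
    then show ?thesis by (rule lim[OF l j])
  next
    case False
    then have "((\<lambda>t. covariance (M t) (X t j) (X t l)) \<longlongrightarrow> \<Sigma> j l) at_top" by (intro lim l j) simp
    then show ?thesis using False sym[of l j] by (simp add: covariance_commute[of _ "X _ j"])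
  qed
qed

lemma asymptotic_covariance_lt:
  assumes x: "\<And>p q m. 1 \<le> m \<Longrightarrow> m \<le> min p q + 1 \<Longrightarrow>
    ((\<lambda>t. growth_ratio p q m (t * \<delta> t ^ DIM('a))) \<longlongrightarrow> x (p + q + 2 - 2 * m)) at_top"
  shows "asymptotic_covariance n M X (\<lambda>l j. \<Sum>i=0..2 * k n. A_lt TYPE('a) k \<alpha> i l j * x i)"
proof (rule asymptotic_covarianceI)
  fix l j assume l: "l \<in> {1..n}" and j: "j \<in> {1..n}" and le: "k l \<le> k j"
  have "k l + k j \<le> 2 * k n" using k_le[OF l] k_le[OF j] by simp
  then show "((\<lambda>t. covariance (M t) (X t l) (X t j)) \<longlongrightarrow>
      (\<Sum>i=0..2 * k n. A_lt TYPE('a) k \<alpha> i l j * x i)) at_top"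
    using le by (simp only: sum_A_lt[of k l j, OF le]) (intro covariance_tendsto l j le x, auto)
qed (simp add: A_lt_commute)

lemma asymptotic_covariance_gt:
  assumes x: "\<And>p q m. 1 \<le> m \<Longrightarrow> m \<le> min p q + 1 \<Longrightarrow>
    ((\<lambda>t. growth_ratio p q m (t * \<delta> t ^ DIM('a))) \<longlongrightarrow> x (m - 1)) at_top"
  shows "asymptotic_covariance n M X (\<lambda>l j. \<Sum>i=0..k n. A_gt TYPE('a) k \<alpha> i l j * x i)"
proof (rule asymptotic_covarianceI)
  fix l j assume l: "l \<in> {1..n}" and j: "j \<in> {1..n}" and le: "k l \<le> k j"
  show "((\<lambda>t. covariance (M t) (X t l) (X t j)) \<longlongrightarrow>
      (\<Sum>i=0..k n. A_gt TYPE('a) k \<alpha> i l j * x i)) at_top"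
    unfolding sum_A_gt[of k l j, OF le k_le[OF l]] using le
    by (intro covariance_tendsto l j le x) auto
qed (simp add: A_gt_commute)

lemma u_pos: "\<forall>\<^sub>F t in at_top. t * \<delta> t ^ DIM('a) > 0"
  using eventually_gt_at_top[of 0] by eventually_elim (simp add: \<delta>(1))

lemma sum_delta_0: "(\<Sum>i=0..N. f i * (if i = 0 then 1 else 0)) = (f 0 :: real)" for N :: nat
  by (simp add: if_distrib[of "\<lambda>r. _ * r"] cong: if_cong)

theorem sparse_regime:
  assumes "((\<lambda>t. t * \<delta> t ^ DIM('a)) \<longlongrightarrow> 0) at_top"
  shows "asymptotic_covariance n M X (A_lt TYPE('a) k \<alpha> 0)"
  using asymptotic_covariance_lt[of "\<lambda>i. if i = 0 then 1 else 0", OF growth_ratio_tendsto_0[OF u_pos assms]]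
  by (simp add: sum_delta_0)

text \<open>
  For \<open>c = 1\<close> the quantity \<open>t \<delta> ^ d\<close> may approach its limit from both sides, so the limit is taken by continuity of the growth ratio,
  and the formula for \<open>u \<le> 1\<close> is used only at the limit point \<open>c\<close>.
\<close>

theorem thermodynamic_le_1:
  assumes c: "0 < c" "c \<le> 1" and u: "((\<lambda>t. t * \<delta> t ^ DIM('a)) \<longlongrightarrow> c) at_top"
  shows "asymptotic_covariance n M X (\<lambda>l j. \<Sum>m=0..2 * k n. A_lt TYPE('a) k \<alpha> m l j * c powr (real m / 2))"
proof (rule asymptotic_covariance_lt)
  fix p q m :: nat assume m: "1 \<le> m" "m \<le> min p q + 1"
  then have "2 * m \<le> p + q + 2" by auto
  then have "real (p + q + 2 - 2 * m) = real p + real q + 2 - 2 * real m" by (simp add: of_nat_diff)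
  then show "((\<lambda>t. growth_ratio p q m (t * \<delta> t ^ DIM('a))) \<longlongrightarrow> c powr (real (p + q + 2 - 2 * m) / 2)) at_top"
    using growth_ratio_tendsto[OF c(1) u, of p q m] growth_ratio_le_1[OF c] by simp
qed

theorem thermodynamic_ge_1:
  assumes c: "1 \<le> c" and u: "((\<lambda>t. t * \<delta> t ^ DIM('a)) \<longlongrightarrow> c) at_top"
  shows "asymptotic_covariance n M X (\<lambda>l j. \<Sum>m=0..k n. A_gt TYPE('a) k \<alpha> m l j * c powr (- real m))"
proof (rule asymptotic_covariance_gt)
  fix p q m :: nat assume m: "1 \<le> m" "m \<le> min p q + 1"
  then have "- real (m - 1) = 1 - real m" by (simp add: of_nat_diff)
  then show "((\<lambda>t. growth_ratio p q m (t * \<delta> t ^ DIM('a))) \<longlongrightarrow> c powr (- real (m - 1))) at_top"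
    using growth_ratio_tendsto[of c "\<lambda>t. t * \<delta> t ^ DIM('a)" at_top p q m] c u growth_ratio_ge_1[OF c] by simp
qed

theorem dense_regime:
  assumes "filterlim (\<lambda>t. t * \<delta> t ^ DIM('a)) at_top at_top"
  shows "asymptotic_covariance n M X (A_gt TYPE('a) k \<alpha> 0)"
  using asymptotic_covariance_gt[of "\<lambda>i. if i = 0 then 1 else 0", OF growth_ratio_tendsto_top[OF assms]]
  by (simp add: sum_delta_0)

end

theorem theorem3p5:
  fixes W :: "'a::euclidean_space set"
    and M :: "real \<Rightarrow> 'w measure"
    and \<eta> :: "real \<Rightarrow> 'w \<Rightarrow> 'a set"
    and \<delta> :: "real \<Rightarrow> real"
    and n :: nat and k :: "nat \<Rightarrow> nat" and \<alpha> :: "nat \<Rightarrow> real"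
    and X :: "real \<Rightarrow> nat \<Rightarrow> 'w \<Rightarrow> real"
  defines "X \<equiv> \<lambda>t i \<omega>. vol_power_hat t (\<delta> t) (k i) (\<alpha> i) (\<eta> t \<omega>)"
  assumes W: "compact W" "convex W" "measure lborel W = 1"
    and \<eta>: "\<forall>t>0. poisson_process (M t) (intensity W t) (\<eta> t)"
    and \<delta>: "\<forall>t>0. \<delta> t > 0" "(\<delta> \<longlongrightarrow> 0) at_top"
    and n: "n \<ge> 1"
    and adm: "admissible DIM('a) n k \<alpha>"
    and fin: "\<forall>i\<in>{1..n}. mu_converges TYPE('a) (k i) (k i) (k i + 1) (\<alpha> i) (\<alpha> i)"
  shows
    "(((\<lambda>t. t * \<delta> t ^ DIM('a)) \<longlongrightarrow> 0) at_top \<longrightarrow>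
        asymptotic_covariance n M X (A_lt TYPE('a) k \<alpha> 0)) \<and>
     (\<forall>c. 0 < c \<and> c \<le> 1 \<and> ((\<lambda>t. t * \<delta> t ^ DIM('a)) \<longlongrightarrow> c) at_top \<longrightarrow>
        asymptotic_covariance n M X
          (\<lambda>l j. \<Sum>m=0..2 * k n. A_lt TYPE('a) k \<alpha> m l j * c powr (real m / 2))) \<and>
     (\<forall>c. 1 \<le> c \<and> ((\<lambda>t. t * \<delta> t ^ DIM('a)) \<longlongrightarrow> c) at_top \<longrightarrow>
        asymptotic_covariance n M X
          (\<lambda>l j. \<Sum>m=0..k n. A_gt TYPE('a) k \<alpha> m l j * c powr (- real m))) \<and>
     (filterlim (\<lambda>t. t * \<delta> t ^ DIM('a)) at_top at_top \<longrightarrow>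
        asymptotic_covariance n M X (A_gt TYPE('a) k \<alpha> 0))"
proof -
  interpret R: rips_limit W M \<eta> \<delta> n k \<alpha>
    by (rule rips_limit.intro[OF W \<eta> \<delta> adm fin])
  have "X = R.X" by (simp add: X_def R.X_def fun_eq_iff)
  then show ?thesis
    using R.sparse_regime R.thermodynamic_le_1 R.thermodynamic_ge_1 R.dense_regime by simp
qed

end
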